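(* Let $\mathbb{X}$ be an exact Mal'tsev category and $n\geq 1$. The adjunction $\mathrm{Coeq}^n\dashv \mathrm{Eq}^n$ between the category $\mathsf{RGrph}^n(\mathbb{X})$ of $n$-fold reflexive graphs and the category $\mathsf{Arr}^n(\mathbb{X})$ of $n$-fold arrows restricts to an equivalence of categories $\mathsf{EERel}^n(\mathbb{X})\simeq \mathsf{Reg}^n(\mathbb{X})$ between the category of $n$-fold effective equivalence relations and the category of $n$-fold regular epimorphisms.
   Context: An exact Mal'tsev category is a Barr exact category in which every (internal) reflexive relation is an equivalence relation; in it every reflexive graph has a coequaliser. $\mathsf{Arr}(\mathbb{X})$ is the category of arrows of $\mathbb{X}$ and $\mathsf{Arr}^n(\mathbb{X})=\mathsf{Arr}(\mathsf{Arr}^{n-1}(\mathbb{X}))$, whose objects are commutative $n$-cubes. $\mathsf{RGrph}(\mathbb{X})$ is the category of reflexive graphs $(d,c\colon G\rightrightarrows X,\ e\colon X\to G,\ de=1_X=ce)$ in $\mathbb{X}$ and $\mathsf{RGrph}^n(\mathbb{X})=\mathsf{RGrph}(\mathsf{RGrph}^{n-1}(\mathbb{X}))$. $\mathrm{Coeq}\colon \mathsf{RGrph}(\mathbb{X})\to\mathsf{Arr}(\mathbb{X})$ sends a reflexive graph to the coequaliser of $d$ and $c$; its right adjoint $\mathrm{Eq}$ sends an arrow to its kernel pair (with the diagonal as splitting). For $n\geq 2$, $\mathrm{Coeq}^n=\mathsf{Arr}(\mathrm{Coeq}^{n-1})\circ\mathrm{Coeq}$ and $\mathrm{Eq}^n=\mathrm{Eq}\circ\mathsf{Arr}(\mathrm{Eq}^{n-1})$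 (coequalisers and kernel pairs being computed pointwise); $\mathrm{Coeq}^n$ is left adjoint to $\mathrm{Eq}^n$. An $n$-fold effective equivalence relation is an $n$-fold reflexive graph in the replete image of $\mathrm{Eq}^n$; these form the full subcategory $\mathsf{EERel}^n(\mathbb{X})$ of $\mathsf{RGrph}^n(\mathbb{X})$. $\mathsf{Reg}(\mathbb{X})$ is the full subcategory of $\mathsf{Arr}(\mathbb{X})$ determined by the regular epimorphisms, and $\mathsf{Reg}^n(\mathbb{X})=\mathsf{Reg}(\mathsf{Reg}^{n-1}(\mathbb{X}))$ is the full subcategory of $\mathsf{Arr}^n(\mathbb{X})$ of $n$-fold regular epimorphisms: the $n$-cubes all of whose arrows are regular epimorphisms and all of whose squares are pushouts in $\mathbb{X}$. *)

theory Defs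
  imports Main
begin

section \<open>Categories, functors, adjunctions\<close>

record ('o, 'm) cat =
  Obj :: "'o set"
  Mor :: "'m set"
  Dom :: "'m \<Rightarrow> 'o"
  Cod :: "'m \<Rightarrow> 'o"
  Ide :: "'o \<Rightarrow> 'm"
  Comp :: "'m \<Rightarrow> 'm \<Rightarrow> 'm"  (infixl "\<cdot>\<index>" 70)

definition Hom :: "('o, 'm) cat \<Rightarrow> 'o \<Rightarrow> 'o \<Rightarrow> 'm set" where
  "Hom C a b = {f \<in> Mor C. Dom C f = a \<and> Cod C f = b}"

text \<open>Composition is written in applicative order: \<open>g \<cdot> f\<close> is \<open>g\<close> after \<open>f\<close>.\<close>

locale category =
  fixes C :: "('o, 'm) cat" (structure)
  assumes Dom_in: "f \<in> Mor C \<Longrightarrow> Dom C f \<in> Obj C"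
    and Cod_in: "f \<in> Mor C \<Longrightarrow> Cod C f \<in> Obj C"
    and Ide_in: "a \<in> Obj C \<Longrightarrow> Ide C a \<in> Hom C a a"
    and Comp_in: "f \<in> Hom C a b \<Longrightarrow> g \<in> Hom C b c \<Longrightarrow> g \<cdot> f \<in> Hom C a c"
    and Comp_assoc: "f \<in> Hom C a b \<Longrightarrow> g \<in> Hom C b c \<Longrightarrow> h \<in> Hom C c d \<Longrightarrow>
           (h \<cdot> g) \<cdot> f = h \<cdot> (g \<cdot> f)"
    and Comp_Ide: "f \<in> Hom C a b \<Longrightarrow> f \<cdot> Ide C a = f"
    and Ide_Comp: "f \<in> Hom C a b \<Longrightarrow> Ide C b \<cdot> f = f"

definition is_iso :: "('o, 'm) cat \<Rightarrow> 'm \<Rightarrow> bool" where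
  "is_iso C f \<longleftrightarrow> f \<in> Mor C \<and>
     (\<exists>g \<in> Hom C (Cod C f) (Dom C f).
        g \<cdot>\<^bsub>C\<^esub> f = Ide C (Dom C f) \<and> f \<cdot>\<^bsub>C\<^esub> g = Ide C (Cod C f))"

definition isomorphic :: "('o, 'm) cat \<Rightarrow> 'o \<Rightarrow> 'o \<Rightarrow> bool" where
  "isomorphic C a b \<longleftrightarrow> (\<exists>f \<in> Hom C a b. is_iso C f)"

definition full_subcat_on :: "('o, 'm) cat \<Rightarrow> 'o set \<Rightarrow> ('o, 'm) cat" where
  "full_subcat_on C S =
     C\<lparr>Obj := Obj C \<inter> S, Mor := {f \<in> Mor C. Dom C f \<in> S \<and> Cod C f \<in> S}\<rparr>"

definition is_full_subcat :: "('o, 'm) cat \<Rightarrow> ('o, 'm) cat \<Rightarrow> bool" where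
  "is_full_subcat D C \<longleftrightarrow> category C \<and> category D \<and>
     Obj D \<subseteq> Obj C \<and>
     Mor D = {f \<in> Mor C. Dom C f \<in> Obj D \<and> Cod C f \<in> Obj D} \<and>
     (\<forall>f \<in> Mor D. Dom D f = Dom C f \<and> Cod D f = Cod C f) \<and>
     (\<forall>a \<in> Obj D. Ide D a = Ide C a) \<and>
     (\<forall>f \<in> Mor D. \<forall>g \<in> Mor D. Dom D g = Cod D f \<longrightarrow> g \<cdot>\<^bsub>D\<^esub> f = g \<cdot>\<^bsub>C\<^esub> f)"

record ('o1, 'm1, 'o2, 'm2) func =
  FObj :: "'o1 \<Rightarrow> 'o2"
  FMor :: "'m1 \<Rightarrow> 'm2"

definition is_functor ::
  "('o1, 'm1) cat \<Rightarrow> ('o2, 'm2) cat \<Rightarrow> ('o1, 'm1, 'o2, 'm2) func \<Rightarrow> bool" where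
  "is_functor C D F \<longleftrightarrow> category C \<and> category D \<and>
     (\<forall>a \<in> Obj C. FObj F a \<in> Obj D) \<and>
     (\<forall>f \<in> Mor C. FMor F f \<in> Hom D (FObj F (Dom C f)) (FObj F (Cod C f))) \<and>
     (\<forall>a \<in> Obj C. FMor F (Ide C a) = Ide D (FObj F a)) \<and>
     (\<forall>f \<in> Mor C. \<forall>g \<in> Mor C. Dom C g = Cod C f \<longrightarrow>
        FMor F (g \<cdot>\<^bsub>C\<^esub> f) = FMor F g \<cdot>\<^bsub>D\<^esub> FMor F f)"

definition id_func :: "('o, 'm, 'o, 'm) func" where
  "id_func = \<lparr>FObj = \<lambda>a. a, FMor = \<lambda>f. f\<rparr>"

definition comp_func ::
  "('o2, 'm2, 'o3, 'm3) func \<Rightarrow> ('o1, 'm1, 'o2, 'm2) func \<Rightarrow> ('o1, 'm1, 'o3, 'm3) func"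
  (infixl "\<circ>\<^sub>F" 55) where
  "G \<circ>\<^sub>F F = \<lparr>FObj = \<lambda>a. FObj G (FObj F a), FMor = \<lambda>f. FMor G (FMor F f)\<rparr>"

definition is_nat_trans ::
  "('o1, 'm1) cat \<Rightarrow> ('o2, 'm2) cat \<Rightarrow> ('o1, 'm1, 'o2, 'm2) func \<Rightarrow>
   ('o1, 'm1, 'o2, 'm2) func \<Rightarrow> ('o1 \<Rightarrow> 'm2) \<Rightarrow> bool" where
  "is_nat_trans C D F G t \<longleftrightarrow> is_functor C D F \<and> is_functor C D G \<and>
     (\<forall>a \<in> Obj C. t a \<in> Hom D (FObj F a) (FObj G a)) \<and>
     (\<forall>f \<in> Mor C. t (Cod C f) \<cdot>\<^bsub>D\<^esub> FMor F f = FMor G f \<cdot>\<^bsub>D\<^esub> t (Dom C f))"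

definition is_nat_iso ::
  "('o1, 'm1) cat \<Rightarrow> ('o2, 'm2) cat \<Rightarrow> ('o1, 'm1, 'o2, 'm2) func \<Rightarrow>
   ('o1, 'm1, 'o2, 'm2) func \<Rightarrow> ('o1 \<Rightarrow> 'm2) \<Rightarrow> bool" where
  "is_nat_iso C D F G t \<longleftrightarrow> is_nat_trans C D F G t \<and> (\<forall>a \<in> Obj C. is_iso D (t a))"

text \<open>\<open>F : C \<rightarrow> D\<close> is left adjoint to \<open>G : D \<rightarrow> C\<close> with unit \<open>\<eta>\<close> and counit \<open>\<epsilon>\<close>.\<close>

definition is_adjunction ::
  "('o1, 'm1) cat \<Rightarrow> ('o2, 'm2) cat \<Rightarrow> ('o1, 'm1, 'o2, 'm2) func \<Rightarrow>
   ('o2, 'm2, 'o1, 'm1) func \<Rightarrow> ('o1 \<Rightarrow> 'm1) \<Rightarrow> ('o2 \<Rightarrow> 'm2) \<Rightarrow> bool" where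
  "is_adjunction C D F G \<eta> \<epsilon> \<longleftrightarrow>
     is_functor C D F \<and> is_functor D C G \<and>
     is_nat_trans C C id_func (G \<circ>\<^sub>F F) \<eta> \<and>
     is_nat_trans D D (F \<circ>\<^sub>F G) id_func \<epsilon> \<and>
     (\<forall>a \<in> Obj C. \<epsilon> (FObj F a) \<cdot>\<^bsub>D\<^esub> FMor F (\<eta> a) = Ide D (FObj F a)) \<and>
     (\<forall>b \<in> Obj D. FMor G (\<epsilon> b) \<cdot>\<^bsub>C\<^esub> \<eta> (FObj G b) = Ide C (FObj G b))"

definition is_equivalence ::
  "('o1, 'm1) cat \<Rightarrow> ('o2, 'm2) cat \<Rightarrow> ('o1, 'm1, 'o2, 'm2) func \<Rightarrow>
   ('o2, 'm2, 'o1, 'm1) func \<Rightarrow> ('o1 \<Rightarrow> 'm1) \<Rightarrow> ('o2 \<Rightarrow> 'm2) \<Rightarrow> bool" where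
  "is_equivalence C D F G \<eta> \<epsilon> \<longleftrightarrow>
     is_functor C D F \<and> is_functor D C G \<and>
     is_nat_iso C C id_func (G \<circ>\<^sub>F F) \<eta> \<and>
     is_nat_iso D D (F \<circ>\<^sub>F G) id_func \<epsilon>"

text \<open>
  The data of an adjunction \<open>C \<rightleftarrows> D\<close> restrict to an equivalence between full subcategories
  \<open>C'\<close> and \<open>D'\<close>. Functors and transformations are total functions on the underlying types, so
  their restrictions are given by the same functions.
\<close>

definition restricts_to_equivalence ::
  "('o1, 'm1) cat \<Rightarrow> ('o2, 'm2) cat \<Rightarrow> ('o1, 'm1, 'o2, 'm2) func \<Rightarrow>
   ('o2, 'm2, 'o1, 'm1) func \<Rightarrow> ('o1 \<Rightarrow> 'm1) \<Rightarrow> ('o2 \<Rightarrow> 'm2) \<Rightarrow>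
   ('o1, 'm1) cat \<Rightarrow> ('o2, 'm2) cat \<Rightarrow> bool" where
  "restricts_to_equivalence C D F G \<eta> \<epsilon> C' D' \<longleftrightarrow>
     is_adjunction C D F G \<eta> \<epsilon> \<and>
     is_full_subcat C' C \<and> is_full_subcat D' D \<and>
     is_equivalence C' D' F G \<eta> \<epsilon>"


section \<open>Limits, coequalisers, exact Mal'tsev categories\<close>

definition is_terminal :: "('o, 'm) cat \<Rightarrow> 'o \<Rightarrow> bool" where
  "is_terminal C t \<longleftrightarrow> t \<in> Obj C \<and> (\<forall>a \<in> Obj C. \<exists>!f. f \<in> Hom C a t)"

definition is_pullback :: "('o, 'm) cat \<Rightarrow> 'm \<Rightarrow> 'm \<Rightarrow> 'm \<Rightarrow> 'm \<Rightarrow> bool" where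
  "is_pullback C f g p q \<longleftrightarrow>
     f \<in> Mor C \<and> g \<in> Mor C \<and> p \<in> Mor C \<and> q \<in> Mor C \<and>
     Cod C f = Cod C g \<and> Dom C p = Dom C q \<and> Cod C p = Dom C f \<and> Cod C q = Dom C g \<and>
     f \<cdot>\<^bsub>C\<^esub> p = g \<cdot>\<^bsub>C\<^esub> q \<and>
     (\<forall>a \<in> Obj C. \<forall>x \<in> Hom C a (Dom C f). \<forall>y \<in> Hom C a (Dom C g).
        f \<cdot>\<^bsub>C\<^esub> x = g \<cdot>\<^bsub>C\<^esub> y \<longrightarrow>
        (\<exists>!u. u \<in> Hom C a (Dom C p) \<and> p \<cdot>\<^bsub>C\<^esub> u = x \<and> q \<cdot>\<^bsub>C\<^esub> u = y))"

definition is_kernel_pair :: "('o, 'm) cat \<Rightarrow> 'm \<Rightarrow> 'm \<Rightarrow> 'm \<Rightarrow> bool" where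
  "is_kernel_pair C f p q \<longleftrightarrow> is_pullback C f f p q"

definition is_coequaliser :: "('o, 'm) cat \<Rightarrow> 'm \<Rightarrow> 'm \<Rightarrow> 'm \<Rightarrow> bool" where
  "is_coequaliser C f g q \<longleftrightarrow>
     f \<in> Mor C \<and> g \<in> Mor C \<and> q \<in> Mor C \<and>
     Dom C f = Dom C g \<and> Cod C f = Cod C g \<and> Dom C q = Cod C f \<and>
     q \<cdot>\<^bsub>C\<^esub> f = q \<cdot>\<^bsub>C\<^esub> g \<and>
     (\<forall>b \<in> Obj C. \<forall>x \<in> Hom C (Cod C f) b. x \<cdot>\<^bsub>C\<^esub> f = x \<cdot>\<^bsub>C\<^esub> g \<longrightarrow>
        (\<exists>!w. w \<in> Hom C (Cod C q) b \<and> w \<cdot>\<^bsub>C\<^esub> q = x))"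

definition regular_epi :: "('o, 'm) cat \<Rightarrow> 'm \<Rightarrow> bool" where
  "regular_epi C q \<longleftrightarrow> (\<exists>f g. is_coequaliser C f g q)"

text \<open>All finite limits, generated by a terminal object and pullbacks.\<close>

definition finitely_complete :: "('o, 'm) cat \<Rightarrow> bool" where
  "finitely_complete C \<longleftrightarrow>
     (\<exists>t. is_terminal C t) \<and>
     (\<forall>f \<in> Mor C. \<forall>g \<in> Mor C. Cod C f = Cod C g \<longrightarrow> (\<exists>p q. is_pullback C f g p q))"

definition regular_category :: "('o, 'm) cat \<Rightarrow> bool" where
  "regular_category C \<longleftrightarrow> category C \<and> finitely_complete C \<and>
     (\<forall>f p q. is_kernel_pair C f p q \<longrightarrow> (\<exists>r. is_coequaliser C p q r)) \<and>
     (\<forall>f g p q. is_pullback C f g p q \<and> regular_epi C f \<longrightarrow> regular_epi C q)"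

text \<open>An internal relation on \<open>a\<close> is a jointly monic pair \<open>r\<^sub>0, r\<^sub>1 : r \<rightarrow> a\<close>.\<close>

definition is_relation :: "('o, 'm) cat \<Rightarrow> 'o \<Rightarrow> 'm \<Rightarrow> 'm \<Rightarrow> bool" where
  "is_relation C a r0 r1 \<longleftrightarrow>
     r0 \<in> Mor C \<and> r1 \<in> Mor C \<and> Dom C r0 = Dom C r1 \<and> Cod C r0 = a \<and> Cod C r1 = a \<and>
     (\<forall>b \<in> Obj C. \<forall>x \<in> Hom C b (Dom C r0). \<forall>y \<in> Hom C b (Dom C r0).
        r0 \<cdot>\<^bsub>C\<^esub> x = r0 \<cdot>\<^bsub>C\<^esub> y \<and> r1 \<cdot>\<^bsub>C\<^esub> x = r1 \<cdot>\<^bsub>C\<^esub> y \<longrightarrow> x = y)"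

definition is_reflexive_relation :: "('o, 'm) cat \<Rightarrow> 'o \<Rightarrow> 'm \<Rightarrow> 'm \<Rightarrow> bool" where
  "is_reflexive_relation C a r0 r1 \<longleftrightarrow> is_relation C a r0 r1 \<and>
     (\<exists>e \<in> Hom C a (Dom C r0). r0 \<cdot>\<^bsub>C\<^esub> e = Ide C a \<and> r1 \<cdot>\<^bsub>C\<^esub> e = Ide C a)"

definition is_equivalence_relation :: "('o, 'm) cat \<Rightarrow> 'o \<Rightarrow> 'm \<Rightarrow> 'm \<Rightarrow> bool" where
  "is_equivalence_relation C a r0 r1 \<longleftrightarrow> is_reflexive_relation C a r0 r1 \<and>
     (\<exists>s \<in> Hom C (Dom C r0) (Dom C r0). r0 \<cdot>\<^bsub>C\<^esub> s = r1 \<and> r1 \<cdot>\<^bsub>C\<^esub> s = r0) \<and>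
     (\<forall>p q. is_pullback C r1 r0 p q \<longrightarrow>
        (\<exists>t \<in> Hom C (Dom C p) (Dom C r0).
           r0 \<cdot>\<^bsub>C\<^esub> t = r0 \<cdot>\<^bsub>C\<^esub> p \<and> r1 \<cdot>\<^bsub>C\<^esub> t = r1 \<cdot>\<^bsub>C\<^esub> q))"

definition Barr_exact_category :: "('o, 'm) cat \<Rightarrow> bool" where
  "Barr_exact_category C \<longleftrightarrow> regular_category C \<and>
     (\<forall>a r0 r1. is_equivalence_relation C a r0 r1 \<longrightarrow> (\<exists>f. is_kernel_pair C f r0 r1))"

definition exact_Maltsev_category :: "('o, 'm) cat \<Rightarrow> bool" where
  "exact_Maltsev_category C \<longleftrightarrow> Barr_exact_category C \<and>
     (\<forall>a r0 r1. is_reflexive_relation C a r0 r1 \<longrightarrow> is_equivalence_relation C a r0 r1)"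


section \<open>Arrows and reflexive graphs\<close>

text \<open>
  To iterate \<open>Arr\<close> and \<open>RGrph\<close> a variable number of times, all cells live in one type. An object
  of \<open>Arr(C)\<close> is a morphism of \<open>C\<close> itself; \<open>ArrMor f g u v\<close> is the commutative square
  \<open>v \<cdot> f = g \<cdot> u\<close>, seen as a morphism from \<open>f\<close> to \<open>g\<close>; \<open>RG d c e\<close> is a reflexive graph with
  domain, codomain and splitting \<open>d, c, e\<close>; \<open>RGMor G H u v\<close> is a morphism from \<open>G\<close> to \<open>H\<close>
  with component \<open>u\<close> on edges and \<open>v\<close> on vertices.
\<close>

datatype ('o, 'm) cell =
    ObjCell (obj_of: 'o)
  | MorCell (mor_of: 'm)
  | ArrMor (arr_src: "('o, 'm) cell") (arr_tgt: "('o, 'm) cell")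
      (on_dom: "('o, 'm) cell") (on_cod: "('o, 'm) cell")
  | RG (rg_d: "('o, 'm) cell") (rg_c: "('o, 'm) cell") (rg_e: "('o, 'm) cell")
  | RGMor (rg_src: "('o, 'm) cell") (rg_tgt: "('o, 'm) cell")
      (on_edges: "('o, 'm) cell") (on_verts: "('o, 'm) cell")

type_synonym ('o, 'm) ccat = "(('o, 'm) cell, ('o, 'm) cell) cat"
type_synonym ('o, 'm) cfunc =
  "(('o, 'm) cell, ('o, 'm) cell, ('o, 'm) cell, ('o, 'm) cell) func"

text \<open>The isomorphic copy of \<open>X\<close> inside the type of cells.\<close>

definition base :: "('o, 'm) cat \<Rightarrow> ('o, 'm) ccat" where
  "base X = \<lparr>
     Obj = ObjCell ` Obj X,
     Mor = MorCell ` Mor X,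
     Dom = \<lambda>f. ObjCell (Dom X (mor_of f)),
     Cod = \<lambda>f. ObjCell (Cod X (mor_of f)),
     Ide = \<lambda>a. MorCell (Ide X (obj_of a)),
     Comp = \<lambda>g f. MorCell (mor_of g \<cdot>\<^bsub>X\<^esub> mor_of f)\<rparr>"

definition Arr :: "('o, 'm) ccat \<Rightarrow> ('o, 'm) ccat" where
  "Arr C = \<lparr>
     Obj = Mor C,
     Mor = {ArrMor f g u v | f g u v. f \<in> Mor C \<and> g \<in> Mor C \<and>
              u \<in> Hom C (Dom C f) (Dom C g) \<and> v \<in> Hom C (Cod C f) (Cod C g) \<and>
              v \<cdot>\<^bsub>C\<^esub> f = g \<cdot>\<^bsub>C\<^esub> u},
     Dom = arr_src,
     Cod = arr_tgt,
     Ide = \<lambda>f. ArrMor f f (Ide C (Dom C f)) (Ide C (Cod C f)),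
     Comp = \<lambda>t s. ArrMor (arr_src s) (arr_tgt t)
                    (on_dom t \<cdot>\<^bsub>C\<^esub> on_dom s) (on_cod t \<cdot>\<^bsub>C\<^esub> on_cod s)\<rparr>"

definition Arr_func :: "('o, 'm) cfunc \<Rightarrow> ('o, 'm) cfunc" where
  "Arr_func F = \<lparr>
     FObj = FMor F,
     FMor = \<lambda>s. ArrMor (FMor F (arr_src s)) (FMor F (arr_tgt s))
                  (FMor F (on_dom s)) (FMor F (on_cod s))\<rparr>"

definition is_reflexive_graph :: "('o, 'm) cat \<Rightarrow> 'm \<Rightarrow> 'm \<Rightarrow> 'm \<Rightarrow> bool" where
  "is_reflexive_graph C d c e \<longleftrightarrow>
     d \<in> Mor C \<and> c \<in> Hom C (Dom C d) (Cod C d) \<and> e \<in> Hom C (Cod C d) (Dom C d) \<and>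
     d \<cdot>\<^bsub>C\<^esub> e = Ide C (Cod C d) \<and> c \<cdot>\<^bsub>C\<^esub> e = Ide C (Cod C d)"

definition rg_edges :: "('o, 'm) ccat \<Rightarrow> ('o, 'm) cell \<Rightarrow> ('o, 'm) cell" where
  "rg_edges C G = Dom C (rg_d G)"

definition rg_verts :: "('o, 'm) ccat \<Rightarrow> ('o, 'm) cell \<Rightarrow> ('o, 'm) cell" where
  "rg_verts C G = Cod C (rg_d G)"

definition RGrph_objs :: "('o, 'm) ccat \<Rightarrow> ('o, 'm) cell set" where
  "RGrph_objs C = {RG d c e | d c e. is_reflexive_graph C d c e}"

definition RGrph :: "('o, 'm) ccat \<Rightarrow> ('o, 'm) ccat" where
  "RGrph C = \<lparr>
     Obj = RGrph_objs C,
     Mor = {RGMor G H u v | G H u v. G \<in> RGrph_objs C \<and> H \<in> RGrph_objs C \<and>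
              u \<in> Hom C (rg_edges C G) (rg_edges C H) \<and>
              v \<in> Hom C (rg_verts C G) (rg_verts C H) \<and>
              rg_d H \<cdot>\<^bsub>C\<^esub> u = v \<cdot>\<^bsub>C\<^esub> rg_d G \<and>
              rg_c H \<cdot>\<^bsub>C\<^esub> u = v \<cdot>\<^bsub>C\<^esub> rg_c G \<and>
              u \<cdot>\<^bsub>C\<^esub> rg_e G = rg_e H \<cdot>\<^bsub>C\<^esub> v},
     Dom = rg_src,
     Cod = rg_tgt,
     Ide = \<lambda>G. RGMor G G (Ide C (rg_edges C G)) (Ide C (rg_verts C G)),
     Comp = \<lambda>t s. RGMor (rg_src s) (rg_tgt t)
                    (on_edges t \<cdot>\<^bsub>C\<^esub> on_edges s) (on_verts t \<cdot>\<^bsub>C\<^esub> on_verts s)\<rparr>"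


section \<open>Coequalisers and kernel pairs as functors\<close>

text \<open>
  \<open>Coeq\<close> and \<open>Eq\<close> are defined, through a choice of coequalisers and kernel pairs, over any
  category \<open>C\<close> in which the coequalisers (of reflexive graphs) and the kernel pairs exist.
\<close>

definition coeq_of :: "('o, 'm) ccat \<Rightarrow> ('o, 'm) cell \<Rightarrow> ('o, 'm) cell" where
  "coeq_of C G = (SOME q. is_coequaliser C (rg_d G) (rg_c G) q)"

definition Coeq :: "('o, 'm) ccat \<Rightarrow> ('o, 'm) cfunc" where
  "Coeq C = \<lparr>
     FObj = coeq_of C,
     FMor = \<lambda>s. let q = coeq_of C (rg_src s); q' = coeq_of C (rg_tgt s) in
       ArrMor q q' (on_verts s)
         (THE w. w \<in> Hom C (Cod C q) (Cod C q') \<and> w \<cdot>\<^bsub>C\<^esub> q = q' \<cdot>\<^bsub>C\<^esub> on_verts s)\<rparr>"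

definition kernel_pair_of ::
  "('o, 'm) ccat \<Rightarrow> ('o, 'm) cell \<Rightarrow> ('o, 'm) cell \<times> ('o, 'm) cell" where
  "kernel_pair_of C f = (SOME (p, q). is_kernel_pair C f p q)"

definition eq_of :: "('o, 'm) ccat \<Rightarrow> ('o, 'm) cell \<Rightarrow> ('o, 'm) cell" where
  "eq_of C f = (let (p, q) = kernel_pair_of C f in
     RG p q (THE e. e \<in> Hom C (Dom C f) (Dom C p) \<and>
               p \<cdot>\<^bsub>C\<^esub> e = Ide C (Dom C f) \<and> q \<cdot>\<^bsub>C\<^esub> e = Ide C (Dom C f)))"

definition Eq :: "('o, 'm) ccat \<Rightarrow> ('o, 'm) cfunc" where
  "Eq C = \<lparr>
     FObj = eq_of C,
     FMor = \<lambda>s. let G = eq_of C (arr_src s); H = eq_of C (arr_tgt s) in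
       RGMor G H
         (THE w. w \<in> Hom C (rg_edges C G) (rg_edges C H) \<and>
            rg_d H \<cdot>\<^bsub>C\<^esub> w = on_dom s \<cdot>\<^bsub>C\<^esub> rg_d G \<and>
            rg_c H \<cdot>\<^bsub>C\<^esub> w = on_dom s \<cdot>\<^bsub>C\<^esub> rg_c G)
         (on_dom s)\<rparr>"


section \<open>The n-fold constructions\<close>

definition Arr_n :: "nat \<Rightarrow> ('o, 'm) cat \<Rightarrow> ('o, 'm) ccat" where
  "Arr_n n X = (Arr ^^ n) (base X)"

definition RGrph_n :: "nat \<Rightarrow> ('o, 'm) cat \<Rightarrow> ('o, 'm) ccat" where
  "RGrph_n n X = (RGrph ^^ n) (base X)"

text \<open>
  Starting from the identity functor at \<open>n = 0\<close> gives \<open>Coeq\<close> and \<open>Eq\<close> at \<open>n = 1\<close>, since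
  \<open>Arr_func\<close> preserves identities.
\<close>

primrec Coeq_n :: "nat \<Rightarrow> ('o, 'm) cat \<Rightarrow> ('o, 'm) cfunc" where
  "Coeq_n 0 X = id_func"
| "Coeq_n (Suc n) X = Arr_func (Coeq_n n X) \<circ>\<^sub>F Coeq (RGrph_n n X)"

primrec Eq_n :: "nat \<Rightarrow> ('o, 'm) cat \<Rightarrow> ('o, 'm) cfunc" where
  "Eq_n 0 X = id_func"
| "Eq_n (Suc n) X = Eq (RGrph_n n X) \<circ>\<^sub>F Arr_func (Eq_n n X)"

definition EERel_n :: "nat \<Rightarrow> ('o, 'm) cat \<Rightarrow> ('o, 'm) ccat" where
  "EERel_n n X = full_subcat_on (RGrph_n n X)
     {G. \<exists>A \<in> Obj (Arr_n n X). isomorphic (RGrph_n n X) G (FObj (Eq_n n X) A)}"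

definition Reg :: "('o, 'm) ccat \<Rightarrow> ('o, 'm) ccat" where
  "Reg C = full_subcat_on (Arr C) {f. regular_epi C f}"

definition Reg_n :: "nat \<Rightarrow> ('o, 'm) cat \<Rightarrow> ('o, 'm) ccat" where
  "Reg_n n X = (Reg ^^ n) (base X)"

end

theory Submission
  imports Defs
begin

text \<open>Write \<open>F\<close> and \<open>G\<close> for \<open>Coeq\<^sup>n\<close> and \<open>Eq\<^sup>n\<close>. Exactness and the Mal'tsev condition enter only through
  the existence of kernel pairs and of coequalisers of reflexive graphs, properties which \<open>RGrph\<close>
  inherits pointwise from its base. Given these, the adjunction is idempotent: \<open>G\<close> is full and
  faithful at every object \<open>F a\<close> (bijective on morphisms out of it), and an idempotent adjunction
  restricts to an equivalence between the replete image of \<open>G\<close> and the objects at which \<open>G\<close> is full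
  and faithful. By induction on \<open>n\<close> the latter are the \<open>n\<close>-fold regular epimorphisms: a morphism \<open>q\<close> of
  \<open>n\<close>-cubes, as an object one dimension up, has this property iff its domain and codomain have it and
  \<open>q\<close> is a coequaliser among the objects that have it, namely of the transposes of the kernel pair
  of \<open>G q\<close>.\<close>

section \<open>Computing in categories\<close>

text \<open>A kernel pair sees an arrow only through its image, so \<open>Eq\<close> is in general
  not full and faithful on all arrows. One dimension up the obstacle is a mismatch: a regular
  epimorphism of \<open>Reg_n\<close> is a coequaliser tested inside the subcategory only, while
  full faithfulness at \<open>q\<close> is tested against all arrows \<open>r\<close> of
  \<open>n\<close>-cubes, whose ends are arbitrary. The counit closes this gap. By idempotency every
  \<open>F G b\<close> belongs to the subcategory, and maps from its objects to any cube
  \<open>b\<close> lift along \<open>\<epsilon> b : F G b -> b\<close>; the subcategory is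
  coreflective, and coequalisers in it can be used against all cubes. Idempotency is therefore
  carried through the induction together with the description of \<open>Reg_n\<close>. Conversely,
  the kernel pair of \<open>G q\<close> consists of \<open>n\<close>-fold graphs, not of cubes.
  Transposing its projections gives a parallel pair starting at a value of \<open>F\<close>, which
  lies in the subcategory. Pushout squares are never handled, since \<open>Reg_n\<close> is used
  through its iterated definition.\<close>

lemma in_Hom_iff [simp]: "f \<in> Hom C a b \<longleftrightarrow> f \<in> Mor C \<and> Dom C f = a \<and> Cod C f = b"
  by (auto simp: Hom_def)

lemma in_HomE: "f \<in> Hom C a b \<Longrightarrow> (f \<in> Mor C \<Longrightarrow> Dom C f = a \<Longrightarrow> Cod C f = b \<Longrightarrow> P) \<Longrightarrow> P"
  by simp

lemma category_Dom_Obj [simp]: "category C \<Longrightarrow> f \<in> Mor C \<Longrightarrow> Dom C f \<in> Obj C"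
  by (rule category.Dom_in)

lemma category_Cod_Obj [simp]: "category C \<Longrightarrow> f \<in> Mor C \<Longrightarrow> Cod C f \<in> Obj C"
  by (rule category.Cod_in)

lemma category_Ide [simp]:
  assumes "category C" "a \<in> Obj C"
  shows "Ide C a \<in> Mor C" "Dom C (Ide C a) = a" "Cod C (Ide C a) = a"
  using category.Ide_in[OF assms] by auto

lemma category_Comp [simp]:
  assumes "category C" "f \<in> Mor C" "g \<in> Mor C" "Dom C g = Cod C f"
  shows "g \<cdot>\<^bsub>C\<^esub> f \<in> Mor C" "Dom C (g \<cdot>\<^bsub>C\<^esub> f) = Dom C f" "Cod C (g \<cdot>\<^bsub>C\<^esub> f) = Cod C g"
  using category.Comp_in[OF assms(1), of f "Dom C f" "Cod C f" g "Cod C g"] assms by auto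

lemma category_assoc:
  assumes "category C" "f \<in> Mor C" "g \<in> Mor C" "h \<in> Mor C" "Dom C g = Cod C f" "Dom C h = Cod C g"
  shows "h \<cdot>\<^bsub>C\<^esub> g \<cdot>\<^bsub>C\<^esub> f = h \<cdot>\<^bsub>C\<^esub> (g \<cdot>\<^bsub>C\<^esub> f)"
  using category.Comp_assoc[OF assms(1), of f "Dom C f" "Cod C f" g "Cod C g" h "Cod C h"] assms
  by auto

lemma category_Comp_Ide [simp]:
  "category C \<Longrightarrow> f \<in> Mor C \<Longrightarrow> Dom C f = a \<Longrightarrow> f \<cdot>\<^bsub>C\<^esub> Ide C a = f"
  using category.Comp_Ide[of C f a "Cod C f"] by auto

lemma category_Ide_Comp [simp]:
  "category C \<Longrightarrow> f \<in> Mor C \<Longrightarrow> Cod C f = b \<Longrightarrow> Ide C b \<cdot>\<^bsub>C\<^esub> f = f"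
  using category.Ide_Comp[of C f "Dom C f" b] by auto

text \<open>Morphisms of \<open>Arr\<close> are commuting squares, and morphisms of
  \<open>RGrph\<close> are triples of them, one for each of d, c and e. Closure under composition
  reduces to this pasting in both cases.\<close>

lemma paste_squares:
  assumes "category C" "f \<in> Mor C" "g \<in> Mor C" "h \<in> Mor C"
    "u \<in> Hom C (Dom C f) (Dom C g)" "v \<in> Hom C (Cod C f) (Cod C g)"
    "u' \<in> Hom C (Dom C g) (Dom C h)" "v' \<in> Hom C (Cod C g) (Cod C h)"
    and uv: "v \<cdot>\<^bsub>C\<^esub> f = g \<cdot>\<^bsub>C\<^esub> u" and uv': "v' \<cdot>\<^bsub>C\<^esub> g = h \<cdot>\<^bsub>C\<^esub> u'"
  shows "v' \<cdot>\<^bsub>C\<^esub> v \<cdot>\<^bsub>C\<^esub> f = h \<cdot>\<^bsub>C\<^esub> (u' \<cdot>\<^bsub>C\<^esub> u)"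
proof -
  have "v' \<cdot>\<^bsub>C\<^esub> v \<cdot>\<^bsub>C\<^esub> f = v' \<cdot>\<^bsub>C\<^esub> (g \<cdot>\<^bsub>C\<^esub> u)"
    using assms(1-8) by (simp add: category_assoc flip: uv)
  also have "\<dots> = v' \<cdot>\<^bsub>C\<^esub> g \<cdot>\<^bsub>C\<^esub> u"
    using assms(1-8) by (simp add: category_assoc)
  also have "\<dots> = h \<cdot>\<^bsub>C\<^esub> (u' \<cdot>\<^bsub>C\<^esub> u)" using assms(1-8) by (simp only: uv') (simp add: category_assoc)
  finally show ?thesis .
qed

lemma category_Comp_left_cong:
  assumes "category C" "g \<cdot>\<^bsub>C\<^esub> f = g' \<cdot>\<^bsub>C\<^esub> f'" "f \<in> Mor C" "f' \<in> Mor C" "g \<in> Mor C" "g' \<in> Mor C"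
    "h \<in> Mor C" "Dom C g = Cod C f" "Dom C g' = Cod C f'" "Dom C f = Cod C h" "Dom C f' = Cod C h"
  shows "g \<cdot>\<^bsub>C\<^esub> (f \<cdot>\<^bsub>C\<^esub> h) = g' \<cdot>\<^bsub>C\<^esub> (f' \<cdot>\<^bsub>C\<^esub> h)"
  using assms by (simp flip: category_assoc)

section \<open>The category of arrows\<close>

lemma Arr_simps [simp]:
  "Obj (Arr C) = Mor C" "Dom (Arr C) = arr_src" "Cod (Arr C) = arr_tgt"
  "Ide (Arr C) f = ArrMor f f (Ide C (Dom C f)) (Ide C (Cod C f))"
  "t \<cdot>\<^bsub>Arr C\<^esub> s = ArrMor (arr_src s) (arr_tgt t)
     (on_dom t \<cdot>\<^bsub>C\<^esub> on_dom s) (on_cod t \<cdot>\<^bsub>C\<^esub> on_cod s)"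
  by (simp_all add: Arr_def)

lemma ArrMor_in_Mor [simp]: "ArrMor f g u v \<in> Mor (Arr C) \<longleftrightarrow>
    f \<in> Mor C \<and> g \<in> Mor C \<and> u \<in> Hom C (Dom C f) (Dom C g) \<and>
    v \<in> Hom C (Cod C f) (Cod C g) \<and> v \<cdot>\<^bsub>C\<^esub> f = g \<cdot>\<^bsub>C\<^esub> u"
  by (simp add: Arr_def)

lemma Mor_Arr_cases:
  assumes "s \<in> Mor (Arr C)"
  obtains f g u v where "s = ArrMor f g u v" "f \<in> Mor C" "g \<in> Mor C"
    "u \<in> Mor C" "v \<in> Mor C" "Dom C u = Dom C f" "Cod C u = Dom C g"
    "Dom C v = Cod C f" "Cod C v = Cod C g" "v \<cdot>\<^bsub>C\<^esub> f = g \<cdot>\<^bsub>C\<^esub> u"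
  using assms by (auto simp: Arr_def)

lemma category_Arr [simp]:
  assumes C: "category C"
  shows "category (Arr C)"
proof
  fix s t a b c assume "s \<in> Hom (Arr C) a b" "t \<in> Hom (Arr C) b c"
  then obtain f g h u v u' v' where "s = ArrMor f g u v" "t = ArrMor g h u' v'" "a = f" "c = h"
    and "ArrMor f g u v \<in> Mor (Arr C)" "ArrMor g h u' v' \<in> Mor (Arr C)"
    by (auto elim!: Mor_Arr_cases)
  then show "t \<cdot>\<^bsub>Arr C\<^esub> s \<in> Hom (Arr C) a c"
    using C paste_squares[OF C, of f g h u v u' v'] by simp
qed (use C in \<open>auto elim!: Mor_Arr_cases simp: category_assoc\<close>)

section \<open>The category of reflexive graphs\<close>

lemma is_reflexive_graph_iff [simp]: "is_reflexive_graph C d c e \<longleftrightarrow>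
    d \<in> Mor C \<and> c \<in> Mor C \<and> e \<in> Mor C \<and> Dom C c = Dom C d \<and> Cod C c = Cod C d \<and>
    Dom C e = Cod C d \<and> Cod C e = Dom C d \<and>
    d \<cdot>\<^bsub>C\<^esub> e = Ide C (Cod C d) \<and> c \<cdot>\<^bsub>C\<^esub> e = Ide C (Cod C d)"
  by (auto simp: is_reflexive_graph_def)

lemma RGrph_simps [simp]:
  "Obj (RGrph C) = RGrph_objs C" "Dom (RGrph C) = rg_src" "Cod (RGrph C) = rg_tgt"
  "Ide (RGrph C) G = RGMor G G (Ide C (rg_edges C G)) (Ide C (rg_verts C G))"
  "t \<cdot>\<^bsub>RGrph C\<^esub> s = RGMor (rg_src s) (rg_tgt t)
     (on_edges t \<cdot>\<^bsub>C\<^esub> on_edges s) (on_verts t \<cdot>\<^bsub>C\<^esub> on_verts s)"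
  by (simp_all add: RGrph_def)

lemma RG_in_RGrph_objs [simp]: "RG d c e \<in> RGrph_objs C \<longleftrightarrow> is_reflexive_graph C d c e"
  by (simp add: RGrph_objs_def)

lemma rg_edges_RG [simp]: "rg_edges C (RG d c e) = Dom C d"
  by (simp add: rg_edges_def)

lemma rg_verts_RG [simp]: "rg_verts C (RG d c e) = Cod C d"
  by (simp add: rg_verts_def)

lemma RGrph_objs_cases:
  assumes "G \<in> RGrph_objs C"
  obtains d c e where "G = RG d c e" "d \<in> Mor C" "c \<in> Mor C" "e \<in> Mor C"
    "Dom C c = Dom C d" "Cod C c = Cod C d" "Dom C e = Cod C d" "Cod C e = Dom C d"
    "d \<cdot>\<^bsub>C\<^esub> e = Ide C (Cod C d)" "c \<cdot>\<^bsub>C\<^esub> e = Ide C (Cod C d)"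
  using assms by (auto simp: RGrph_objs_def)

lemma RGMor_in_Mor [simp]: "RGMor G H u v \<in> Mor (RGrph C) \<longleftrightarrow>
    G \<in> RGrph_objs C \<and> H \<in> RGrph_objs C \<and>
    u \<in> Hom C (rg_edges C G) (rg_edges C H) \<and> v \<in> Hom C (rg_verts C G) (rg_verts C H) \<and>
    rg_d H \<cdot>\<^bsub>C\<^esub> u = v \<cdot>\<^bsub>C\<^esub> rg_d G \<and> rg_c H \<cdot>\<^bsub>C\<^esub> u = v \<cdot>\<^bsub>C\<^esub> rg_c G \<and>
    u \<cdot>\<^bsub>C\<^esub> rg_e G = rg_e H \<cdot>\<^bsub>C\<^esub> v"
  by (simp add: RGrph_def)

lemma Mor_RGrph_cases:
  assumes "s \<in> Mor (RGrph C)"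
  obtains G H u v where "s = RGMor G H u v" "G \<in> RGrph_objs C" "H \<in> RGrph_objs C"
    "u \<in> Mor C" "Dom C u = rg_edges C G" "Cod C u = rg_edges C H"
    "v \<in> Mor C" "Dom C v = rg_verts C G" "Cod C v = rg_verts C H"
    "rg_d H \<cdot>\<^bsub>C\<^esub> u = v \<cdot>\<^bsub>C\<^esub> rg_d G" "rg_c H \<cdot>\<^bsub>C\<^esub> u = v \<cdot>\<^bsub>C\<^esub> rg_c G"
    "u \<cdot>\<^bsub>C\<^esub> rg_e G = rg_e H \<cdot>\<^bsub>C\<^esub> v"
  using assms by (auto simp: RGrph_def)

lemma RGMor_Comp_in_Mor:
  assumes C: "category C"
    and s: "RGMor G H u v \<in> Mor (RGrph C)" and t: "RGMor H K u' v' \<in> Mor (RGrph C)"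
  shows "RGMor G K (u' \<cdot>\<^bsub>C\<^esub> u) (v' \<cdot>\<^bsub>C\<^esub> v) \<in> Mor (RGrph C)"
proof -
  obtain d c e where G: "G = RG d c e" "is_reflexive_graph C d c e"
    using s by (auto simp: RGrph_objs_def simp del: is_reflexive_graph_iff)
  obtain d' c' e' where H: "H = RG d' c' e'" "is_reflexive_graph C d' c' e'"
    using s by (auto simp: RGrph_objs_def simp del: is_reflexive_graph_iff)
  obtain d'' c'' e'' where K: "K = RG d'' c'' e''" "is_reflexive_graph C d'' c'' e''"
    using t by (auto simp: RGrph_objs_def simp del: is_reflexive_graph_iff)
  have "v' \<cdot>\<^bsub>C\<^esub> v \<cdot>\<^bsub>C\<^esub> d = d'' \<cdot>\<^bsub>C\<^esub> (u' \<cdot>\<^bsub>C\<^esub> u)"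
    using s t G H K by (intro paste_squares[OF C, where g = d']) auto
  moreover have "v' \<cdot>\<^bsub>C\<^esub> v \<cdot>\<^bsub>C\<^esub> c = c'' \<cdot>\<^bsub>C\<^esub> (u' \<cdot>\<^bsub>C\<^esub> u)"
    using s t G H K by (intro paste_squares[OF C, where g = c']) auto
  moreover have "u' \<cdot>\<^bsub>C\<^esub> u \<cdot>\<^bsub>C\<^esub> e = e'' \<cdot>\<^bsub>C\<^esub> (v' \<cdot>\<^bsub>C\<^esub> v)"
    using s t G H K by (intro paste_squares[OF C, where g = e']) auto
  ultimately show ?thesis using C s t G H K by auto
qed

lemma category_RGrph [simp]:
  assumes C: "category C"
  shows "category (RGrph C)"
proof
  fix s t a b c assume s: "s \<in> Hom (RGrph C) a b" and t: "t \<in> Hom (RGrph C) b c"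
  obtain u v where s': "s = RGMor a b u v" using s by (elim in_HomE Mor_RGrph_cases) simp
  obtain u' v' where t': "t = RGMor b c u' v'" using t by (elim in_HomE Mor_RGrph_cases) simp
  show "t \<cdot>\<^bsub>RGrph C\<^esub> s \<in> Hom (RGrph C) a c"
    using RGMor_Comp_in_Mor[OF C, of a b u v c u' v'] s t s' t' by (simp del: RGMor_in_Mor)
next
  fix a assume "a \<in> Obj (RGrph C)"
  then show "Ide (RGrph C) a \<in> Hom (RGrph C) a a"
    using C by (auto elim!: RGrph_objs_cases)
next
  fix f g h a b c d assume "f \<in> Hom (RGrph C) a b" "g \<in> Hom (RGrph C) b c" "h \<in> Hom (RGrph C) c d"
  then show "h \<cdot>\<^bsub>RGrph C\<^esub> g \<cdot>\<^bsub>RGrph C\<^esub> f = h \<cdot>\<^bsub>RGrph C\<^esub> (g \<cdot>\<^bsub>RGrph C\<^esub> f)"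
    using C by (elim Mor_RGrph_cases in_HomE) (simp add: category_assoc)
next
  fix f a b assume "f \<in> Hom (RGrph C) a b"
  then show "f \<cdot>\<^bsub>RGrph C\<^esub> Ide (RGrph C) a = f" "Ide (RGrph C) b \<cdot>\<^bsub>RGrph C\<^esub> f = f"
    using C by (elim Mor_RGrph_cases in_HomE; simp)+
next
  fix f assume "f \<in> Mor (RGrph C)"
  then show "Dom (RGrph C) f \<in> Obj (RGrph C)" "Cod (RGrph C) f \<in> Obj (RGrph C)"
    by (elim Mor_RGrph_cases; simp)+
qed

section \<open>Kernel pairs and reflexive coequalisers\<close>

lemma is_kernel_pair_iff: "is_kernel_pair C f p q \<longleftrightarrow>
     f \<in> Mor C \<and> p \<in> Mor C \<and> q \<in> Mor C \<and>
     Dom C q = Dom C p \<and> Cod C p = Dom C f \<and> Cod C q = Dom C f \<and>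
     f \<cdot>\<^bsub>C\<^esub> p = f \<cdot>\<^bsub>C\<^esub> q \<and>
     (\<forall>a \<in> Obj C. \<forall>x \<in> Hom C a (Dom C f). \<forall>y \<in> Hom C a (Dom C f).
        f \<cdot>\<^bsub>C\<^esub> x = f \<cdot>\<^bsub>C\<^esub> y \<longrightarrow>
        (\<exists>!u. u \<in> Hom C a (Dom C p) \<and> p \<cdot>\<^bsub>C\<^esub> u = x \<and> q \<cdot>\<^bsub>C\<^esub> u = y))"
  unfolding is_kernel_pair_def is_pullback_def
  by (rule iffI; elim conjE; intro conjI; (assumption | rule refl | erule sym))

lemma kernel_pair_cone:
  assumes "is_kernel_pair C f p q"
  shows "f \<in> Mor C" "p \<in> Mor C" "q \<in> Mor C" "Dom C q = Dom C p"
    "Cod C p = Dom C f" "Cod C q = Dom C f" "f \<cdot>\<^bsub>C\<^esub> p = f \<cdot>\<^bsub>C\<^esub> q"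
  using assms by (auto simp: is_kernel_pair_iff)

lemma kernel_pair_lift:
  assumes "category C" "is_kernel_pair C f p q" "x \<in> Mor C" "y \<in> Mor C" "Dom C x = Dom C y"
    "Cod C x = Dom C f" "Cod C y = Dom C f" "f \<cdot>\<^bsub>C\<^esub> x = f \<cdot>\<^bsub>C\<^esub> y"
  obtains u where "u \<in> Mor C" "Dom C u = Dom C y" "Cod C u = Dom C p" "p \<cdot>\<^bsub>C\<^esub> u = x" "q \<cdot>\<^bsub>C\<^esub> u = y"
proof -
  have "\<exists>!u. u \<in> Hom C (Dom C y) (Dom C p) \<and> p \<cdot>\<^bsub>C\<^esub> u = x \<and> q \<cdot>\<^bsub>C\<^esub> u = y"
    using assms unfolding is_kernel_pair_iff by simp
  then show ?thesis using that by auto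
qed

text \<open>Both maps mediate the same cone over \<open>f\<close>. This is the uniqueness half of
  the universal property, separated from existence because equations between maps into a kernel pair
  are checked after the two projections.\<close>

lemma kernel_pair_joint_mono:
  assumes C: "category C" and k: "is_kernel_pair C f p q" and "u \<in> Mor C" "u' \<in> Mor C" "Dom C u = Dom C u'"
    "Cod C u = Dom C p" "Cod C u' = Dom C p"
    and e: "p \<cdot>\<^bsub>C\<^esub> u = p \<cdot>\<^bsub>C\<^esub> u'" "q \<cdot>\<^bsub>C\<^esub> u = q \<cdot>\<^bsub>C\<^esub> u'"
  shows "u = u'"
proof -
  note kernel_pair_cone[OF k, simp]
  have "f \<cdot>\<^bsub>C\<^esub> (p \<cdot>\<^bsub>C\<^esub> u) = f \<cdot>\<^bsub>C\<^esub> (q \<cdot>\<^bsub>C\<^esub> u)"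
    using assms(1-7) by (intro category_Comp_left_cong) auto
  then have "\<exists>!w. w \<in> Hom C (Dom C u) (Dom C p) \<and> p \<cdot>\<^bsub>C\<^esub> w = p \<cdot>\<^bsub>C\<^esub> u \<and> q \<cdot>\<^bsub>C\<^esub> w = q \<cdot>\<^bsub>C\<^esub> u"
    using k C assms(3-7) unfolding is_kernel_pair_iff by simp
  then show ?thesis using assms(3-7) e by auto
qed

lemma coequaliser_cocone:
  assumes "is_coequaliser C f g q"
  shows "f \<in> Mor C" "g \<in> Mor C" "q \<in> Mor C" "Dom C g = Dom C f"
    "Cod C g = Cod C f" "Dom C q = Cod C f" "q \<cdot>\<^bsub>C\<^esub> f = q \<cdot>\<^bsub>C\<^esub> g"
  using assms by (auto simp: is_coequaliser_def)

lemma coequaliser_desc: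
  assumes "category C" "is_coequaliser C f g q" "x \<in> Mor C" "Dom C x = Cod C f" "x \<cdot>\<^bsub>C\<^esub> f = x \<cdot>\<^bsub>C\<^esub> g"
  obtains w where "w \<in> Mor C" "Dom C w = Cod C q" "Cod C w = Cod C x" "w \<cdot>\<^bsub>C\<^esub> q = x"
proof -
  have "\<exists>!w. w \<in> Hom C (Cod C q) (Cod C x) \<and> w \<cdot>\<^bsub>C\<^esub> q = x"
    using assms unfolding is_coequaliser_def by simp
  then show ?thesis using that by auto
qed

lemma coequaliser_epi:
  assumes C: "category C" and q: "is_coequaliser C f g q" and "w \<in> Mor C" "w' \<in> Mor C"
    "Dom C w = Cod C q" "Dom C w' = Cod C q" "Cod C w = Cod C w'"
    and e: "w \<cdot>\<^bsub>C\<^esub> q = w' \<cdot>\<^bsub>C\<^esub> q"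
  shows "w = w'"
proof -
  note coequaliser_cocone[OF q, simp]
  have "w \<cdot>\<^bsub>C\<^esub> q \<cdot>\<^bsub>C\<^esub> f = w \<cdot>\<^bsub>C\<^esub> q \<cdot>\<^bsub>C\<^esub> g"
    using assms(1-6) by (simp add: category_assoc)
  then have "\<exists>!x. x \<in> Hom C (Cod C q) (Cod C w) \<and> x \<cdot>\<^bsub>C\<^esub> q = w \<cdot>\<^bsub>C\<^esub> q"
    using q C assms(3-7) unfolding is_coequaliser_def by simp
  then show ?thesis using assms(3-7) e by auto
qed

lemma is_coequaliserI:
  assumes "f \<in> Mor C" "g \<in> Mor C" "q \<in> Mor C" "Dom C g = Dom C f"
    "Cod C g = Cod C f" "Dom C q = Cod C f" "q \<cdot>\<^bsub>C\<^esub> f = q \<cdot>\<^bsub>C\<^esub> g"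
    and "\<And>x. x \<in> Mor C \<Longrightarrow> Dom C x = Cod C f \<Longrightarrow> x \<cdot>\<^bsub>C\<^esub> f = x \<cdot>\<^bsub>C\<^esub> g \<Longrightarrow>
      \<exists>w. w \<in> Mor C \<and> Dom C w = Cod C q \<and> Cod C w = Cod C x \<and> w \<cdot>\<^bsub>C\<^esub> q = x"
    and "\<And>w w'. w \<in> Mor C \<Longrightarrow> w' \<in> Mor C \<Longrightarrow> Dom C w = Cod C q \<Longrightarrow> Dom C w' = Cod C q \<Longrightarrow>
      Cod C w = Cod C w' \<Longrightarrow> w \<cdot>\<^bsub>C\<^esub> q = w' \<cdot>\<^bsub>C\<^esub> q \<Longrightarrow> w = w'"
  shows "is_coequaliser C f g q"
  unfolding is_coequaliser_def
proof (intro conjI ballI impI)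
  fix b x assume "b \<in> Obj C" and x: "x \<in> Hom C (Cod C f) b" "x \<cdot>\<^bsub>C\<^esub> f = x \<cdot>\<^bsub>C\<^esub> g"
  then obtain w where "w \<in> Mor C" "Dom C w = Cod C q" "Cod C w = b" "w \<cdot>\<^bsub>C\<^esub> q = x"
    using assms(8)[of x] by auto
  then show "\<exists>!w. w \<in> Hom C (Cod C q) b \<and> w \<cdot>\<^bsub>C\<^esub> q = x"
    using assms(9) by (intro ex1I[of _ w]) auto
qed (use assms(1-7) in auto)

lemma is_kernel_pairI:
  assumes "f \<in> Mor C" "p \<in> Mor C" "q \<in> Mor C" "Dom C q = Dom C p"
    "Cod C p = Dom C f" "Cod C q = Dom C f" "f \<cdot>\<^bsub>C\<^esub> p = f \<cdot>\<^bsub>C\<^esub> q"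
    and "\<And>x y. x \<in> Mor C \<Longrightarrow> y \<in> Mor C \<Longrightarrow> Dom C x = Dom C y \<Longrightarrow> Cod C x = Dom C f \<Longrightarrow>
      Cod C y = Dom C f \<Longrightarrow> f \<cdot>\<^bsub>C\<^esub> x = f \<cdot>\<^bsub>C\<^esub> y \<Longrightarrow>
      \<exists>u. u \<in> Mor C \<and> Dom C u = Dom C y \<and> Cod C u = Dom C p \<and> p \<cdot>\<^bsub>C\<^esub> u = x \<and> q \<cdot>\<^bsub>C\<^esub> u = y"
    and "\<And>u u'. u \<in> Mor C \<Longrightarrow> u' \<in> Mor C \<Longrightarrow> Dom C u = Dom C u' \<Longrightarrow> Cod C u = Dom C p \<Longrightarrow>
      Cod C u' = Dom C p \<Longrightarrow> p \<cdot>\<^bsub>C\<^esub> u = p \<cdot>\<^bsub>C\<^esub> u' \<Longrightarrow> q \<cdot>\<^bsub>C\<^esub> u = q \<cdot>\<^bsub>C\<^esub> u' \<Longrightarrow> u = u'"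
  shows "is_kernel_pair C f p q"
  unfolding is_kernel_pair_iff
proof (intro conjI ballI impI)
  fix a x y assume "a \<in> Obj C" and "x \<in> Hom C a (Dom C f)" "y \<in> Hom C a (Dom C f)"
    "f \<cdot>\<^bsub>C\<^esub> x = f \<cdot>\<^bsub>C\<^esub> y"
  then obtain u where "u \<in> Mor C" "Dom C u = a" "Cod C u = Dom C p" "p \<cdot>\<^bsub>C\<^esub> u = x" "q \<cdot>\<^bsub>C\<^esub> u = y"
    using assms(8)[of x y] by auto
  then show "\<exists>!u. u \<in> Hom C a (Dom C p) \<and> p \<cdot>\<^bsub>C\<^esub> u = x \<and> q \<cdot>\<^bsub>C\<^esub> u = y"
    using assms(9) by (intro ex1I[of _ u]) auto
qed (use assms(1-7) in auto)

text \<open>Composites are normalised to the right, which hides a known product \<open>a b\<close>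
  inside \<open>a (b c)\<close>. Resolving an equation with this lemma (called \<open>red\<close> in
  later proofs) gives the rewrite rule that still applies there; diagram chases use both
  forms.\<close>

lemma category_Comp_reduce:
  assumes "category C" "a \<cdot>\<^bsub>C\<^esub> b = x" "a \<in> Mor C" "b \<in> Mor C" "c \<in> Mor C"
    "Dom C a = Cod C b" "Dom C b = Cod C c"
  shows "a \<cdot>\<^bsub>C\<^esub> (b \<cdot>\<^bsub>C\<^esub> c) = x \<cdot>\<^bsub>C\<^esub> c"
  using assms by (simp flip: category_assoc)

text \<open>Functoriality of kernel pairs: \<open>f' h = g f\<close> makes \<open>h p\<close> and
  \<open>h q\<close> a cone over \<open>f'\<close>. The structure maps of a kernel pair of reflexive
  graphs arise in this way.\<close>

lemma kernel_pair_map: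
  assumes C: "category C" and k: "is_kernel_pair C f p q" and k': "is_kernel_pair C f' p' q'"
    and h: "h \<in> Hom C (Dom C f) (Dom C f')" and g: "g \<in> Hom C (Cod C f) (Cod C f')"
    and sq: "g \<cdot>\<^bsub>C\<^esub> f = f' \<cdot>\<^bsub>C\<^esub> h"
  obtains w where "w \<in> Mor C" "Dom C w = Dom C p" "Cod C w = Dom C p'"
    "p' \<cdot>\<^bsub>C\<^esub> w = h \<cdot>\<^bsub>C\<^esub> p" "q' \<cdot>\<^bsub>C\<^esub> w = h \<cdot>\<^bsub>C\<^esub> q"
proof -
  note [simp] = kernel_pair_cone(1-6)[OF k] kernel_pair_cone(1-6)[OF k']
  have "f' \<cdot>\<^bsub>C\<^esub> (h \<cdot>\<^bsub>C\<^esub> p) = g \<cdot>\<^bsub>C\<^esub> (f \<cdot>\<^bsub>C\<^esub> p)"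
    using C h g by (simp add: category_Comp_reduce[OF C sq[symmetric]] category_assoc)
  also have "\<dots> = f' \<cdot>\<^bsub>C\<^esub> (h \<cdot>\<^bsub>C\<^esub> q)"
    using C h g kernel_pair_cone(7)[OF k]
    by (simp add: category_Comp_reduce[OF C sq[symmetric]] category_assoc)
  finally have "f' \<cdot>\<^bsub>C\<^esub> (h \<cdot>\<^bsub>C\<^esub> p) = f' \<cdot>\<^bsub>C\<^esub> (h \<cdot>\<^bsub>C\<^esub> q)" .
  from kernel_pair_lift[OF C k' _ _ _ _ _ this] show ?thesis
    using that C h g by auto
qed

lemma coequaliser_map:
  assumes C: "category C" and k: "is_coequaliser C f g q" and k': "is_coequaliser C f' g' q'"
    and h: "h \<in> Hom C (Cod C f) (Cod C f')" and h': "h' \<in> Hom C (Dom C f) (Dom C f')"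
    and sq: "h \<cdot>\<^bsub>C\<^esub> f = f' \<cdot>\<^bsub>C\<^esub> h'" "h \<cdot>\<^bsub>C\<^esub> g = g' \<cdot>\<^bsub>C\<^esub> h'"
  obtains w where "w \<in> Mor C" "Dom C w = Cod C q" "Cod C w = Cod C q'"
    "w \<cdot>\<^bsub>C\<^esub> q = q' \<cdot>\<^bsub>C\<^esub> h"
proof -
  note [simp] = coequaliser_cocone(1-6)[OF k] coequaliser_cocone(1-6)[OF k']
  have "q' \<cdot>\<^bsub>C\<^esub> h \<cdot>\<^bsub>C\<^esub> f = q' \<cdot>\<^bsub>C\<^esub> h \<cdot>\<^bsub>C\<^esub> g"
    using C h h' coequaliser_cocone(7)[OF k']
    by (simp add: category_assoc sq category_Comp_reduce[OF C coequaliser_cocone(7)[OF k']])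
  from coequaliser_desc[OF C k _ _ this] show ?thesis
    using that C h h' by auto
qed

section \<open>Inheritance by reflexive graphs, computed pointwise\<close>

definition has_kernel_pairs :: "('o, 'm) cat \<Rightarrow> bool" where
  "has_kernel_pairs C \<longleftrightarrow> (\<forall>f \<in> Mor C. \<exists>p q. is_kernel_pair C f p q)"

text \<open>Coequalisers of reflexive pairs are what the Mal'tsev condition provides. Reflexivity
  passes to the components of a pair of graph morphisms, so the property can be iterated along
  \<open>RGrph\<close>.\<close>

definition has_reflexive_coequalisers :: "('o, 'm) cat \<Rightarrow> bool" where
  "has_reflexive_coequalisers C \<longleftrightarrow>
     (\<forall>d c e. is_reflexive_graph C d c e \<longrightarrow> (\<exists>q. is_coequaliser C d c q))"

text \<open>The kernel pairs on edges and on vertices receive structure maps induced by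
  \<open>d\<close>, \<open>c\<close> and \<open>e\<close>. All identities required of these maps
  hold because they hold after the jointly monic projections.\<close>

lemma is_kernel_pair_RGrph:
  assumes C: "category C" and s: "RGMor (RG d c e) (RG d' c' e') u v \<in> Mor (RGrph C)"
    and k: "is_kernel_pair C u p\<^sub>1 q\<^sub>1" and k': "is_kernel_pair C v p\<^sub>0 q\<^sub>0"
  shows "\<exists>P Q. is_kernel_pair (RGrph C) (RGMor (RG d c e) (RG d' c' e') u v) P Q"
proof -
  note red = category_Comp_reduce[OF C]
  note s' [simp] = s[simplified]
  note [simp] = kernel_pair_cone(1-6)[OF k] kernel_pair_cone(1-6)[OF k'] C
  obtain d\<^sub>K where d: "d\<^sub>K \<in> Mor C" "Dom C d\<^sub>K = Dom C p\<^sub>1" "Cod C d\<^sub>K = Dom C p\<^sub>0"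
    and dK: "p\<^sub>0 \<cdot>\<^bsub>C\<^esub> d\<^sub>K = d \<cdot>\<^bsub>C\<^esub> p\<^sub>1" "q\<^sub>0 \<cdot>\<^bsub>C\<^esub> d\<^sub>K = d \<cdot>\<^bsub>C\<^esub> q\<^sub>1"
    by (rule kernel_pair_map[OF C k k', of d d']) auto
  obtain c\<^sub>K where c: "c\<^sub>K \<in> Mor C" "Dom C c\<^sub>K = Dom C p\<^sub>1" "Cod C c\<^sub>K = Dom C p\<^sub>0"
    and cK: "p\<^sub>0 \<cdot>\<^bsub>C\<^esub> c\<^sub>K = c \<cdot>\<^bsub>C\<^esub> p\<^sub>1" "q\<^sub>0 \<cdot>\<^bsub>C\<^esub> c\<^sub>K = c \<cdot>\<^bsub>C\<^esub> q\<^sub>1"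
    by (rule kernel_pair_map[OF C k k', of c c']) auto
  obtain e\<^sub>K where e: "e\<^sub>K \<in> Mor C" "Dom C e\<^sub>K = Dom C p\<^sub>0" "Cod C e\<^sub>K = Dom C p\<^sub>1"
    and eK: "p\<^sub>1 \<cdot>\<^bsub>C\<^esub> e\<^sub>K = e \<cdot>\<^bsub>C\<^esub> p\<^sub>0" "q\<^sub>1 \<cdot>\<^bsub>C\<^esub> e\<^sub>K = e \<cdot>\<^bsub>C\<^esub> q\<^sub>0"
    by (rule kernel_pair_map[OF C k' k, of e e']) auto
  note [simp] = d c e
  have de: "d \<cdot>\<^bsub>C\<^esub> e = Ide C (Cod C d)" "c \<cdot>\<^bsub>C\<^esub> e = Ide C (Cod C d)"
    by auto
  note rw = dK cK eK dK[THEN red] cK[THEN red] eK[THEN red] category_assoc de[THEN red]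
  have "d\<^sub>K \<cdot>\<^bsub>C\<^esub> e\<^sub>K = Ide C (Dom C p\<^sub>0)" "c\<^sub>K \<cdot>\<^bsub>C\<^esub> e\<^sub>K = Ide C (Dom C p\<^sub>0)"
    by (rule kernel_pair_joint_mono[OF C k']; simp add: rw)+
  then have K: "RG d\<^sub>K c\<^sub>K e\<^sub>K \<in> RGrph_objs C" by simp
  let ?s = "RGMor (RG d c e) (RG d' c' e') u v"
  have "is_kernel_pair (RGrph C) ?s
      (RGMor (RG d\<^sub>K c\<^sub>K e\<^sub>K) (RG d c e) p\<^sub>1 p\<^sub>0) (RGMor (RG d\<^sub>K c\<^sub>K e\<^sub>K) (RG d c e) q\<^sub>1 q\<^sub>0)"
  proof (rule is_kernel_pairI)
    fix x y assume xy: "x \<in> Mor (RGrph C)" "y \<in> Mor (RGrph C)"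
      "Dom (RGrph C) x = Dom (RGrph C) y" "Cod (RGrph C) x = Dom (RGrph C) ?s"
      "Cod (RGrph C) y = Dom (RGrph C) ?s" "?s \<cdot>\<^bsub>RGrph C\<^esub> x = ?s \<cdot>\<^bsub>RGrph C\<^esub> y"
    then obtain A x1 x0 y1 y0 where x: "x = RGMor A (RG d c e) x1 x0" and y: "y = RGMor A (RG d c e) y1 y0"
      by (auto elim!: Mor_RGrph_cases)
    with xy have "A \<in> RGrph_objs C" by simp
    then obtain d'' c'' e'' where A: "A = RG d'' c'' e''" by (auto simp: RGrph_objs_def)
    note [simp] = xy(1)[unfolded x A, simplified] xy(2)[unfolded y A, simplified]
    obtain w1 where w1 [simp]: "w1 \<in> Mor C" "Dom C w1 = Dom C y1" "Cod C w1 = Dom C p\<^sub>1"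
      and w1': "p\<^sub>1 \<cdot>\<^bsub>C\<^esub> w1 = x1" "q\<^sub>1 \<cdot>\<^bsub>C\<^esub> w1 = y1"
      by (rule kernel_pair_lift[OF C k, of x1 y1]) (use xy(6) x y A in auto)
    obtain w0 where w0 [simp]: "w0 \<in> Mor C" "Dom C w0 = Dom C y0" "Cod C w0 = Dom C p\<^sub>0"
      and w0': "p\<^sub>0 \<cdot>\<^bsub>C\<^esub> w0 = x0" "q\<^sub>0 \<cdot>\<^bsub>C\<^esub> w0 = y0"
      by (rule kernel_pair_lift[OF C k', of x0 y0]) (use xy(6) x y A in auto)
    note rw' = rw w1' w0' w1'[THEN red] w0'[THEN red]
    have "d\<^sub>K \<cdot>\<^bsub>C\<^esub> w1 = w0 \<cdot>\<^bsub>C\<^esub> d''" "c\<^sub>K \<cdot>\<^bsub>C\<^esub> w1 = w0 \<cdot>\<^bsub>C\<^esub> c''"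
      by (rule kernel_pair_joint_mono[OF C k']; simp add: rw')+
    moreover have "w1 \<cdot>\<^bsub>C\<^esub> e'' = e\<^sub>K \<cdot>\<^bsub>C\<^esub> w0"
      by (rule kernel_pair_joint_mono[OF C k]; simp add: rw')
    ultimately have "RGMor A (RG d\<^sub>K c\<^sub>K e\<^sub>K) w1 w0 \<in> Mor (RGrph C)"
      using K by (simp add: A)
    then show "\<exists>w. w \<in> Mor (RGrph C) \<and> Dom (RGrph C) w = Dom (RGrph C) y \<and>
        Cod (RGrph C) w = Dom (RGrph C) (RGMor (RG d\<^sub>K c\<^sub>K e\<^sub>K) (RG d c e) p\<^sub>1 p\<^sub>0) \<and>
        RGMor (RG d\<^sub>K c\<^sub>K e\<^sub>K) (RG d c e) p\<^sub>1 p\<^sub>0 \<cdot>\<^bsub>RGrph C\<^esub> w = x \<and>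
        RGMor (RG d\<^sub>K c\<^sub>K e\<^sub>K) (RG d c e) q\<^sub>1 q\<^sub>0 \<cdot>\<^bsub>RGrph C\<^esub> w = y"
      using w1' w0' by (intro exI[of _ "RGMor A (RG d\<^sub>K c\<^sub>K e\<^sub>K) w1 w0"]) (simp add: x y)
  next
    fix x y
    assume "x \<in> Mor (RGrph C)" "y \<in> Mor (RGrph C)" "Dom (RGrph C) x = Dom (RGrph C) y"
      "Cod (RGrph C) x = Dom (RGrph C) (RGMor (RG d\<^sub>K c\<^sub>K e\<^sub>K) (RG d c e) p\<^sub>1 p\<^sub>0)"
      "Cod (RGrph C) y = Dom (RGrph C) (RGMor (RG d\<^sub>K c\<^sub>K e\<^sub>K) (RG d c e) p\<^sub>1 p\<^sub>0)"
      "RGMor (RG d\<^sub>K c\<^sub>K e\<^sub>K) (RG d c e) p\<^sub>1 p\<^sub>0 \<cdot>\<^bsub>RGrph C\<^esub> x =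
       RGMor (RG d\<^sub>K c\<^sub>K e\<^sub>K) (RG d c e) p\<^sub>1 p\<^sub>0 \<cdot>\<^bsub>RGrph C\<^esub> y"
      "RGMor (RG d\<^sub>K c\<^sub>K e\<^sub>K) (RG d c e) q\<^sub>1 q\<^sub>0 \<cdot>\<^bsub>RGrph C\<^esub> x =
       RGMor (RG d\<^sub>K c\<^sub>K e\<^sub>K) (RG d c e) q\<^sub>1 q\<^sub>0 \<cdot>\<^bsub>RGrph C\<^esub> y"
    then show "x = y"
      by (elim Mor_RGrph_cases, simp)
        (rule conjI, rule kernel_pair_joint_mono[OF C k], simp_all,
          rule kernel_pair_joint_mono[OF C k'], simp_all)
  qed (use s K kernel_pair_cone(7)[OF k] kernel_pair_cone(7)[OF k'] dK cK eK in auto)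
  then show ?thesis by blast
qed

lemma has_kernel_pairs_RGrph:
  assumes C: "category C" and k: "has_kernel_pairs C"
  shows "has_kernel_pairs (RGrph C)"
  unfolding has_kernel_pairs_def
proof
  fix s assume s: "s \<in> Mor (RGrph C)"
  then obtain d c e d' c' e' u v where s': "s = RGMor (RG d c e) (RG d' c' e') u v"
    by (auto elim!: Mor_RGrph_cases RGrph_objs_cases)
  with s have "u \<in> Mor C" "v \<in> Mor C" by auto
  with k obtain p q p' q' where "is_kernel_pair C u p q" "is_kernel_pair C v p' q'"
    unfolding has_kernel_pairs_def by blast
  then show "\<exists>p q. is_kernel_pair (RGrph C) s p q"
    using is_kernel_pair_RGrph[OF C] s s' by blast
qed

text \<open>The quotients on edges and on vertices are formed separately. The graph structure
  descends to them, and each identity is tested after precomposition with a quotient map, which is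
  epic.\<close>

lemma has_reflexive_coequalisers_RGrph:
  assumes C: "category C" and coeq: "has_reflexive_coequalisers C"
  shows "has_reflexive_coequalisers (RGrph C)"
  unfolding has_reflexive_coequalisers_def
proof (intro allI impI)
  fix D E S assume DES: "is_reflexive_graph (RGrph C) D E S"
  then obtain G H d\<^sub>1 d\<^sub>0 where D: "D = RGMor G H d\<^sub>1 d\<^sub>0" "G \<in> RGrph_objs C" "H \<in> RGrph_objs C"
    by (auto elim!: Mor_RGrph_cases)
  then obtain d c e d' c' e' where G: "G = RG d c e" and H: "H = RG d' c' e'"
    by (auto elim!: RGrph_objs_cases)
  obtain c\<^sub>1 c\<^sub>0 where E: "E = RGMor G H c\<^sub>1 c\<^sub>0" using DES D by (auto elim!: Mor_RGrph_cases)
  obtain e\<^sub>1 e\<^sub>0 where S: "S = RGMor H G e\<^sub>1 e\<^sub>0" using DES D by (auto elim!: Mor_RGrph_cases)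
  note [simp] = DES[unfolded D E S G H, simplified] C
  note red = category_Comp_reduce[OF C]
  \<comment> \<open>The common section \<open>S\<close> enters here: its two components split those
    of \<open>D\<close> and \<open>E\<close>, so both component pairs are reflexive and have
    coequalisers.\<close>
  have "is_reflexive_graph C d\<^sub>1 c\<^sub>1 e\<^sub>1" "is_reflexive_graph C d\<^sub>0 c\<^sub>0 e\<^sub>0" by auto
  with coeq obtain q\<^sub>1 q\<^sub>0 where k: "is_coequaliser C d\<^sub>1 c\<^sub>1 q\<^sub>1" and k': "is_coequaliser C d\<^sub>0 c\<^sub>0 q\<^sub>0"
    unfolding has_reflexive_coequalisers_def by blast
  note [simp] = coequaliser_cocone(3,6)[OF k] coequaliser_cocone(3,6)[OF k']
  obtain d\<^sub>Q where d: "d\<^sub>Q \<in> Mor C" "Dom C d\<^sub>Q = Cod C q\<^sub>1" "Cod C d\<^sub>Q = Cod C q\<^sub>0"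
    and dQ: "d\<^sub>Q \<cdot>\<^bsub>C\<^esub> q\<^sub>1 = q\<^sub>0 \<cdot>\<^bsub>C\<^esub> d'"
    by (rule coequaliser_map[OF C k k', of d' d]) auto
  obtain c\<^sub>Q where c: "c\<^sub>Q \<in> Mor C" "Dom C c\<^sub>Q = Cod C q\<^sub>1" "Cod C c\<^sub>Q = Cod C q\<^sub>0"
    and cQ: "c\<^sub>Q \<cdot>\<^bsub>C\<^esub> q\<^sub>1 = q\<^sub>0 \<cdot>\<^bsub>C\<^esub> c'"
    by (rule coequaliser_map[OF C k k', of c' c]) auto
  obtain e\<^sub>Q where e: "e\<^sub>Q \<in> Mor C" "Dom C e\<^sub>Q = Cod C q\<^sub>0" "Cod C e\<^sub>Q = Cod C q\<^sub>1"
    and eQ: "e\<^sub>Q \<cdot>\<^bsub>C\<^esub> q\<^sub>0 = q\<^sub>1 \<cdot>\<^bsub>C\<^esub> e'"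
    by (rule coequaliser_map[OF C k' k, of e' e]) auto
  note [simp] = d c e
  note rw = dQ cQ eQ dQ[THEN red] cQ[THEN red] eQ[THEN red] category_assoc
  have "d\<^sub>Q \<cdot>\<^bsub>C\<^esub> e\<^sub>Q = Ide C (Cod C q\<^sub>0)" "c\<^sub>Q \<cdot>\<^bsub>C\<^esub> e\<^sub>Q = Ide C (Cod C q\<^sub>0)"
    by (rule coequaliser_epi[OF C k']; simp add: rw)+
  then have Q: "RG d\<^sub>Q c\<^sub>Q e\<^sub>Q \<in> RGrph_objs C" by simp
  let ?q = "RGMor H (RG d\<^sub>Q c\<^sub>Q e\<^sub>Q) q\<^sub>1 q\<^sub>0"
  have "is_coequaliser (RGrph C) D E ?q"
  proof (rule is_coequaliserI)
    fix x assume x: "x \<in> Mor (RGrph C)" "Dom (RGrph C) x = Cod (RGrph C) D"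
      "x \<cdot>\<^bsub>RGrph C\<^esub> D = x \<cdot>\<^bsub>RGrph C\<^esub> E"
    then obtain A x1 x0 where x': "x = RGMor H A x1 x0"
      by (auto elim!: Mor_RGrph_cases simp: D)
    with x have "A \<in> RGrph_objs C" by simp
    then obtain d'' c'' e'' where A: "A = RG d'' c'' e''" by (auto simp: RGrph_objs_def)
    note [simp] = x(1)[unfolded x' A H, simplified]
    obtain w1 where w1 [simp]: "w1 \<in> Mor C" "Dom C w1 = Cod C q\<^sub>1" "Cod C w1 = Cod C x1"
      and w1': "w1 \<cdot>\<^bsub>C\<^esub> q\<^sub>1 = x1"
      by (rule coequaliser_desc[OF C k, of x1]) (use x(3) x' A D E in auto)
    obtain w0 where w0 [simp]: "w0 \<in> Mor C" "Dom C w0 = Cod C q\<^sub>0" "Cod C w0 = Cod C x0"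
      and w0': "w0 \<cdot>\<^bsub>C\<^esub> q\<^sub>0 = x0"
      by (rule coequaliser_desc[OF C k', of x0]) (use x(3) x' A D E in auto)
    note rw' = rw w1' w0' w1'[THEN red] w0'[THEN red]
    have "d'' \<cdot>\<^bsub>C\<^esub> w1 = w0 \<cdot>\<^bsub>C\<^esub> d\<^sub>Q" "c'' \<cdot>\<^bsub>C\<^esub> w1 = w0 \<cdot>\<^bsub>C\<^esub> c\<^sub>Q"
      by (rule coequaliser_epi[OF C k]; simp add: rw')+
    moreover have "w1 \<cdot>\<^bsub>C\<^esub> e\<^sub>Q = e'' \<cdot>\<^bsub>C\<^esub> w0"
      by (rule coequaliser_epi[OF C k']; simp add: rw')
    ultimately have "RGMor (RG d\<^sub>Q c\<^sub>Q e\<^sub>Q) A w1 w0 \<in> Mor (RGrph C)"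
      using Q by (simp add: A)
    then show "\<exists>w. w \<in> Mor (RGrph C) \<and> Dom (RGrph C) w = Cod (RGrph C) ?q \<and>
        Cod (RGrph C) w = Cod (RGrph C) x \<and> w \<cdot>\<^bsub>RGrph C\<^esub> ?q = x"
      using w1' w0' by (intro exI[of _ "RGMor (RG d\<^sub>Q c\<^sub>Q e\<^sub>Q) A w1 w0"]) (simp add: x')
  next
    fix x y
    assume "x \<in> Mor (RGrph C)" "y \<in> Mor (RGrph C)" "Dom (RGrph C) x = Cod (RGrph C) ?q"
      "Dom (RGrph C) y = Cod (RGrph C) ?q" "Cod (RGrph C) x = Cod (RGrph C) y"
      "x \<cdot>\<^bsub>RGrph C\<^esub> ?q = y \<cdot>\<^bsub>RGrph C\<^esub> ?q"
    then show "x = y"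
      by (elim Mor_RGrph_cases, simp)
        (rule conjI, rule coequaliser_epi[OF C k], simp_all,
          rule coequaliser_epi[OF C k'], simp_all)
  qed (use DES Q coequaliser_cocone(7)[OF k] coequaliser_cocone(7)[OF k'] dQ cQ eQ in
      \<open>simp_all add: D E S G H\<close>)
  then show "\<exists>q. is_coequaliser (RGrph C) D E q" by blast
qed

section \<open>The copy of \<open>X\<close> among cells\<close>

lemma base_simps [simp]:
  "Obj (base X) = ObjCell ` Obj X" "Mor (base X) = MorCell ` Mor X"
  "Dom (base X) (MorCell f) = ObjCell (Dom X f)" "Cod (base X) (MorCell f) = ObjCell (Cod X f)"
  "Ide (base X) (ObjCell a) = MorCell (Ide X a)"
  "MorCell g \<cdot>\<^bsub>base X\<^esub> MorCell f = MorCell (g \<cdot>\<^bsub>X\<^esub> f)"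
  by (simp_all add: base_def)

lemma category_base:
  assumes "category X"
  shows "category (base X)"
  by unfold_locales (use assms in \<open>auto simp: category_assoc\<close>)

lemma is_coequaliser_base:
  assumes X: "category X" and q: "is_coequaliser X f g q"
  shows "is_coequaliser (base X) (MorCell f) (MorCell g) (MorCell q)"
proof (rule is_coequaliserI)
  fix x assume x: "x \<in> Mor (base X)" "Dom (base X) x = Cod (base X) (MorCell f)"
    "x \<cdot>\<^bsub>base X\<^esub> MorCell f = x \<cdot>\<^bsub>base X\<^esub> MorCell g"
  then obtain x' where x': "x = MorCell x'" by auto
  obtain w where "w \<in> Mor X" "Dom X w = Cod X q" "Cod X w = Cod X x'" "w \<cdot>\<^bsub>X\<^esub> q = x'"
    using coequaliser_desc[OF X q, of x'] x x' by auto
  then show "\<exists>w. w \<in> Mor (base X) \<and> Dom (base X) w = Cod (base X) (MorCell q) \<and>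
      Cod (base X) w = Cod (base X) x \<and> w \<cdot>\<^bsub>base X\<^esub> MorCell q = x"
    using x' by (intro exI[of _ "MorCell w"]) auto
qed (use coequaliser_cocone[OF q] coequaliser_epi[OF X q] in auto)

lemma is_kernel_pair_base:
  assumes X: "category X" and k: "is_kernel_pair X f p q"
  shows "is_kernel_pair (base X) (MorCell f) (MorCell p) (MorCell q)"
proof (rule is_kernel_pairI)
  fix x y assume xy: "x \<in> Mor (base X)" "y \<in> Mor (base X)" "Dom (base X) x = Dom (base X) y"
    "Cod (base X) x = Dom (base X) (MorCell f)" "Cod (base X) y = Dom (base X) (MorCell f)"
    "MorCell f \<cdot>\<^bsub>base X\<^esub> x = MorCell f \<cdot>\<^bsub>base X\<^esub> y"
  then obtain x' y' where x': "x = MorCell x'" "y = MorCell y'" by auto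
  obtain u where "u \<in> Mor X" "Dom X u = Dom X y'" "Cod X u = Dom X p" "p \<cdot>\<^bsub>X\<^esub> u = x'" "q \<cdot>\<^bsub>X\<^esub> u = y'"
    using kernel_pair_lift[OF X k, of x' y'] xy x' by auto
  then show "\<exists>u. u \<in> Mor (base X) \<and> Dom (base X) u = Dom (base X) y \<and>
      Cod (base X) u = Dom (base X) (MorCell p) \<and>
      MorCell p \<cdot>\<^bsub>base X\<^esub> u = x \<and> MorCell q \<cdot>\<^bsub>base X\<^esub> u = y"
    using x' by (intro exI[of _ "MorCell u"]) auto
qed (use kernel_pair_cone[OF k] kernel_pair_joint_mono[OF X k] in auto)

lemma has_kernel_pairs_base:
  assumes "category X" "has_kernel_pairs X"
  shows "has_kernel_pairs (base X)"
  using assms is_kernel_pair_base unfolding has_kernel_pairs_def by fastforce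

lemma has_reflexive_coequalisers_base:
  assumes X: "category X" and coeq: "has_reflexive_coequalisers X"
  shows "has_reflexive_coequalisers (base X)"
  unfolding has_reflexive_coequalisers_def
proof (intro allI impI)
  fix d c e assume r: "is_reflexive_graph (base X) d c e"
  then obtain d' c' e' where e: "d = MorCell d'" "c = MorCell c'" "e = MorCell e'" by auto
  with r have "is_reflexive_graph X d' c' e'" by auto
  with coeq show "\<exists>q. is_coequaliser (base X) d c q"
    unfolding has_reflexive_coequalisers_def e using is_coequaliser_base[OF X] by blast
qed

section \<open>Exact Mal'tsev categories\<close>

lemma is_pullbackD:
  assumes "is_pullback C f g p q"
  shows "f \<in> Mor C" "g \<in> Mor C" "p \<in> Mor C" "q \<in> Mor C" "Cod C g = Cod C f" "Dom C q = Dom C p"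
    "Cod C p = Dom C f" "Cod C q = Dom C g" "f \<cdot>\<^bsub>C\<^esub> p = g \<cdot>\<^bsub>C\<^esub> q"
  using assms by (auto simp: is_pullback_def)

lemma regular_epi_epi:
  assumes "category C" "regular_epi C q" "w \<in> Mor C" "w' \<in> Mor C"
    "Dom C w = Cod C q" "Dom C w' = Cod C q" "Cod C w = Cod C w'" "w \<cdot>\<^bsub>C\<^esub> q = w' \<cdot>\<^bsub>C\<^esub> q"
  shows "w = w'"
  using assms coequaliser_epi[OF assms(1)] unfolding regular_epi_def by blast

text \<open>Two generalised elements identified by \<open>m\<close> are lifted along \<open>r\<close> after passing to regular
  covers, where the lifts lie in the kernel pair.\<close>

lemma image_mono:
  assumes X: "regular_category X" and k: "is_kernel_pair X f p q" and r: "is_coequaliser X p q r"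
    and m: "m \<in> Mor X" "Dom X m = Cod X r" "m \<cdot>\<^bsub>X\<^esub> r = f"
    and x: "x \<in> Mor X" "y \<in> Mor X" "Dom X x = Dom X y" "Cod X x = Dom X m" "Cod X y = Dom X m"
      "m \<cdot>\<^bsub>X\<^esub> x = m \<cdot>\<^bsub>X\<^esub> y"
  shows "x = y"
proof -
  have C: "category X" using X by (simp add: regular_category_def)
  note [simp] = kernel_pair_cone(1-6)[OF k] coequaliser_cocone(1-6)[OF r] C m(1,2) x(1-5)
  note red = category_Comp_reduce[OF C]
  have re: "regular_epi X r" using r by (auto simp: regular_epi_def)
  have pb: "\<exists>p q. is_pullback X r z p q \<and> regular_epi X q" if "z \<in> Mor X" "Cod X z = Cod X r" for z
  proof -
    have "r \<in> Mor X" by simp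
    with that X obtain p q where "is_pullback X r z p q"
      unfolding regular_category_def finitely_complete_def by metis
    with X re show ?thesis unfolding regular_category_def by blast
  qed
  obtain x' s where px: "is_pullback X r x x' s" and s: "regular_epi X s"
    using pb[of x] by auto
  note [simp] = is_pullbackD(1-8)[OF px]
  \<comment> \<open>The second cover is taken over \<open>y s\<close> rather than over
    \<open>y\<close>. Both elements are thus lifted along \<open>r\<close> on one common domain,
    that of \<open>t\<close>, as \<open>x' t\<close> and \<open>y'\<close>.\<close>
  obtain y' t where py: "is_pullback X r (y \<cdot>\<^bsub>X\<^esub> s) y' t" and t: "regular_epi X t"
    using pb[of "y \<cdot>\<^bsub>X\<^esub> s"] by auto
  note [simp] = is_pullbackD(1,3,4,6-8)[OF py]
  note pxe = is_pullbackD(9)[OF px] and pye = is_pullbackD(9)[OF py]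
  have "f \<cdot>\<^bsub>X\<^esub> (x' \<cdot>\<^bsub>X\<^esub> t) = m \<cdot>\<^bsub>X\<^esub> (r \<cdot>\<^bsub>X\<^esub> x') \<cdot>\<^bsub>X\<^esub> t"
    by (simp add: category_assoc red[OF m(3)])
  also have "\<dots> = m \<cdot>\<^bsub>X\<^esub> x \<cdot>\<^bsub>X\<^esub> s \<cdot>\<^bsub>X\<^esub> t" by (simp add: pxe category_assoc)
  also have "\<dots> = m \<cdot>\<^bsub>X\<^esub> (r \<cdot>\<^bsub>X\<^esub> y')" by (simp add: x(6) pye category_assoc)
  also have "\<dots> = f \<cdot>\<^bsub>X\<^esub> y'" by (simp add: red[OF m(3)])
  finally have "f \<cdot>\<^bsub>X\<^esub> (x' \<cdot>\<^bsub>X\<^esub> t) = f \<cdot>\<^bsub>X\<^esub> y'" .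
  then obtain u where u: "u \<in> Mor X" "Dom X u = Dom X y'" "Cod X u = Dom X p"
      "p \<cdot>\<^bsub>X\<^esub> u = x' \<cdot>\<^bsub>X\<^esub> t" "q \<cdot>\<^bsub>X\<^esub> u = y'"
    using kernel_pair_lift[OF C k, of "x' \<cdot>\<^bsub>X\<^esub> t" y'] by auto
  have "r \<cdot>\<^bsub>X\<^esub> (p \<cdot>\<^bsub>X\<^esub> u) = r \<cdot>\<^bsub>X\<^esub> (q \<cdot>\<^bsub>X\<^esub> u)"
    using u(1-3) coequaliser_cocone(7)[OF r] by (intro category_Comp_left_cong[OF C]) auto
  then have "x \<cdot>\<^bsub>X\<^esub> s \<cdot>\<^bsub>X\<^esub> t = y \<cdot>\<^bsub>X\<^esub> s \<cdot>\<^bsub>X\<^esub> t"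
    by (simp add: u pye category_assoc red[OF pxe])
  then have "x \<cdot>\<^bsub>X\<^esub> s = y \<cdot>\<^bsub>X\<^esub> s"
    by - (rule regular_epi_epi[OF C t], auto)
  then show ?thesis
    by - (rule regular_epi_epi[OF C s], auto)
qed

lemma regular_category_has_kernel_pairs:
  assumes "regular_category X"
  shows "has_kernel_pairs X"
  unfolding has_kernel_pairs_def is_kernel_pair_def
proof
  fix f assume f: "f \<in> Mor X"
  have "\<forall>f \<in> Mor X. \<forall>g \<in> Mor X. Cod X f = Cod X g \<longrightarrow> (\<exists>p q. is_pullback X f g p q)"
    using assms by (simp add: regular_category_def finitely_complete_def)
  with f show "\<exists>p q. is_pullback X f f p q" by blast
qed

lemma regular_category_kernel_pair_coequaliser:
  assumes "regular_category X" and k: "is_kernel_pair X f p q"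
  shows "\<exists>r. is_coequaliser X p q r"
proof -
  have "\<forall>f p q. is_kernel_pair X f p q \<longrightarrow> (\<exists>r. is_coequaliser X p q r)"
    using assms(1) by (simp add: regular_category_def)
  then show ?thesis using k by blast
qed

text \<open>A reflexive graph need not be jointly monic, so it is replaced by its image in the
  product of the vertex object with itself. The image is a reflexive relation, hence an equivalence
  relation by the Mal'tsev condition, hence a kernel pair by exactness, and so has a coequaliser by
  regularity. The map from the graph onto its image is epic, so the same arrow is a coequaliser of
  the graph.\<close>

lemma exact_Maltsev_has_reflexive_coequalisers:
  assumes X: "exact_Maltsev_category X"
  shows "has_reflexive_coequalisers X"
  unfolding has_reflexive_coequalisers_def
proof (intro allI impI)
  fix d c e assume "is_reflexive_graph X d c e"
  note [simp] = this[simplified]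
  have R: "regular_category X"
    using X by (simp add: exact_Maltsev_category_def Barr_exact_category_def)
  then have C [simp]: "category X" by (simp add: regular_category_def)
  note red = category_Comp_reduce[OF C]
  have k: "\<exists>p q. is_kernel_pair X f p q" if "f \<in> Mor X" for f
    using regular_category_has_kernel_pairs[OF R] that by (simp add: has_kernel_pairs_def)
  let ?a = "Cod X d"
  have "finitely_complete X" using R by (simp add: regular_category_def)
  then obtain t where t: "is_terminal X t" unfolding finitely_complete_def by blast
  have "?a \<in> Obj X" by simp
  then have "\<exists>z. z \<in> Hom X ?a t" using t unfolding is_terminal_def by blast
  then obtain z where z [simp]: "z \<in> Mor X" "Dom X z = ?a" "Cod X z = t" by auto
  \<comment> \<open>the kernel pair of \<open>a \<rightarrow> 1\<close> is the product \<open>a \<times> a\<close>\<close>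
  obtain \<pi>\<^sub>1 \<pi>\<^sub>2 where \<pi>: "is_kernel_pair X z \<pi>\<^sub>1 \<pi>\<^sub>2" using k[of z] by auto
  note [simp] = kernel_pair_cone(2-6)[OF \<pi>]
  have "z \<cdot>\<^bsub>X\<^esub> d \<in> Hom X (Dom X d) t" "z \<cdot>\<^bsub>X\<^esub> c \<in> Hom X (Dom X d) t" by simp_all
  moreover have "Dom X d \<in> Obj X" by simp
  ultimately have "z \<cdot>\<^bsub>X\<^esub> d = z \<cdot>\<^bsub>X\<^esub> c" using t unfolding is_terminal_def by blast
  then obtain f where f [simp]: "f \<in> Mor X" "Dom X f = Dom X d" "Cod X f = Dom X \<pi>\<^sub>1"
    and \<pi>f: "\<pi>\<^sub>1 \<cdot>\<^bsub>X\<^esub> f = d" "\<pi>\<^sub>2 \<cdot>\<^bsub>X\<^esub> f = c"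
    using kernel_pair_lift[OF C \<pi>, of d c] by auto
  \<comment> \<open>Regular image factorisation \<open>f = m r\<close>: the arrow \<open>r\<close>
    is the coequaliser of the kernel pair of \<open>f\<close>, and \<open>m\<close> is monic by
    \<open>image_mono\<close>.\<close>
  obtain p q where pq: "is_kernel_pair X f p q" using k[of f] by auto
  obtain r where r: "is_coequaliser X p q r"
    using regular_category_kernel_pair_coequaliser[OF R pq] by blast
  note [simp] = kernel_pair_cone(2-6)[OF pq] coequaliser_cocone(3,6)[OF r]
  obtain m where m [simp]: "m \<in> Mor X" "Dom X m = Cod X r" "Cod X m = Dom X \<pi>\<^sub>1" and mr: "m \<cdot>\<^bsub>X\<^esub> r = f"
    using coequaliser_desc[OF C r, of f] kernel_pair_cone(7)[OF pq] by auto
  let ?r\<^sub>0 = "\<pi>\<^sub>1 \<cdot>\<^bsub>X\<^esub> m" and ?r\<^sub>1 = "\<pi>\<^sub>2 \<cdot>\<^bsub>X\<^esub> m"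
  have "x = y" if "x \<in> Mor X" "y \<in> Mor X" "Dom X x = Dom X y" "Cod X x = Cod X r" "Cod X y = Cod X r"
    "?r\<^sub>0 \<cdot>\<^bsub>X\<^esub> x = ?r\<^sub>0 \<cdot>\<^bsub>X\<^esub> y" "?r\<^sub>1 \<cdot>\<^bsub>X\<^esub> x = ?r\<^sub>1 \<cdot>\<^bsub>X\<^esub> y" for x y
  proof (rule image_mono[OF R pq r _ _ mr])
    show "m \<cdot>\<^bsub>X\<^esub> x = m \<cdot>\<^bsub>X\<^esub> y"
      by (rule kernel_pair_joint_mono[OF C \<pi>]) (use that in \<open>simp_all add: category_assoc\<close>)
  qed (use that in simp_all)
  then have "is_relation X ?a ?r\<^sub>0 ?r\<^sub>1"
    unfolding is_relation_def by simp
  moreover have "?r\<^sub>0 \<cdot>\<^bsub>X\<^esub> (r \<cdot>\<^bsub>X\<^esub> e) = Ide X ?a" "?r\<^sub>1 \<cdot>\<^bsub>X\<^esub> (r \<cdot>\<^bsub>X\<^esub> e) = Ide X ?a"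
    by (simp_all add: category_assoc red[OF mr] red[OF \<pi>f(1)] red[OF \<pi>f(2)])
  ultimately have "is_reflexive_relation X ?a ?r\<^sub>0 ?r\<^sub>1"
    unfolding is_reflexive_relation_def by (auto intro!: bexI[of _ "r \<cdot>\<^bsub>X\<^esub> e"])
  then obtain g where "is_kernel_pair X g ?r\<^sub>0 ?r\<^sub>1"
    using X unfolding exact_Maltsev_category_def Barr_exact_category_def by blast
  then obtain s where s: "is_coequaliser X ?r\<^sub>0 ?r\<^sub>1 s"
    using regular_category_kernel_pair_coequaliser[OF R] by blast
  note [simp] = coequaliser_cocone(3,6)[OF s, simplified]
  have r01: "x \<cdot>\<^bsub>X\<^esub> d = x \<cdot>\<^bsub>X\<^esub> ?r\<^sub>0 \<cdot>\<^bsub>X\<^esub> r" "x \<cdot>\<^bsub>X\<^esub> c = x \<cdot>\<^bsub>X\<^esub> ?r\<^sub>1 \<cdot>\<^bsub>X\<^esub> r"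
    if "x \<in> Mor X" "Dom X x = Cod X d" for x
    using that by (simp_all add: category_assoc mr \<pi>f)
  have "is_coequaliser X d c s"
  proof (rule is_coequaliserI)
    show "s \<cdot>\<^bsub>X\<^esub> d = s \<cdot>\<^bsub>X\<^esub> c"
      using coequaliser_cocone(7)[OF s] by (simp add: r01)
  next
    fix x assume x: "x \<in> Mor X" "Dom X x = Cod X d" "x \<cdot>\<^bsub>X\<^esub> d = x \<cdot>\<^bsub>X\<^esub> c"
    have "x \<cdot>\<^bsub>X\<^esub> ?r\<^sub>0 = x \<cdot>\<^bsub>X\<^esub> ?r\<^sub>1"
      by (rule coequaliser_epi[OF C r]) (use x r01[OF x(1,2)] in simp_all)
    from coequaliser_desc[OF C s x(1) _ this] x
    show "\<exists>w. w \<in> Mor X \<and> Dom X w = Cod X s \<and> Cod X w = Cod X x \<and> w \<cdot>\<^bsub>X\<^esub> s = x"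
      by auto
  next
    fix w w' assume "w \<in> Mor X" "w' \<in> Mor X" "Dom X w = Cod X s" "Dom X w' = Cod X s"
      "Cod X w = Cod X w'" "w \<cdot>\<^bsub>X\<^esub> s = w' \<cdot>\<^bsub>X\<^esub> s"
    then show "w = w'" by (rule coequaliser_epi[OF C s])
  qed simp_all
  then show "\<exists>q. is_coequaliser X d c q" by blast
qed

section \<open>Adjunctions through universal arrows\<close>

lemma functor_simps:
  assumes "is_functor C D F"
  shows "category C" "category D"
    "a \<in> Obj C \<Longrightarrow> FObj F a \<in> Obj D"
    "f \<in> Mor C \<Longrightarrow> FMor F f \<in> Mor D"
    "f \<in> Mor C \<Longrightarrow> Dom D (FMor F f) = FObj F (Dom C f)"
    "f \<in> Mor C \<Longrightarrow> Cod D (FMor F f) = FObj F (Cod C f)"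
    "a \<in> Obj C \<Longrightarrow> FMor F (Ide C a) = Ide D (FObj F a)"
    "f \<in> Mor C \<Longrightarrow> g \<in> Mor C \<Longrightarrow> Dom C g = Cod C f \<Longrightarrow>
       FMor F (g \<cdot>\<^bsub>C\<^esub> f) = FMor F g \<cdot>\<^bsub>D\<^esub> FMor F f"
  using assms by (simp_all add: is_functor_def)

lemma is_functorI:
  assumes "category C" "category D" "\<And>a. a \<in> Obj C \<Longrightarrow> FObj F a \<in> Obj D"
    "\<And>f. f \<in> Mor C \<Longrightarrow> FMor F f \<in> Hom D (FObj F (Dom C f)) (FObj F (Cod C f))"
    "\<And>a. a \<in> Obj C \<Longrightarrow> FMor F (Ide C a) = Ide D (FObj F a)"
    "\<And>f g. f \<in> Mor C \<Longrightarrow> g \<in> Mor C \<Longrightarrow> Dom C g = Cod C f \<Longrightarrow>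
       FMor F (g \<cdot>\<^bsub>C\<^esub> f) = FMor F g \<cdot>\<^bsub>D\<^esub> FMor F f"
  shows "is_functor C D F"
  using assms by (simp add: is_functor_def)

lemma func_simps [simp]:
  "FObj id_func a = a" "FMor id_func f = f"
  "FObj (G \<circ>\<^sub>F F) a = FObj G (FObj F a)" "FMor (G \<circ>\<^sub>F F) f = FMor G (FMor F f)"
  by (simp_all add: id_func_def comp_func_def)

lemma is_functor_id: "category C \<Longrightarrow> is_functor C C id_func"
  by (simp add: is_functor_def)

lemma is_functor_comp:
  assumes "is_functor C D F" "is_functor D E G"
  shows "is_functor C E (G \<circ>\<^sub>F F)"
  using assms by (simp add: is_functor_def)

lemma is_nat_transI:
  assumes "is_functor C D F" "is_functor C D G"
    "\<And>a. a \<in> Obj C \<Longrightarrow> t a \<in> Hom D (FObj F a) (FObj G a)"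
    "\<And>f. f \<in> Mor C \<Longrightarrow> t (Cod C f) \<cdot>\<^bsub>D\<^esub> FMor F f = FMor G f \<cdot>\<^bsub>D\<^esub> t (Dom C f)"
  shows "is_nat_trans C D F G t"
  using assms by (simp add: is_nat_trans_def)

text \<open>An adjunction presented by universal arrows to \<open>G\<close>. In this form
  adjunctions compose and lift to arrow categories without carrying a counit and triangle identities
  along; \<open>universal_unit_adjunction\<close> supplies the counit where one is required.\<close>

definition universal_unit ::
  "('o1, 'm1) cat \<Rightarrow> ('o2, 'm2) cat \<Rightarrow> ('o1, 'm1, 'o2, 'm2) func \<Rightarrow>
   ('o2, 'm2, 'o1, 'm1) func \<Rightarrow> ('o1 \<Rightarrow> 'm1) \<Rightarrow> bool" where
  "universal_unit C D F G \<eta> \<longleftrightarrow>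
     is_functor C D F \<and> is_functor D C G \<and> is_nat_trans C C id_func (G \<circ>\<^sub>F F) \<eta> \<and>
     (\<forall>a \<in> Obj C. \<forall>b \<in> Obj D. \<forall>f \<in> Hom C a (FObj G b).
        \<exists>!h. h \<in> Hom D (FObj F a) b \<and> FMor G h \<cdot>\<^bsub>C\<^esub> \<eta> a = f)"

lemma universal_unitD:
  assumes "universal_unit C D F G \<eta>"
  shows "is_functor C D F" "is_functor D C G"
    "a \<in> Obj C \<Longrightarrow> \<eta> a \<in> Mor C"
    "a \<in> Obj C \<Longrightarrow> Dom C (\<eta> a) = a"
    "a \<in> Obj C \<Longrightarrow> Cod C (\<eta> a) = FObj G (FObj F a)"
    "f \<in> Mor C \<Longrightarrow> \<eta> (Cod C f) \<cdot>\<^bsub>C\<^esub> f = FMor G (FMor F f) \<cdot>\<^bsub>C\<^esub> \<eta> (Dom C f)"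
  using assms by (simp_all add: universal_unit_def is_nat_trans_def)

lemma universal_unit_transpose:
  assumes "universal_unit C D F G \<eta>" "f \<in> Mor C" "b \<in> Obj D" "Cod C f = FObj G b"
  obtains h where "h \<in> Mor D" "Dom D h = FObj F (Dom C f)" "Cod D h = b"
    "FMor G h \<cdot>\<^bsub>C\<^esub> \<eta> (Dom C f) = f"
proof -
  have "category C" using functor_simps(1) universal_unitD(1) assms(1) by blast
  then have "Dom C f \<in> Obj C" "f \<in> Hom C (Dom C f) (FObj G b)" using assms by simp_all
  then have "\<exists>!h. h \<in> Hom D (FObj F (Dom C f)) b \<and> FMor G h \<cdot>\<^bsub>C\<^esub> \<eta> (Dom C f) = f"
    using assms(1,3) unfolding universal_unit_def by blast
  then show ?thesis using that by auto
qed

lemma universal_unit_unique: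
  assumes u: "universal_unit C D F G \<eta>" and a: "a \<in> Obj C" and "h \<in> Mor D" "h' \<in> Mor D"
    "Dom D h = FObj F a" "Dom D h' = FObj F a" "Cod D h = Cod D h'"
    and e: "FMor G h \<cdot>\<^bsub>C\<^esub> \<eta> a = FMor G h' \<cdot>\<^bsub>C\<^esub> \<eta> a"
  shows "h = h'"
proof -
  note [simp] = functor_simps[OF universal_unitD(1)[OF u]] functor_simps[OF universal_unitD(2)[OF u]]
    universal_unitD(3-5)[OF u]
  have "Cod D h \<in> Obj D" "FMor G h \<cdot>\<^bsub>C\<^esub> \<eta> a \<in> Hom C a (FObj G (Cod D h))"
    using assms(2-7) by simp_all
  then have "\<exists>!k. k \<in> Hom D (FObj F a) (Cod D h) \<and> FMor G k \<cdot>\<^bsub>C\<^esub> \<eta> a = FMor G h \<cdot>\<^bsub>C\<^esub> \<eta> a"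
    using u a unfolding universal_unit_def by blast
  then show ?thesis using assms(3-7) e by auto
qed

lemma universal_unitI:
  assumes F: "is_functor C D F" and G: "is_functor D C G"
    and \<eta>: "\<And>a. a \<in> Obj C \<Longrightarrow> \<eta> a \<in> Hom C a (FObj G (FObj F a))"
    "\<And>f. f \<in> Mor C \<Longrightarrow> \<eta> (Cod C f) \<cdot>\<^bsub>C\<^esub> f = FMor G (FMor F f) \<cdot>\<^bsub>C\<^esub> \<eta> (Dom C f)"
    and ex: "\<And>f b. f \<in> Mor C \<Longrightarrow> b \<in> Obj D \<Longrightarrow> Cod C f = FObj G b \<Longrightarrow>
      \<exists>h. h \<in> Hom D (FObj F (Dom C f)) b \<and> FMor G h \<cdot>\<^bsub>C\<^esub> \<eta> (Dom C f) = f"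
    and un: "\<And>a h h'. a \<in> Obj C \<Longrightarrow> h \<in> Mor D \<Longrightarrow> h' \<in> Mor D \<Longrightarrow> Dom D h = FObj F a \<Longrightarrow>
      Dom D h' = FObj F a \<Longrightarrow> Cod D h = Cod D h' \<Longrightarrow>
      FMor G h \<cdot>\<^bsub>C\<^esub> \<eta> a = FMor G h' \<cdot>\<^bsub>C\<^esub> \<eta> a \<Longrightarrow> h = h'"
  shows "universal_unit C D F G \<eta>"
  unfolding universal_unit_def
proof (intro conjI ballI)
  show "is_nat_trans C C id_func (G \<circ>\<^sub>F F) \<eta>"
    using \<eta> by (intro is_nat_transI is_functor_id is_functor_comp[OF F G] functor_simps(1)[OF F]) auto
next
  fix a b f assume a: "a \<in> Obj C" "b \<in> Obj D" and f: "f \<in> Hom C a (FObj G b)"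
  then obtain h where "h \<in> Hom D (FObj F a) b" "FMor G h \<cdot>\<^bsub>C\<^esub> \<eta> a = f"
    using ex[of f b] by auto
  then show "\<exists>!h. h \<in> Hom D (FObj F a) b \<and> FMor G h \<cdot>\<^bsub>C\<^esub> \<eta> a = f"
    using un[OF a(1)] by (intro ex1I[of _ h]) auto
qed (use F G in auto)

lemma universal_unit_id:
  "category C \<Longrightarrow> universal_unit C C id_func id_func (Ide C)"
  by (rule universal_unitI) (auto intro: is_functor_id)

text \<open>The transpose of \<open>f\<close> is \<open>\<epsilon> b\<close> after
  \<open>F f\<close>. The triangle identity at objects of \<open>D\<close> gives that it is a
  transpose, the one at objects of \<open>C\<close> that it is the only one.\<close>

lemma adjunction_universal_unit:
  assumes adj: "is_adjunction C D F G \<eta> \<epsilon>"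
  shows "universal_unit C D F G \<eta>"
proof -
  have F: "is_functor C D F" and G: "is_functor D C G"
    using adj by (simp_all add: is_adjunction_def)
  note [simp] = functor_simps[OF F] functor_simps[OF G]
  have \<eta> [simp]: "a \<in> Obj C \<Longrightarrow> \<eta> a \<in> Mor C" "a \<in> Obj C \<Longrightarrow> Dom C (\<eta> a) = a"
    "a \<in> Obj C \<Longrightarrow> Cod C (\<eta> a) = FObj G (FObj F a)" for a
    using adj by (simp_all add: is_adjunction_def is_nat_trans_def)
  have \<epsilon> [simp]: "b \<in> Obj D \<Longrightarrow> \<epsilon> b \<in> Mor D" "b \<in> Obj D \<Longrightarrow> Dom D (\<epsilon> b) = FObj F (FObj G b)"
    "b \<in> Obj D \<Longrightarrow> Cod D (\<epsilon> b) = b" for b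
    using adj by (simp_all add: is_adjunction_def is_nat_trans_def)
  have \<eta>_nat: "\<eta> (Cod C f) \<cdot>\<^bsub>C\<^esub> f = FMor G (FMor F f) \<cdot>\<^bsub>C\<^esub> \<eta> (Dom C f)" if "f \<in> Mor C" for f
    using adj that by (simp add: is_adjunction_def is_nat_trans_def)
  have \<epsilon>_nat: "\<epsilon> (Cod D f) \<cdot>\<^bsub>D\<^esub> FMor F (FMor G f) = f \<cdot>\<^bsub>D\<^esub> \<epsilon> (Dom D f)" if "f \<in> Mor D" for f
    using adj that by (simp add: is_adjunction_def is_nat_trans_def)
  have tri: "\<epsilon> (FObj F a) \<cdot>\<^bsub>D\<^esub> FMor F (\<eta> a) = Ide D (FObj F a)" if "a \<in> Obj C" for a
    using adj that by (simp add: is_adjunction_def)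
  have tri': "FMor G (\<epsilon> b) \<cdot>\<^bsub>C\<^esub> \<eta> (FObj G b) = Ide C (FObj G b)" if "b \<in> Obj D" for b
    using adj that by (simp add: is_adjunction_def)
  show ?thesis
  proof (rule universal_unitI[OF F G])
    fix f b assume f: "f \<in> Mor C" and b: "b \<in> Obj D" "Cod C f = FObj G b"
    have "FMor G (\<epsilon> b \<cdot>\<^bsub>D\<^esub> FMor F f) \<cdot>\<^bsub>C\<^esub> \<eta> (Dom C f) = FMor G (\<epsilon> b) \<cdot>\<^bsub>C\<^esub> (\<eta> (Cod C f) \<cdot>\<^bsub>C\<^esub> f)"
      using f b unfolding \<eta>_nat[OF f] by (simp add: category_assoc)
    also have "\<dots> = FMor G (\<epsilon> b) \<cdot>\<^bsub>C\<^esub> \<eta> (FObj G b) \<cdot>\<^bsub>C\<^esub> f"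
      using f b by (simp add: category_assoc)
    also have "\<dots> = f" using f b by (simp add: tri')
    finally show "\<exists>h. h \<in> Hom D (FObj F (Dom C f)) b \<and> FMor G h \<cdot>\<^bsub>C\<^esub> \<eta> (Dom C f) = f"
      using f b by (intro exI[of _ "\<epsilon> b \<cdot>\<^bsub>D\<^esub> FMor F f"]) simp
  next
    fix a h h' assume h: "a \<in> Obj C" "h \<in> Mor D" "h' \<in> Mor D" "Dom D h = FObj F a"
      "Dom D h' = FObj F a" "Cod D h = Cod D h'"
      "FMor G h \<cdot>\<^bsub>C\<^esub> \<eta> a = FMor G h' \<cdot>\<^bsub>C\<^esub> \<eta> a"
    \<comment> \<open>Every morphism out of \<open>F a\<close> is recovered from its transpose,
      hence determined by it.\<close>
    have *: "k = \<epsilon> (Cod D k) \<cdot>\<^bsub>D\<^esub> FMor F (FMor G k \<cdot>\<^bsub>C\<^esub> \<eta> a)" if k: "k \<in> Mor D" "Dom D k = FObj F a" for k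
    proof -
      have "\<epsilon> (Cod D k) \<cdot>\<^bsub>D\<^esub> FMor F (FMor G k \<cdot>\<^bsub>C\<^esub> \<eta> a) =
          \<epsilon> (Cod D k) \<cdot>\<^bsub>D\<^esub> FMor F (FMor G k) \<cdot>\<^bsub>D\<^esub> FMor F (\<eta> a)"
        using k h(1) by (simp add: category_assoc)
      also have "\<dots> = k" using k h(1) tri[OF h(1)] by (simp add: \<epsilon>_nat category_assoc)
      finally show ?thesis ..
    qed
    have "h = \<epsilon> (Cod D h) \<cdot>\<^bsub>D\<^esub> FMor F (FMor G h \<cdot>\<^bsub>C\<^esub> \<eta> a)" using h by (intro *)
    also have "\<dots> = h'" using h *[of h'] by simp
    finally show "h = h'" .
  qed (use \<eta>_nat in auto)
qed

text \<open>The counit at \<open>b\<close> is the transpose of the identity of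
  \<open>G b\<close>.\<close>

lemma universal_unit_adjunction:
  assumes u: "universal_unit C D F G \<eta>"
  shows "\<exists>\<epsilon>. is_adjunction C D F G \<eta> \<epsilon>"
proof -
  have F: "is_functor C D F" and G: "is_functor D C G"
    using universal_unitD[OF u] by simp_all
  note [simp] = functor_simps[OF F] functor_simps[OF G] universal_unitD(3-5)[OF u]
  note nat = universal_unitD(6)[OF u]
  have "\<exists>h. h \<in> Hom D (FObj F (FObj G b)) b \<and> FMor G h \<cdot>\<^bsub>C\<^esub> \<eta> (FObj G b) = Ide C (FObj G b)"
    if "b \<in> Obj D" for b
    using universal_unit_transpose[OF u, of "Ide C (FObj G b)" b] that by auto
  then obtain \<epsilon> where \<epsilon>: "\<And>b. b \<in> Obj D \<Longrightarrow> \<epsilon> b \<in> Hom D (FObj F (FObj G b)) b"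
    and tri: "\<And>b. b \<in> Obj D \<Longrightarrow> FMor G (\<epsilon> b) \<cdot>\<^bsub>C\<^esub> \<eta> (FObj G b) = Ide C (FObj G b)"
    by metis
  note [simp] = \<epsilon>[simplified, THEN conjunct1] \<epsilon>[simplified, THEN conjunct2, THEN conjunct1]
    \<epsilon>[simplified, THEN conjunct2, THEN conjunct2]
  \<comment> \<open>The transpose of a general \<open>f\<close> is \<open>\<epsilon> b\<close> after
    \<open>F f\<close>. Naturality of the counit and the remaining triangle identity follow by
    comparing transposes.\<close>
  have move: "FMor G (\<epsilon> b \<cdot>\<^bsub>D\<^esub> FMor F f) \<cdot>\<^bsub>C\<^esub> \<eta> (Dom C f) = f"
    if "f \<in> Mor C" "b \<in> Obj D" "Cod C f = FObj G b" for f b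
  proof -
    have "FMor G (\<epsilon> b \<cdot>\<^bsub>D\<^esub> FMor F f) \<cdot>\<^bsub>C\<^esub> \<eta> (Dom C f) = FMor G (\<epsilon> b) \<cdot>\<^bsub>C\<^esub> (\<eta> (Cod C f) \<cdot>\<^bsub>C\<^esub> f)"
      using that unfolding nat[OF that(1)] by (simp add: category_assoc)
    also have "\<dots> = FMor G (\<epsilon> b) \<cdot>\<^bsub>C\<^esub> \<eta> (FObj G b) \<cdot>\<^bsub>C\<^esub> f"
      using that by (simp add: category_assoc)
    also have "\<dots> = f" using that by (simp add: tri)
    finally show ?thesis .
  qed
  have "is_nat_trans D D (F \<circ>\<^sub>F G) id_func \<epsilon>"
  proof (rule is_nat_transI)
    fix f assume f: "f \<in> Mor D"
    let ?a = "FObj G (Dom D f)"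
    have "FMor G (f \<cdot>\<^bsub>D\<^esub> \<epsilon> (Dom D f)) \<cdot>\<^bsub>C\<^esub> \<eta> ?a = FMor G f"
      using f by (simp add: category_assoc tri)
    moreover have "FMor G (\<epsilon> (Cod D f) \<cdot>\<^bsub>D\<^esub> FMor F (FMor G f)) \<cdot>\<^bsub>C\<^esub> \<eta> ?a = FMor G f"
      using move[of "FMor G f" "Cod D f"] f by simp
    ultimately have "\<epsilon> (Cod D f) \<cdot>\<^bsub>D\<^esub> FMor F (FMor G f) = f \<cdot>\<^bsub>D\<^esub> \<epsilon> (Dom D f)"
      by - (rule universal_unit_unique[OF u, of ?a], use f in simp_all)
    then show "\<epsilon> (Cod D f) \<cdot>\<^bsub>D\<^esub> FMor (F \<circ>\<^sub>F G) f = FMor id_func f \<cdot>\<^bsub>D\<^esub> \<epsilon> (Dom D f)"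
      by simp
  qed (auto intro: is_functor_id is_functor_comp[OF G F])
  moreover have "\<epsilon> (FObj F a) \<cdot>\<^bsub>D\<^esub> FMor F (\<eta> a) = Ide D (FObj F a)" if a: "a \<in> Obj C" for a
    by (rule universal_unit_unique[OF u a]) (use a move[of "\<eta> a" "FObj F a"] in simp_all)
  moreover have "is_nat_trans C C id_func (G \<circ>\<^sub>F F) \<eta>"
    using u by (simp add: universal_unit_def)
  ultimately show ?thesis
    using F G tri unfolding is_adjunction_def by blast
qed

lemma universal_unit_comp:
  assumes u: "universal_unit C D F G \<eta>" and u': "universal_unit D E F' G' \<eta>'"
  shows "universal_unit C E (F' \<circ>\<^sub>F F) (G \<circ>\<^sub>F G') (\<lambda>a. FMor G (\<eta>' (FObj F a)) \<cdot>\<^bsub>C\<^esub> \<eta> a)"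
proof -
  note F = universal_unitD(1)[OF u] and G = universal_unitD(2)[OF u]
  note F' = universal_unitD(1)[OF u'] and G' = universal_unitD(2)[OF u']
  note [simp] = functor_simps[OF F] functor_simps[OF G] universal_unitD(3-5)[OF u]
  note [simp] = functor_simps[OF F'] functor_simps[OF G'] universal_unitD(3-5)[OF u']
  have C: "category C" by simp
  show ?thesis
  proof (rule universal_unitI[OF is_functor_comp[OF F F'] is_functor_comp[OF G' G]])
    fix f assume f: "f \<in> Mor C"
    have "FMor G (\<eta>' (FObj F (Cod C f))) \<cdot>\<^bsub>C\<^esub> \<eta> (Cod C f) \<cdot>\<^bsub>C\<^esub> f =
        FMor G (\<eta>' (Cod D (FMor F f)) \<cdot>\<^bsub>D\<^esub> FMor F f) \<cdot>\<^bsub>C\<^esub> \<eta> (Dom C f)"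
      using f by (simp add: category_assoc universal_unitD(6)[OF u f])
    also have "\<dots> = FMor G (FMor G' (FMor F' (FMor F f))) \<cdot>\<^bsub>C\<^esub>
        (FMor G (\<eta>' (FObj F (Dom C f))) \<cdot>\<^bsub>C\<^esub> \<eta> (Dom C f))"
      using f by (subst universal_unitD(6)[OF u']) (simp_all add: category_assoc)
    finally show "FMor G (\<eta>' (FObj F (Cod C f))) \<cdot>\<^bsub>C\<^esub> \<eta> (Cod C f) \<cdot>\<^bsub>C\<^esub> f =
      FMor (G \<circ>\<^sub>F G') (FMor (F' \<circ>\<^sub>F F) f) \<cdot>\<^bsub>C\<^esub> (FMor G (\<eta>' (FObj F (Dom C f))) \<cdot>\<^bsub>C\<^esub> \<eta> (Dom C f))"
      by simp
  next
    fix f b assume f: "f \<in> Mor C" and b: "b \<in> Obj E" "Cod C f = FObj (G \<circ>\<^sub>F G') b"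
    obtain h where h: "h \<in> Mor D" "Dom D h = FObj F (Dom C f)" "Cod D h = FObj G' b"
      "FMor G h \<cdot>\<^bsub>C\<^esub> \<eta> (Dom C f) = f"
      using universal_unit_transpose[OF u f, of "FObj G' b"] b by auto
    obtain k where k: "k \<in> Mor E" "Dom E k = FObj F' (Dom D h)" "Cod E k = b"
      "FMor G' k \<cdot>\<^bsub>D\<^esub> \<eta>' (Dom D h) = h"
      using universal_unit_transpose[OF u' h(1), of b] b h by auto
    have "FMor G (FMor G' k) \<cdot>\<^bsub>C\<^esub> (FMor G (\<eta>' (FObj F (Dom C f))) \<cdot>\<^bsub>C\<^esub> \<eta> (Dom C f)) =
        FMor G (FMor G' k \<cdot>\<^bsub>D\<^esub> \<eta>' (Dom D h)) \<cdot>\<^bsub>C\<^esub> \<eta> (Dom C f)"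
      using f h(1,2) k(1,2) by (simp add: category_assoc)
    also have "\<dots> = f" using h k by simp
    finally show "\<exists>h. h \<in> Hom E (FObj (F' \<circ>\<^sub>F F) (Dom C f)) b \<and>
        FMor (G \<circ>\<^sub>F G') h \<cdot>\<^bsub>C\<^esub> (FMor G (\<eta>' (FObj F (Dom C f))) \<cdot>\<^bsub>C\<^esub> \<eta> (Dom C f)) = f"
      using k h by (intro exI[of _ k]) simp
  next
    fix a h h' assume h: "a \<in> Obj C" "h \<in> Mor E" "h' \<in> Mor E" "Dom E h = FObj (F' \<circ>\<^sub>F F) a"
      "Dom E h' = FObj (F' \<circ>\<^sub>F F) a" "Cod E h = Cod E h'"
      and e: "FMor (G \<circ>\<^sub>F G') h \<cdot>\<^bsub>C\<^esub> (FMor G (\<eta>' (FObj F a)) \<cdot>\<^bsub>C\<^esub> \<eta> a) =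
        FMor (G \<circ>\<^sub>F G') h' \<cdot>\<^bsub>C\<^esub> (FMor G (\<eta>' (FObj F a)) \<cdot>\<^bsub>C\<^esub> \<eta> a)"
    have "FMor G' h \<cdot>\<^bsub>D\<^esub> \<eta>' (FObj F a) = FMor G' h' \<cdot>\<^bsub>D\<^esub> \<eta>' (FObj F a)"
      by (rule universal_unit_unique[OF u h(1)]) (use h e in \<open>simp_all add: category_assoc\<close>)
    then show "h = h'"
      by - (rule universal_unit_unique[OF u', of "FObj F a"], use h in simp_all)
  qed simp_all
qed

section \<open>Functors and adjunctions on arrow categories\<close>

lemma Arr_func_simps [simp]:
  "FObj (Arr_func F) f = FMor F f"
  "FMor (Arr_func F) (ArrMor f g u v) = ArrMor (FMor F f) (FMor F g) (FMor F u) (FMor F v)"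
  by (simp_all add: Arr_func_def)

lemma is_functor_Arr_func:
  assumes F: "is_functor C D F"
  shows "is_functor (Arr C) (Arr D) (Arr_func F)"
proof -
  note [simp] = functor_simps[OF F]
  note comp = functor_simps(8)[OF F, symmetric]
  show ?thesis
    by (rule is_functorI) (auto elim!: Mor_Arr_cases simp: comp simp del: functor_simps(8)[OF F])
qed

text \<open>A square transposes componentwise. The resulting pair of maps is again a square because
  its two composites transpose to the two composites of the original square, which agree.\<close>

lemma universal_unit_Arr:
  assumes u: "universal_unit C D F G \<eta>"
  shows "universal_unit (Arr C) (Arr D) (Arr_func F) (Arr_func G)
    (\<lambda>f. ArrMor f (FMor G (FMor F f)) (\<eta> (Dom C f)) (\<eta> (Cod C f)))"
proof -
  note F = universal_unitD(1)[OF u] and G = universal_unitD(2)[OF u]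
  note [simp] = functor_simps[OF F] functor_simps[OF G] universal_unitD(3-5)[OF u]
  note nat = universal_unitD(6)[OF u]
  have C: "category C" by simp
  show ?thesis
  proof (rule universal_unitI[OF is_functor_Arr_func[OF F] is_functor_Arr_func[OF G]])
    fix s b assume s: "s \<in> Mor (Arr C)" and b: "b \<in> Obj (Arr D)" "Cod (Arr C) s = FObj (Arr_func G) b"
    then obtain f u\<^sub>0 v\<^sub>0 where s': "s = ArrMor f (FMor G b) u\<^sub>0 v\<^sub>0" by (auto elim!: Mor_Arr_cases)
    note [simp] = s[unfolded s', simplified] b(1)[simplified]
    obtain h where h [simp]: "h \<in> Mor D" "Dom D h = FObj F (Dom C f)" "Cod D h = Dom D b"
      and hu: "FMor G h \<cdot>\<^bsub>C\<^esub> \<eta> (Dom C f) = u\<^sub>0"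
      using universal_unit_transpose[OF u, of u\<^sub>0 "Dom D b"] by auto
    obtain k where k [simp]: "k \<in> Mor D" "Dom D k = FObj F (Cod C f)" "Cod D k = Cod D b"
      and kv: "FMor G k \<cdot>\<^bsub>C\<^esub> \<eta> (Cod C f) = v\<^sub>0"
      using universal_unit_transpose[OF u, of v\<^sub>0 "Cod D b"] by auto
    have "FMor G (k \<cdot>\<^bsub>D\<^esub> FMor F f) \<cdot>\<^bsub>C\<^esub> \<eta> (Dom C f) = FMor G k \<cdot>\<^bsub>C\<^esub> (\<eta> (Cod C f) \<cdot>\<^bsub>C\<^esub> f)"
      unfolding nat[of f, simplified] by (simp add: category_assoc)
    also have "\<dots> = v\<^sub>0 \<cdot>\<^bsub>C\<^esub> f" by (simp add: category_Comp_reduce[OF C kv])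
    also have "\<dots> = FMor G (b \<cdot>\<^bsub>D\<^esub> h) \<cdot>\<^bsub>C\<^esub> \<eta> (Dom C f)" by (simp add: category_assoc hu)
    finally have "k \<cdot>\<^bsub>D\<^esub> FMor F f = b \<cdot>\<^bsub>D\<^esub> h"
      by - (rule universal_unit_unique[OF u, of "Dom C f"], simp_all)
    then show "\<exists>h. h \<in> Hom (Arr D) (FObj (Arr_func F) (Dom (Arr C) s)) b \<and>
        FMor (Arr_func G) h \<cdot>\<^bsub>Arr C\<^esub> ArrMor (Dom (Arr C) s) (FMor G (FMor F (Dom (Arr C) s)))
          (\<eta> (Dom C (Dom (Arr C) s))) (\<eta> (Cod C (Dom (Arr C) s))) = s"
      using hu kv by (intro exI[of _ "ArrMor (FMor F f) b h k"]) (simp add: s')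
  next
    fix f s t
    assume f: "f \<in> Obj (Arr C)" and st: "s \<in> Mor (Arr D)" "t \<in> Mor (Arr D)"
      "Dom (Arr D) s = FObj (Arr_func F) f" "Dom (Arr D) t = FObj (Arr_func F) f"
      "Cod (Arr D) s = Cod (Arr D) t"
      "FMor (Arr_func G) s \<cdot>\<^bsub>Arr C\<^esub> ArrMor f (FMor G (FMor F f)) (\<eta> (Dom C f)) (\<eta> (Cod C f)) =
       FMor (Arr_func G) t \<cdot>\<^bsub>Arr C\<^esub> ArrMor f (FMor G (FMor F f)) (\<eta> (Dom C f)) (\<eta> (Cod C f))"
    then obtain g h k h' k' where "s = ArrMor (FMor F f) g h k" "t = ArrMor (FMor F f) g h' k'"
      by (auto elim!: Mor_Arr_cases)
    with f st show "s = t"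
      using universal_unit_unique[OF u, of "Dom C f" h h'] universal_unit_unique[OF u, of "Cod C f" k k']
      by simp
  next
    fix s assume s: "s \<in> Mor (Arr C)"
    then obtain f g u\<^sub>0 v\<^sub>0 where s': "s = ArrMor f g u\<^sub>0 v\<^sub>0" by (auto elim!: Mor_Arr_cases)
    with s show "ArrMor (Cod (Arr C) s) (FMor G (FMor F (Cod (Arr C) s)))
        (\<eta> (Dom C (Cod (Arr C) s))) (\<eta> (Cod C (Cod (Arr C) s))) \<cdot>\<^bsub>Arr C\<^esub> s =
      FMor (Arr_func G) (FMor (Arr_func F) s) \<cdot>\<^bsub>Arr C\<^esub>
        ArrMor (Dom (Arr C) s) (FMor G (FMor F (Dom (Arr C) s)))
          (\<eta> (Dom C (Dom (Arr C) s))) (\<eta> (Cod C (Dom (Arr C) s)))"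
      using nat[of u\<^sub>0] nat[of v\<^sub>0] by simp
  qed (simp_all add: nat)
qed

section \<open>Restriction of an adjunction to an equivalence\<close>

text \<open>For a right adjoint \<open>G\<close> this amounts to invertibility of the counit at
  \<open>b\<close>. The formulation by hom-sets involves \<open>G\<close> alone, so it does not
  depend on a chosen unit and counit, and it can be compared directly for \<open>G\<close> and for
  \<open>Eq\<close> after \<open>Arr_func G\<close>.\<close>

definition full_faithful_at ::
  "('o1, 'm1) cat \<Rightarrow> ('o2, 'm2) cat \<Rightarrow> ('o2, 'm2, 'o1, 'm1) func \<Rightarrow> 'o2 \<Rightarrow> bool" where
  "full_faithful_at C D G b \<longleftrightarrow>
     (\<forall>b' \<in> Obj D. \<forall>g \<in> Hom C (FObj G b) (FObj G b'). \<exists>!h. h \<in> Hom D b b' \<and> FMor G h = g)"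

lemma full_faithful_at_lift:
  assumes "full_faithful_at C D G b" "g \<in> Mor C" "Dom C g = FObj G b" "Cod C g = FObj G b'" "b' \<in> Obj D"
  obtains h where "h \<in> Mor D" "Dom D h = b" "Cod D h = b'" "FMor G h = g"
  using assms unfolding full_faithful_at_def by fastforce

lemma full_faithful_at_inj:
  assumes ff: "full_faithful_at C D G b" and G: "is_functor D C G"
    and h: "h \<in> Mor D" "h' \<in> Mor D" "Dom D h = b" "Dom D h' = b" "Cod D h = Cod D h'"
    and e: "FMor G h = FMor G h'"
  shows "h = h'"
proof -
  note [simp] = functor_simps[OF G]
  have "Cod D h \<in> Obj D" "FMor G h \<in> Hom C (FObj G b) (FObj G (Cod D h))" using h by auto
  then have "\<exists>!k. k \<in> Hom D b (Cod D h) \<and> FMor G k = FMor G h"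
    using ff unfolding full_faithful_at_def by blast
  then show ?thesis using h e by auto
qed

lemma full_faithful_atI:
  assumes "\<And>b' g. b' \<in> Obj D \<Longrightarrow> g \<in> Mor C \<Longrightarrow> Dom C g = FObj G b \<Longrightarrow> Cod C g = FObj G b' \<Longrightarrow>
      \<exists>h. h \<in> Mor D \<and> Dom D h = b \<and> Cod D h = b' \<and> FMor G h = g"
    and "\<And>h h'. h \<in> Mor D \<Longrightarrow> h' \<in> Mor D \<Longrightarrow> Dom D h = b \<Longrightarrow> Dom D h' = b \<Longrightarrow>
      Cod D h = Cod D h' \<Longrightarrow> FMor G h = FMor G h' \<Longrightarrow> h = h'"
  shows "full_faithful_at C D G b"
  unfolding full_faithful_at_def
proof (intro ballI)
  fix b' g assume "b' \<in> Obj D" "g \<in> Hom C (FObj G b) (FObj G b')"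
  then obtain h where "h \<in> Mor D" "Dom D h = b" "Cod D h = b'" "FMor G h = g"
    using assms(1)[of b' g] by auto
  then show "\<exists>!h. h \<in> Hom D b b' \<and> FMor G h = g"
    using assms(2) by (intro ex1I[of _ h]) auto
qed

lemma is_isoI:
  assumes "f \<in> Mor C" "g \<in> Mor C" "Dom C g = Cod C f" "Cod C g = Dom C f"
    "g \<cdot>\<^bsub>C\<^esub> f = Ide C (Dom C f)" "f \<cdot>\<^bsub>C\<^esub> g = Ide C (Cod C f)"
  shows "is_iso C f"
  using assms unfolding is_iso_def by auto

lemma is_isoE:
  assumes "is_iso C f"
  obtains g where "f \<in> Mor C" "g \<in> Mor C" "Dom C g = Cod C f" "Cod C g = Dom C f"
    "g \<cdot>\<^bsub>C\<^esub> f = Ide C (Dom C f)" "f \<cdot>\<^bsub>C\<^esub> g = Ide C (Cod C f)"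
  using assms unfolding is_iso_def by auto

lemma isomorphic_refl:
  assumes "category C" "a \<in> Obj C"
  shows "isomorphic C a a"
proof -
  have "is_iso C (Ide C a)" using assms by (intro is_isoI[of _ _ "Ide C a"]) simp_all
  then show ?thesis using assms unfolding isomorphic_def by (intro bexI[of _ "Ide C a"]) simp_all
qed

text \<open>Morphisms out of the two objects correspond by composition with \<open>i\<close> and its
  inverse. Invariance is needed because the ends of a cube will only be isomorphic to values of
  \<open>F\<close>.\<close>

lemma full_faithful_at_iso:
  assumes ff: "full_faithful_at C D G (Cod D i)" and G: "is_functor D C G" and i: "is_iso D i"
  shows "full_faithful_at C D G (Dom D i)"
proof -
  note [simp] = functor_simps[OF G]
  obtain j where [simp]: "i \<in> Mor D" "j \<in> Mor D" "Dom D j = Cod D i" "Cod D j = Dom D i"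
    and ji: "j \<cdot>\<^bsub>D\<^esub> i = Ide D (Dom D i)" and ij: "i \<cdot>\<^bsub>D\<^esub> j = Ide D (Cod D i)"
    using is_isoE[OF i] by blast
  have Gji: "FMor G j \<cdot>\<^bsub>C\<^esub> FMor G i = Ide C (FObj G (Dom D i))"
    using functor_simps(8)[OF G, of i j] by (simp add: ji)
  show ?thesis
  proof (rule full_faithful_atI)
    fix b' g assume g: "b' \<in> Obj D" "g \<in> Mor C" "Dom C g = FObj G (Dom D i)" "Cod C g = FObj G b'"
    obtain h where h: "h \<in> Mor D" "Dom D h = Cod D i" "Cod D h = b'" "FMor G h = g \<cdot>\<^bsub>C\<^esub> FMor G j"
      by (rule full_faithful_at_lift[OF ff, of "g \<cdot>\<^bsub>C\<^esub> FMor G j" b']) (use g in simp_all)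
    with g show "\<exists>h. h \<in> Mor D \<and> Dom D h = Dom D i \<and> Cod D h = b' \<and> FMor G h = g"
      by (intro exI[of _ "h \<cdot>\<^bsub>D\<^esub> i"]) (simp add: category_assoc Gji)
  next
    fix h h' assume h: "h \<in> Mor D" "h' \<in> Mor D" "Dom D h = Dom D i" "Dom D h' = Dom D i"
      "Cod D h = Cod D h'" "FMor G h = FMor G h'"
    have e: "h \<cdot>\<^bsub>D\<^esub> j = h' \<cdot>\<^bsub>D\<^esub> j"
      by (rule full_faithful_at_inj[OF ff G]) (use h in simp_all)
    have "h = h \<cdot>\<^bsub>D\<^esub> j \<cdot>\<^bsub>D\<^esub> i" using h by (simp add: category_assoc ji)
    also have "\<dots> = h'" unfolding e using h by (simp add: category_assoc ji)
    finally show "h = h'" .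
  qed
qed

lemma adjunction_counit:
  assumes "is_adjunction C D F G \<eta> \<epsilon>" "b \<in> Obj D"
  shows "\<epsilon> b \<in> Mor D" "Dom D (\<epsilon> b) = FObj F (FObj G b)" "Cod D (\<epsilon> b) = b"
    "FMor G (\<epsilon> b) \<cdot>\<^bsub>C\<^esub> \<eta> (FObj G b) = Ide C (FObj G b)"
  using assms by (simp_all add: is_adjunction_def is_nat_trans_def)

text \<open>The inverse is the morphism \<open>b -> F G b\<close> that fullness provides over the
  unit at \<open>G b\<close>. One composite is an identity by faithfulness and a triangle identity,
  the other by uniqueness of transposes.\<close>

lemma counit_is_iso:
  assumes adj: "is_adjunction C D F G \<eta> \<epsilon>" and b: "b \<in> Obj D"
    and ff: "full_faithful_at C D G b"
  shows "is_iso D (\<epsilon> b)"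
proof -
  note u = adjunction_universal_unit[OF adj]
  note F = universal_unitD(1)[OF u] and G = universal_unitD(2)[OF u]
  note [simp] = functor_simps[OF F] functor_simps[OF G] universal_unitD(3-5)[OF u] b
  note [simp] = adjunction_counit(1-3)[OF adj b]
  note tri = adjunction_counit(4)[OF adj b]
  obtain h where h: "h \<in> Mor D" "Dom D h = b" "Cod D h = FObj F (FObj G b)" "FMor G h = \<eta> (FObj G b)"
    by (rule full_faithful_at_lift[OF ff, of "\<eta> (FObj G b)" "FObj F (FObj G b)"]) simp_all
  have "\<epsilon> b \<cdot>\<^bsub>D\<^esub> h = Ide D b"
    by (rule full_faithful_at_inj[OF ff G]) (use h in \<open>simp_all add: tri\<close>)
  moreover have "h \<cdot>\<^bsub>D\<^esub> \<epsilon> b = Ide D (FObj F (FObj G b))"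
    by (rule universal_unit_unique[OF u, of "FObj G b"]) (use h in \<open>simp_all add: category_assoc tri\<close>)
  ultimately show ?thesis using h by (intro is_isoI[of _ _ h]) simp_all
qed

text \<open>The inverse is \<open>G (\<epsilon> b)\<close>, and one composite is a triangle
  identity. The other is an endomorphism of \<open>G F G b\<close>, hence \<open>G h\<close> for an
  endomorphism \<open>h\<close> of \<open>F G b\<close>; precomposing \<open>G h\<close> with the
  unit gives back the unit, so \<open>h\<close> is the identity by uniqueness of transposes.\<close>

lemma unit_is_iso:
  assumes adj: "is_adjunction C D F G \<eta> \<epsilon>" and b: "b \<in> Obj D"
    and ff: "full_faithful_at C D G (FObj F (FObj G b))"
  shows "is_iso C (\<eta> (FObj G b))"
proof -
  note u = adjunction_universal_unit[OF adj]
  note F = universal_unitD(1)[OF u] and G = universal_unitD(2)[OF u]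
  note [simp] = functor_simps[OF F] functor_simps[OF G] universal_unitD(3-5)[OF u] b
  note [simp] = adjunction_counit(1-3)[OF adj b]
  note tri = adjunction_counit(4)[OF adj b]
  obtain h where h: "h \<in> Mor D" "Dom D h = FObj F (FObj G b)" "Cod D h = FObj F (FObj G b)"
    "FMor G h = \<eta> (FObj G b) \<cdot>\<^bsub>C\<^esub> FMor G (\<epsilon> b)"
    by (rule full_faithful_at_lift[OF ff, of "\<eta> (FObj G b) \<cdot>\<^bsub>C\<^esub> FMor G (\<epsilon> b)" "FObj F (FObj G b)"])
      simp_all
  have "h = Ide D (FObj F (FObj G b))"
    by (rule universal_unit_unique[OF u, of "FObj G b"]) (use h in \<open>simp_all add: category_assoc tri\<close>)
  with h have "\<eta> (FObj G b) \<cdot>\<^bsub>C\<^esub> FMor G (\<epsilon> b) = Ide C (FObj G (FObj F (FObj G b)))" by simp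
  with tri show ?thesis by (intro is_isoI[of _ _ "FMor G (\<epsilon> b)"]) simp_all
qed

text \<open>By naturality \<open>t\<close> at \<open>Dom C i\<close> is \<open>t\<close> at
  \<open>Cod C i\<close> conjugated by the images of \<open>i\<close>. This extends invertibility of
  the unit from the values of \<open>G\<close> to its replete image.\<close>

lemma nat_trans_is_iso_cong:
  assumes t: "is_nat_trans C D F G t" and i: "is_iso C i" and iso: "is_iso D (t (Cod C i))"
  shows "is_iso D (t (Dom C i))"
proof -
  have F: "is_functor C D F" and G: "is_functor C D G"
    and t1 [simp]: "\<And>a. a \<in> Obj C \<Longrightarrow> t a \<in> Mor D" "\<And>a. a \<in> Obj C \<Longrightarrow> Dom D (t a) = FObj F a"
      "\<And>a. a \<in> Obj C \<Longrightarrow> Cod D (t a) = FObj G a"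
    and nat: "\<And>f. f \<in> Mor C \<Longrightarrow> t (Cod C f) \<cdot>\<^bsub>D\<^esub> FMor F f = FMor G f \<cdot>\<^bsub>D\<^esub> t (Dom C f)"
    using t by (simp_all add: is_nat_trans_def)
  note [simp] = functor_simps[OF F] functor_simps[OF G]
  obtain j where [simp]: "i \<in> Mor C" "j \<in> Mor C" "Dom C j = Cod C i" "Cod C j = Dom C i"
    and ji: "j \<cdot>\<^bsub>C\<^esub> i = Ide C (Dom C i)" "i \<cdot>\<^bsub>C\<^esub> j = Ide C (Cod C i)"
    using is_isoE[OF i] by blast
  obtain k where [simp]: "k \<in> Mor D" "Dom D k = FObj G (Cod C i)" "Cod D k = FObj F (Cod C i)"
    and k: "k \<cdot>\<^bsub>D\<^esub> t (Cod C i) = Ide D (FObj F (Cod C i))" "t (Cod C i) \<cdot>\<^bsub>D\<^esub> k = Ide D (FObj G (Cod C i))"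
    using is_isoE[OF iso] by auto
  have D: "category D" by simp
  note red = category_Comp_reduce[OF D]
  have F': "FMor F j \<cdot>\<^bsub>D\<^esub> FMor F i = Ide D (FObj F (Dom C i))"
    using functor_simps(8)[OF F, of i j] by (simp add: ji)
  have G': "FMor G j \<cdot>\<^bsub>D\<^esub> FMor G i = Ide D (FObj G (Dom C i))"
    using functor_simps(8)[OF G, of i j] by (simp add: ji)
  have nat_i: "FMor G i \<cdot>\<^bsub>D\<^esub> t (Dom C i) = t (Cod C i) \<cdot>\<^bsub>D\<^esub> FMor F i" using nat[of i] by simp
  have nat_j: "t (Dom C i) \<cdot>\<^bsub>D\<^esub> FMor F j = FMor G j \<cdot>\<^bsub>D\<^esub> t (Cod C i)" using nat[of j] by simp
  show ?thesis
  proof (rule is_isoI[of _ _ "FMor F j \<cdot>\<^bsub>D\<^esub> (k \<cdot>\<^bsub>D\<^esub> FMor G i)"])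
    show "FMor F j \<cdot>\<^bsub>D\<^esub> (k \<cdot>\<^bsub>D\<^esub> FMor G i) \<cdot>\<^bsub>D\<^esub> t (Dom C i) = Ide D (Dom D (t (Dom C i)))"
      by (simp add: category_assoc nat_i red[OF k(1)] F')
    show "t (Dom C i) \<cdot>\<^bsub>D\<^esub> (FMor F j \<cdot>\<^bsub>D\<^esub> (k \<cdot>\<^bsub>D\<^esub> FMor G i)) = Ide D (Cod D (t (Dom C i)))"
      by (simp add: category_assoc red[OF nat_j] red[OF k(2)] G')
  qed simp_all
qed

section \<open>Full subcategories\<close>

lemma full_subcat_on_simps [simp]:
  "Obj (full_subcat_on C S) = Obj C \<inter> S"
  "Mor (full_subcat_on C S) = {f \<in> Mor C. Dom C f \<in> S \<and> Cod C f \<in> S}"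
  "Dom (full_subcat_on C S) = Dom C" "Cod (full_subcat_on C S) = Cod C"
  "Ide (full_subcat_on C S) = Ide C" "Comp (full_subcat_on C S) = Comp C"
  by (simp_all add: full_subcat_on_def)

lemma category_full_subcat_on [simp]:
  "category C \<Longrightarrow> category (full_subcat_on C S)"
  by unfold_locales (auto simp: category_assoc)

lemma is_full_subcat_full_subcat_on:
  "category C \<Longrightarrow> is_full_subcat (full_subcat_on C S) C"
  by (auto simp: is_full_subcat_def)

lemma is_iso_full_subcat_on:
  assumes "is_iso C f" "Dom C f \<in> S" "Cod C f \<in> S"
  shows "is_iso (full_subcat_on C S) f"
proof -
  obtain g where "f \<in> Mor C" "g \<in> Mor C" "Dom C g = Cod C f" "Cod C g = Dom C f"
    "g \<cdot>\<^bsub>C\<^esub> f = Ide C (Dom C f)" "f \<cdot>\<^bsub>C\<^esub> g = Ide C (Cod C f)"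
    using is_isoE[OF assms(1)] .
  with assms show ?thesis by (intro is_isoI[of _ _ g]) simp_all
qed

lemma is_functor_full_subcat_on:
  assumes "is_functor C D F" "\<And>a. a \<in> Obj C \<Longrightarrow> a \<in> S \<Longrightarrow> FObj F a \<in> T"
  shows "is_functor (full_subcat_on C S) (full_subcat_on D T) F"
  using assms by (auto simp: is_functor_def)

text \<open>The assumption on \<open>F\<close> says that the adjunction is idempotent; then its unit is invertible
  exactly on the replete image of \<open>G\<close>, and its counit at the objects where \<open>G\<close> is full and
  faithful.\<close>

lemma idempotent_adjunction_restricts:
  assumes adj: "is_adjunction C D F G \<eta> \<epsilon>"
    and ff: "\<And>a. a \<in> Obj C \<Longrightarrow> full_faithful_at C D G (FObj F a)"
  shows "restricts_to_equivalence C D F G \<eta> \<epsilon>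
    (full_subcat_on C {a. \<exists>b \<in> Obj D. isomorphic C a (FObj G b)})
    (full_subcat_on D {b. full_faithful_at C D G b})"
    (is "restricts_to_equivalence C D F G \<eta> \<epsilon> (full_subcat_on C ?S) (full_subcat_on D ?T)")
proof -
  note u = adjunction_universal_unit[OF adj]
  note F = universal_unitD(1)[OF u] and G = universal_unitD(2)[OF u]
  note [simp] = functor_simps[OF F] functor_simps[OF G] universal_unitD(3-5)[OF u]
  have \<eta>: "is_nat_trans C C id_func (G \<circ>\<^sub>F F) \<eta>" and \<epsilon>: "is_nat_trans D D (F \<circ>\<^sub>F G) id_func \<epsilon>"
    using adj by (simp_all add: is_adjunction_def)
  have GS: "FObj G b \<in> ?S" if "b \<in> Obj D" for b
    using that isomorphic_refl[of C "FObj G b"] by auto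
  have F': "is_functor (full_subcat_on C ?S) (full_subcat_on D ?T) F"
    using ff by (intro is_functor_full_subcat_on[OF F]) simp
  have G': "is_functor (full_subcat_on D ?T) (full_subcat_on C ?S) G"
    using GS by (intro is_functor_full_subcat_on[OF G])
  have \<eta>_iso: "is_iso C (\<eta> a)" if a: "a \<in> Obj C" "a \<in> ?S" for a
  proof -
    obtain b i where b: "b \<in> Obj D" and i: "Dom C i = a" "Cod C i = FObj G b" "is_iso C i"
      using a unfolding isomorphic_def by auto
    have "is_iso C (\<eta> (FObj G b))"
      using unit_is_iso[OF adj b] ff b by simp
    with nat_trans_is_iso_cong[OF \<eta> i(3)] i show ?thesis by simp
  qed
  have "is_nat_iso (full_subcat_on C ?S) (full_subcat_on C ?S) id_func (G \<circ>\<^sub>F F) \<eta>"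
    unfolding is_nat_iso_def
  proof (intro conjI ballI)
    show "is_nat_trans (full_subcat_on C ?S) (full_subcat_on C ?S) id_func (G \<circ>\<^sub>F F) \<eta>"
    proof (rule is_nat_transI)
      show "is_functor (full_subcat_on C ?S) (full_subcat_on C ?S) (G \<circ>\<^sub>F F)"
        by (rule is_functor_comp[OF F' G'])
    next
      fix a assume "a \<in> Obj (full_subcat_on C ?S)"
      then show "\<eta> a \<in> Hom (full_subcat_on C ?S) (FObj id_func a) (FObj (G \<circ>\<^sub>F F) a)"
        using GS[of "FObj F a"] by simp
    next
      fix f assume "f \<in> Mor (full_subcat_on C ?S)"
      then show "\<eta> (Cod (full_subcat_on C ?S) f) \<cdot>\<^bsub>full_subcat_on C ?S\<^esub> FMor id_func f =
          FMor (G \<circ>\<^sub>F F) f \<cdot>\<^bsub>full_subcat_on C ?S\<^esub> \<eta> (Dom (full_subcat_on C ?S) f)"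
        using universal_unitD(6)[OF u, of f] by simp
    qed (simp add: is_functor_id)
  next
    fix a assume "a \<in> Obj (full_subcat_on C ?S)"
    then show "is_iso (full_subcat_on C ?S) (\<eta> a)"
      using GS[of "FObj F a"] \<eta>_iso[of a] by (intro is_iso_full_subcat_on) simp_all
  qed
  moreover have "is_nat_iso (full_subcat_on D ?T) (full_subcat_on D ?T) (F \<circ>\<^sub>F G) id_func \<epsilon>"
    unfolding is_nat_iso_def
  proof (intro conjI ballI)
    show "is_nat_trans (full_subcat_on D ?T) (full_subcat_on D ?T) (F \<circ>\<^sub>F G) id_func \<epsilon>"
    proof (rule is_nat_transI)
      show "is_functor (full_subcat_on D ?T) (full_subcat_on D ?T) (F \<circ>\<^sub>F G)"
        by (rule is_functor_comp[OF G' F'])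
    next
      fix b assume "b \<in> Obj (full_subcat_on D ?T)"
      then show "\<epsilon> b \<in> Hom (full_subcat_on D ?T) (FObj (F \<circ>\<^sub>F G) b) (FObj id_func b)"
        using adjunction_counit[OF adj, of b] ff by simp
    next
      fix f assume "f \<in> Mor (full_subcat_on D ?T)"
      then show "\<epsilon> (Cod (full_subcat_on D ?T) f) \<cdot>\<^bsub>full_subcat_on D ?T\<^esub> FMor (F \<circ>\<^sub>F G) f =
          FMor id_func f \<cdot>\<^bsub>full_subcat_on D ?T\<^esub> \<epsilon> (Dom (full_subcat_on D ?T) f)"
        using \<epsilon> by (simp add: is_nat_trans_def)
    qed (simp add: is_functor_id)
  next
    fix b assume "b \<in> Obj (full_subcat_on D ?T)"
    then show "is_iso (full_subcat_on D ?T) (\<epsilon> b)"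
      using counit_is_iso[OF adj, of b] adjunction_counit[OF adj, of b] ff
      by (intro is_iso_full_subcat_on) simp_all
  qed
  ultimately show ?thesis
    using adj F' G' by (simp add: restricts_to_equivalence_def is_equivalence_def is_full_subcat_full_subcat_on)
qed

section \<open>Coequalisers and kernel pairs as adjoint functors\<close>

lemma coeq_of_is_coequaliser:
  assumes "has_reflexive_coequalisers C" "G \<in> RGrph_objs C"
  shows "is_coequaliser C (rg_d G) (rg_c G) (coeq_of C G)"
proof -
  obtain d c e where "G = RG d c e" "is_reflexive_graph C d c e"
    using assms(2) unfolding RGrph_objs_def by blast
  then have "\<exists>q. is_coequaliser C (rg_d G) (rg_c G) q"
    using assms(1) unfolding has_reflexive_coequalisers_def by (metis cell.sel(7,8))
  then show ?thesis unfolding coeq_of_def by (rule someI_ex)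
qed

text \<open>The choices in the definition of \<open>eq_of\<close> are legitimate: a kernel pair
  exists, and the diagonal is the unique lift of the pair of identities.\<close>

lemma eq_of_cases:
  assumes C: "category C" and kp: "has_kernel_pairs C" and f: "f \<in> Mor C"
  obtains p q e where "eq_of C f = RG p q e" "is_kernel_pair C f p q" "is_reflexive_graph C p q e"
proof -
  obtain p q where pq: "kernel_pair_of C f = (p, q)" by fastforce
  have "\<exists>z. case z of (p, q) \<Rightarrow> is_kernel_pair C f p q"
    using kp f by (auto simp: has_kernel_pairs_def)
  then have "case kernel_pair_of C f of (p, q) \<Rightarrow> is_kernel_pair C f p q"
    unfolding kernel_pair_of_def by (rule someI_ex)
  then have k: "is_kernel_pair C f p q" by (simp add: pq)
  note [simp] = kernel_pair_cone[OF k] C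
  let ?P = "\<lambda>e. e \<in> Hom C (Dom C f) (Dom C p) \<and>
    p \<cdot>\<^bsub>C\<^esub> e = Ide C (Dom C f) \<and> q \<cdot>\<^bsub>C\<^esub> e = Ide C (Dom C f)"
  obtain e where "?P e"
    using kernel_pair_lift[OF C k, of "Ide C (Dom C f)" "Ide C (Dom C f)"] by auto
  then have "\<exists>!e. ?P e" using kernel_pair_joint_mono[OF C k] by (intro ex1I[of _ e]) auto
  then have "?P (THE e. ?P e)" by (rule theI')
  then show ?thesis using that[of p q "THE e. ?P e"] k by (simp add: eq_of_def pq)
qed

lemma eq_of_in_RGrph_objs:
  assumes "category C" "has_kernel_pairs C" "f \<in> Mor C"
  shows "eq_of C f \<in> RGrph_objs C" "rg_verts C (eq_of C f) = Dom C f"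
proof -
  obtain p q e where "eq_of C f = RG p q e" "is_kernel_pair C f p q" "is_reflexive_graph C p q e"
    using eq_of_cases[OF assms] .
  then show "eq_of C f \<in> RGrph_objs C" "rg_verts C (eq_of C f) = Dom C f"
    by (simp_all del: is_reflexive_graph_iff add: kernel_pair_cone)
qed

text \<open>The edge component is fixed by its composites with the projections of the kernel pair,
  and these are given by the vertex component. Functoriality of \<open>Eq\<close> and naturality of
  the unit are thereby checked on vertices alone.\<close>

lemma RGMor_into_eq_of_ext:
  assumes C: "category C" and kp: "has_kernel_pairs C" and f: "f \<in> Mor C"
    and s: "s \<in> Mor (RGrph C)" "t \<in> Mor (RGrph C)" "Dom (RGrph C) s = Dom (RGrph C) t"
      "Cod (RGrph C) s = eq_of C f" "Cod (RGrph C) t = eq_of C f" "on_verts s = on_verts t"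
  shows "s = t"
proof -
  obtain p q e where e: "eq_of C f = RG p q e" and k: "is_kernel_pair C f p q"
    using eq_of_cases[OF C kp f] .
  obtain G u v u' where s': "s = RGMor G (RG p q e) u v" "t = RGMor G (RG p q e) u' v"
    using s e by (elim Mor_RGrph_cases) simp
  have "u = u'"
    by (rule kernel_pair_joint_mono[OF C k]) (use s(1,2) s' in auto)
  then show ?thesis using s' by simp
qed

text \<open>The edge component is the lift of \<open>v d\<close> and \<open>v c\<close>;
  compatibility with the splittings then holds by joint monicity. Together with
  \<open>RGMor_into_eq_of_ext\<close> and \<open>RGMor_into_eq_of_coequalises\<close>, this
  identifies morphisms from a graph to the kernel pair of \<open>f\<close> with vertex maps
  \<open>v\<close> such that \<open>f v\<close> coequalises the graph.\<close>

lemma RGMor_into_eq_of_ex: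
  assumes C: "category C" and kp: "has_kernel_pairs C" and f: "f \<in> Mor C"
    and G: "RG d c e \<in> RGrph_objs C" and v: "v \<in> Mor C" "Dom C v = Cod C d" "Cod C v = Dom C f"
    and eq: "f \<cdot>\<^bsub>C\<^esub> (v \<cdot>\<^bsub>C\<^esub> d) = f \<cdot>\<^bsub>C\<^esub> (v \<cdot>\<^bsub>C\<^esub> c)"
  shows "\<exists>u. RGMor (RG d c e) (eq_of C f) u v \<in> Mor (RGrph C)"
proof -
  note red = category_Comp_reduce[OF C]
  obtain p q e' where e': "eq_of C f = RG p q e'" and k: "is_kernel_pair C f p q"
    and r: "is_reflexive_graph C p q e'"
    using eq_of_cases[OF C kp f] .
  note [simp] = kernel_pair_cone(1-6)[OF k] C v r[simplified] G[simplified]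
  obtain u where u [simp]: "u \<in> Mor C" "Dom C u = Dom C d" "Cod C u = Dom C p"
    and pu: "p \<cdot>\<^bsub>C\<^esub> u = v \<cdot>\<^bsub>C\<^esub> d" "q \<cdot>\<^bsub>C\<^esub> u = v \<cdot>\<^bsub>C\<^esub> c"
    using kernel_pair_lift[OF C k _ _ _ _ _ eq] by auto
  have r': "p \<cdot>\<^bsub>C\<^esub> e' = Ide C (Dom C f)" "q \<cdot>\<^bsub>C\<^esub> e' = Ide C (Dom C f)" by simp_all
  have "u \<cdot>\<^bsub>C\<^esub> e = e' \<cdot>\<^bsub>C\<^esub> v"
    by (rule kernel_pair_joint_mono[OF C k]) (simp_all add: category_assoc pu[THEN red] r'[THEN red])
  then show ?thesis using pu by (intro exI[of _ u]) (simp add: e')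
qed

lemma RGMor_into_eq_of_coequalises:
  assumes C: "category C" and kp: "has_kernel_pairs C" and f: "f \<in> Mor C"
    and s: "RGMor (RG d c e) (eq_of C f) u v \<in> Mor (RGrph C)"
  shows "f \<cdot>\<^bsub>C\<^esub> (v \<cdot>\<^bsub>C\<^esub> d) = f \<cdot>\<^bsub>C\<^esub> (v \<cdot>\<^bsub>C\<^esub> c)"
proof -
  obtain p q e' where e': "eq_of C f = RG p q e'" and k: "is_kernel_pair C f p q"
    using eq_of_cases[OF C kp f] .
  have u: "u \<in> Mor C" "Dom C u = Dom C d" "Cod C u = Dom C p"
    and pu: "v \<cdot>\<^bsub>C\<^esub> d = p \<cdot>\<^bsub>C\<^esub> u" "v \<cdot>\<^bsub>C\<^esub> c = q \<cdot>\<^bsub>C\<^esub> u" using s e' by simp_all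
  show ?thesis
    unfolding pu using u by (intro category_Comp_left_cong[OF C]) (simp_all add: kernel_pair_cone[OF k])
qed

lemma FMor_Eq:
  assumes C: "category C" and kp: "has_kernel_pairs C" and s: "s \<in> Mor (Arr C)"
  shows "FMor (Eq C) s \<in> Hom (RGrph C) (eq_of C (arr_src s)) (eq_of C (arr_tgt s))"
    "on_verts (FMor (Eq C) s) = on_dom s"
proof -
  obtain f g u v where s': "s = ArrMor f g u v" using s by (auto elim!: Mor_Arr_cases)
  note [simp] = s[unfolded s', simplified] C
  have f: "f \<in> Mor C" and g: "g \<in> Mor C" by simp_all
  obtain p q e where e: "eq_of C f = RG p q e" and k: "is_kernel_pair C f p q"
    using eq_of_cases[OF C kp f] .
  obtain p' q' e' where e': "eq_of C g = RG p' q' e'" and k': "is_kernel_pair C g p' q'"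
    using eq_of_cases[OF C kp g] .
  have RG: "RG p q e \<in> RGrph_objs C" using eq_of_in_RGrph_objs(1)[OF C kp f] e by simp
  note [simp] = kernel_pair_cone(1-6)[OF k] kernel_pair_cone(1-6)[OF k']
  have "g \<cdot>\<^bsub>C\<^esub> (u \<cdot>\<^bsub>C\<^esub> z) = v \<cdot>\<^bsub>C\<^esub> (f \<cdot>\<^bsub>C\<^esub> z)" if "z \<in> Mor C" "Cod C z = Dom C f" for z
    using that by (subst category_assoc[OF C, of z f v, symmetric]) (simp_all add: category_assoc)
  then have "g \<cdot>\<^bsub>C\<^esub> (u \<cdot>\<^bsub>C\<^esub> p) = g \<cdot>\<^bsub>C\<^esub> (u \<cdot>\<^bsub>C\<^esub> q)"
    using kernel_pair_cone(7)[OF k] by simp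
  then obtain w where w: "RGMor (eq_of C f) (eq_of C g) w u \<in> Mor (RGrph C)"
    using RGMor_into_eq_of_ex[OF C kp g RG, of u] e by auto
  let ?P = "\<lambda>w. w \<in> Hom C (rg_edges C (eq_of C f)) (rg_edges C (eq_of C g)) \<and>
    rg_d (eq_of C g) \<cdot>\<^bsub>C\<^esub> w = u \<cdot>\<^bsub>C\<^esub> rg_d (eq_of C f) \<and>
    rg_c (eq_of C g) \<cdot>\<^bsub>C\<^esub> w = u \<cdot>\<^bsub>C\<^esub> rg_c (eq_of C f)"
  have "?P w" using w by simp
  moreover have "w' = w" if "?P w'" for w'
    by (rule kernel_pair_joint_mono[OF C k']) (use w that e e' in auto)
  ultimately have "(THE w. ?P w) = w" by (rule the_equality)
  then have *: "FMor (Eq C) s = RGMor (eq_of C f) (eq_of C g) w u"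
    by (simp add: Eq_def s')
  show "FMor (Eq C) s \<in> Hom (RGrph C) (eq_of C (arr_src s)) (eq_of C (arr_tgt s))"
    unfolding * using w by (simp add: s' del: RGMor_in_Mor)
  show "on_verts (FMor (Eq C) s) = on_dom s" unfolding * by (simp add: s')
qed

lemma FObj_Eq [simp]: "FObj (Eq C) = eq_of C"
  by (simp add: Eq_def)

lemma is_functor_Eq:
  assumes C: "category C" and kp: "has_kernel_pairs C"
  shows "is_functor (Arr C) (RGrph C) (Eq C)"
proof (rule is_functorI)
  fix f assume f: "f \<in> Obj (Arr C)"
  then have i: "Ide (Arr C) f \<in> Mor (Arr C)" "f \<in> Mor C" using C by simp_all
  show "FMor (Eq C) (Ide (Arr C) f) = Ide (RGrph C) (FObj (Eq C) f)"
    by (rule RGMor_into_eq_of_ext[OF C kp i(2)])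
      (use FMor_Eq[OF C kp i(1)] eq_of_in_RGrph_objs[OF C kp i(2)] category_Ide[OF category_RGrph[OF C], of "eq_of C f"]
        in \<open>simp_all del: RGMor_in_Mor\<close>)
next
  fix s t assume st: "s \<in> Mor (Arr C)" "t \<in> Mor (Arr C)" "Dom (Arr C) t = Cod (Arr C) s"
  have ts: "t \<cdot>\<^bsub>Arr C\<^esub> s \<in> Mor (Arr C)" using C st by (intro category_Comp) simp_all
  note s = FMor_Eq[OF C kp st(1)] and t = FMor_Eq[OF C kp st(2)]
  have "arr_tgt t \<in> Mor C" using st by (auto elim!: Mor_Arr_cases)
  then show "FMor (Eq C) (t \<cdot>\<^bsub>Arr C\<^esub> s) = FMor (Eq C) t \<cdot>\<^bsub>RGrph C\<^esub> FMor (Eq C) s"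
  proof (rule RGMor_into_eq_of_ext[OF C kp])
    show "FMor (Eq C) t \<cdot>\<^bsub>RGrph C\<^esub> FMor (Eq C) s \<in> Mor (RGrph C)"
      using s t st C by (intro category_Comp) simp_all
  qed (use FMor_Eq[OF C kp ts] s t in simp_all)
qed (use C FMor_Eq[OF C kp] eq_of_in_RGrph_objs[OF C kp] in auto)

lemma FMor_Coeq:
  assumes C: "category C" and rc: "has_reflexive_coequalisers C" and s: "s \<in> Mor (RGrph C)"
  shows "FMor (Coeq C) s \<in> Hom (Arr C) (coeq_of C (rg_src s)) (coeq_of C (rg_tgt s))"
    "on_dom (FMor (Coeq C) s) = on_verts s"
proof -
  obtain G H u v where s': "s = RGMor G H u v" and GH: "G \<in> RGrph_objs C" "H \<in> RGrph_objs C"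
    using s by (auto elim!: Mor_RGrph_cases)
  obtain d c e d' c' e' where G: "G = RG d c e" and H: "H = RG d' c' e'"
    using GH by (auto simp: RGrph_objs_def)
  note [simp] = s[unfolded s' G H, simplified] C
  let ?q = "coeq_of C G" and ?q' = "coeq_of C H"
  have k: "is_coequaliser C d c ?q" and k': "is_coequaliser C d' c' ?q'"
    using coeq_of_is_coequaliser[OF rc GH(1)] coeq_of_is_coequaliser[OF rc GH(2)] by (simp_all add: G H)
  note [simp] = coequaliser_cocone(1-6)[OF k] coequaliser_cocone(1-6)[OF k']
  obtain w where w: "w \<in> Mor C" "Dom C w = Cod C ?q" "Cod C w = Cod C ?q'" "w \<cdot>\<^bsub>C\<^esub> ?q = ?q' \<cdot>\<^bsub>C\<^esub> v"
    by (rule coequaliser_map[OF C k k', of v u]) auto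
  let ?P = "\<lambda>w. w \<in> Hom C (Cod C ?q) (Cod C ?q') \<and> w \<cdot>\<^bsub>C\<^esub> ?q = ?q' \<cdot>\<^bsub>C\<^esub> v"
  have "?P w" using w by simp
  moreover have "w' = w" if "?P w'" for w'
    by (rule coequaliser_epi[OF C k]) (use w that in auto)
  ultimately have "(THE w. ?P w) = w" by (rule the_equality)
  then have *: "FMor (Coeq C) s = ArrMor ?q ?q' v w"
    by (simp add: Coeq_def s')
  show "FMor (Coeq C) s \<in> Hom (Arr C) (coeq_of C (rg_src s)) (coeq_of C (rg_tgt s))"
    unfolding * using w by (simp add: s')
  show "on_dom (FMor (Coeq C) s) = on_verts s" unfolding * by (simp add: s')
qed

lemma FObj_Coeq [simp]: "FObj (Coeq C) = coeq_of C"
  by (simp add: Coeq_def)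

lemma ArrMor_from_coequaliser_ext:
  assumes C: "category C" and q: "is_coequaliser C d c q"
    and s: "s \<in> Mor (Arr C)" "t \<in> Mor (Arr C)" "Dom (Arr C) s = q" "Dom (Arr C) t = q"
      "Cod (Arr C) s = Cod (Arr C) t" "on_dom s = on_dom t"
  shows "s = t"
proof -
  obtain r u v v' where s': "s = ArrMor q r u v" "t = ArrMor q r u v'"
    using s by (elim Mor_Arr_cases) simp
  have "v = v'"
    by (rule coequaliser_epi[OF C q]) (use s(1,2) s' in auto)
  then show ?thesis using s' by simp
qed

lemma is_functor_Coeq:
  assumes C: "category C" and rc: "has_reflexive_coequalisers C"
  shows "is_functor (RGrph C) (Arr C) (Coeq C)"
proof (rule is_functorI)
  fix G assume G: "G \<in> Obj (RGrph C)"
  then have i: "Ide (RGrph C) G \<in> Mor (RGrph C)" "G \<in> RGrph_objs C"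
    using category_Ide[OF category_RGrph[OF C]] by simp_all
  note q = coeq_of_is_coequaliser[OF rc i(2)]
  show "FMor (Coeq C) (Ide (RGrph C) G) = Ide (Arr C) (FObj (Coeq C) G)"
    by (rule ArrMor_from_coequaliser_ext[OF C q])
      (use FMor_Coeq[OF C rc i(1)] coequaliser_cocone[OF q] category_Ide[OF category_Arr[OF C], of "coeq_of C G"]
        in \<open>simp_all add: rg_verts_def del: ArrMor_in_Mor\<close>)
next
  fix s t assume st: "s \<in> Mor (RGrph C)" "t \<in> Mor (RGrph C)" "Dom (RGrph C) t = Cod (RGrph C) s"
  have ts: "t \<cdot>\<^bsub>RGrph C\<^esub> s \<in> Mor (RGrph C)" using C st by (intro category_Comp) simp_all
  note s = FMor_Coeq[OF C rc st(1)] and t = FMor_Coeq[OF C rc st(2)]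
  have "rg_src s \<in> RGrph_objs C" using st by (auto elim!: Mor_RGrph_cases)
  note q = coeq_of_is_coequaliser[OF rc this]
  show "FMor (Coeq C) (t \<cdot>\<^bsub>RGrph C\<^esub> s) = FMor (Coeq C) t \<cdot>\<^bsub>Arr C\<^esub> FMor (Coeq C) s"
  proof (rule ArrMor_from_coequaliser_ext[OF C q])
    show "FMor (Coeq C) t \<cdot>\<^bsub>Arr C\<^esub> FMor (Coeq C) s \<in> Mor (Arr C)"
      using s t st C by (intro category_Comp) simp_all
  qed (use FMor_Coeq[OF C rc ts] s t in simp_all)
next
  fix G assume "G \<in> Obj (RGrph C)"
  then show "FObj (Coeq C) G \<in> Obj (Arr C)"
    using coequaliser_cocone(3)[OF coeq_of_is_coequaliser[OF rc]] by simp
qed (use C FMor_Coeq[OF C rc] in auto)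

text \<open>If \<open>q\<close> is the coequaliser of a graph, then \<open>q d = q c\<close> makes
  the identity on vertices a morphism into the kernel pair of \<open>q\<close>: this is the unit. A
  morphism to the kernel pair of \<open>r\<close> with vertex part \<open>v\<close> makes
  \<open>r v\<close> coequalise the graph, so \<open>r v\<close> factors as \<open>k q\<close>; the
  square formed by \<open>v\<close> and \<open>k\<close> is the transpose.\<close>

lemma universal_unit_Coeq_Eq:
  assumes C: "category C" and kp: "has_kernel_pairs C" and rc: "has_reflexive_coequalisers C"
  shows "\<exists>\<eta>. universal_unit (RGrph C) (Arr C) (Coeq C) (Eq C) \<eta> \<and>
    (\<forall>G \<in> RGrph_objs C. on_verts (\<eta> G) = Ide C (rg_verts C G))"
proof -
  note CE = FMor_Coeq[OF C rc] FMor_Eq[OF C kp]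
  note RC = category_RGrph[OF C]
  have "\<exists>u. RGMor G (eq_of C (coeq_of C G)) u (Ide C (rg_verts C G)) \<in> Mor (RGrph C)"
    if G: "G \<in> RGrph_objs C" for G
  proof -
    obtain d c e where G': "G = RG d c e" using G by (auto simp: RGrph_objs_def)
    note [simp] = G[unfolded G', simplified] C
    have q: "is_coequaliser C d c (coeq_of C G)"
      using coeq_of_is_coequaliser[OF rc G] by (simp add: G')
    note [simp] = coequaliser_cocone[OF q[unfolded G']]
    show ?thesis
      unfolding G' by (rule RGMor_into_eq_of_ex[OF C kp]) simp_all
  qed
  then obtain \<mu> where \<mu>: "\<And>G. G \<in> RGrph_objs C \<Longrightarrow>
      RGMor G (eq_of C (coeq_of C G)) (\<mu> G) (Ide C (rg_verts C G)) \<in> Mor (RGrph C)"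
    by metis
  define \<eta> where "\<eta> G = RGMor G (eq_of C (coeq_of C G)) (\<mu> G) (Ide C (rg_verts C G))" for G
  have \<eta>: "\<eta> G \<in> Mor (RGrph C)" "Dom (RGrph C) (\<eta> G) = G"
    "Cod (RGrph C) (\<eta> G) = eq_of C (coeq_of C G)" "on_verts (\<eta> G) = Ide C (rg_verts C G)"
    if "G \<in> RGrph_objs C" for G
    using \<mu>[OF that] by (simp_all add: \<eta>_def)
  have q: "is_coequaliser C (rg_d G) (rg_c G) (coeq_of C G)" if "G \<in> RGrph_objs C" for G
    by (rule coeq_of_is_coequaliser[OF rc that])
  have q_Mor: "coeq_of C G \<in> Mor C" if "G \<in> RGrph_objs C" for G
    using coequaliser_cocone(3)[OF q[OF that]] .
  have "universal_unit (RGrph C) (Arr C) (Coeq C) (Eq C) \<eta>"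
  proof (rule universal_unitI[OF is_functor_Coeq[OF C rc] is_functor_Eq[OF C kp]])
    fix s assume s: "s \<in> Mor (RGrph C)"
    then obtain G H u v where s': "s = RGMor G H u v" and GH: "G \<in> RGrph_objs C" "H \<in> RGrph_objs C"
        "v \<in> Mor C" "Dom C v = rg_verts C G" "Cod C v = rg_verts C H"
      by (auto elim!: Mor_RGrph_cases)
    have Fs: "FMor (Coeq C) s \<in> Mor (Arr C)" using CE(1)[OF s] by simp
    show "\<eta> (Cod (RGrph C) s) \<cdot>\<^bsub>RGrph C\<^esub> s = FMor (Eq C) (FMor (Coeq C) s) \<cdot>\<^bsub>RGrph C\<^esub> \<eta> (Dom (RGrph C) s)"
    proof (rule RGMor_into_eq_of_ext[OF C kp q_Mor[OF GH(2)]])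
      show "\<eta> (Cod (RGrph C) s) \<cdot>\<^bsub>RGrph C\<^esub> s \<in> Mor (RGrph C)"
        using s \<eta> GH by (intro category_Comp[OF RC]) (simp_all add: s' del: RGMor_in_Mor)
      show "FMor (Eq C) (FMor (Coeq C) s) \<cdot>\<^bsub>RGrph C\<^esub> \<eta> (Dom (RGrph C) s) \<in> Mor (RGrph C)"
        using CE(1)[OF s] CE(3)[OF Fs] \<eta> GH by (intro category_Comp[OF RC]) (simp_all add: s')
    qed (use CE(1,2)[OF s] CE(3,4)[OF Fs] \<eta> GH C in \<open>simp_all add: s'\<close>)
  next
    fix s r assume s: "s \<in> Mor (RGrph C)" and r: "r \<in> Obj (Arr C)" "Cod (RGrph C) s = FObj (Eq C) r"
    then obtain G u v where s': "s = RGMor G (eq_of C r) u v" and G: "G \<in> RGrph_objs C"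
      by (auto elim!: Mor_RGrph_cases)
    obtain d c e where G': "G = RG d c e" using G by (auto simp: RGrph_objs_def)
    have r' [simp]: "r \<in> Mor C" using r by simp
    note [simp] = eq_of_in_RGrph_objs[OF C kp r'] C
    note [simp] = s[unfolded s' G', simplified]
    note qG = q[OF G, unfolded G', simplified, folded G']
    note [simp] = coequaliser_cocone(3,6)[OF qG]
    have "r \<cdot>\<^bsub>C\<^esub> v \<cdot>\<^bsub>C\<^esub> d = r \<cdot>\<^bsub>C\<^esub> v \<cdot>\<^bsub>C\<^esub> c"
      using RGMor_into_eq_of_coequalises[OF C kp r' s[unfolded s' G']] by (simp add: category_assoc)
    then obtain k where k: "k \<in> Mor C" "Dom C k = Cod C (coeq_of C G)" "Cod C k = Cod C r"
      "k \<cdot>\<^bsub>C\<^esub> coeq_of C G = r \<cdot>\<^bsub>C\<^esub> v"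
      using coequaliser_desc[OF C qG, of "r \<cdot>\<^bsub>C\<^esub> v"] by auto
    let ?h = "ArrMor (coeq_of C G) r v k"
    have h: "?h \<in> Mor (Arr C)" using k by simp
    have "FMor (Eq C) ?h \<cdot>\<^bsub>RGrph C\<^esub> \<eta> G = s"
    proof (rule RGMor_into_eq_of_ext[OF C kp r'])
      show "FMor (Eq C) ?h \<cdot>\<^bsub>RGrph C\<^esub> \<eta> G \<in> Mor (RGrph C)"
        using CE(3)[OF h] \<eta> G by (intro category_Comp[OF RC]) simp_all
    qed (use s CE(3,4)[OF h] \<eta>[OF G] in \<open>simp_all add: s' del: RGMor_in_Mor\<close>, simp add: G')
    then show "\<exists>h. h \<in> Hom (Arr C) (FObj (Coeq C) (Dom (RGrph C) s)) r \<and>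
        FMor (Eq C) h \<cdot>\<^bsub>RGrph C\<^esub> \<eta> (Dom (RGrph C) s) = s"
      using h by (intro exI[of _ ?h]) (simp add: s' del: RGrph_simps(5))
  next
    fix G h h' assume G: "G \<in> Obj (RGrph C)" and h: "h \<in> Mor (Arr C)" "h' \<in> Mor (Arr C)"
      "Dom (Arr C) h = FObj (Coeq C) G" "Dom (Arr C) h' = FObj (Coeq C) G"
      "Cod (Arr C) h = Cod (Arr C) h'"
      and e: "FMor (Eq C) h \<cdot>\<^bsub>RGrph C\<^esub> \<eta> G = FMor (Eq C) h' \<cdot>\<^bsub>RGrph C\<^esub> \<eta> G"
    have G' [simp]: "G \<in> RGrph_objs C" using G by simp
    have v: "rg_verts C G = Dom C (coeq_of C G)"
      using coequaliser_cocone[OF q[OF G']] by (simp add: rg_verts_def)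
    have "on_dom h = on_dom h'"
      using arg_cong[OF e, of on_verts] h C CE(4)[OF h(1)] CE(4)[OF h(2)] \<eta>(4)[OF G']
      by (elim Mor_Arr_cases) (simp add: v)
    then show "h = h'"
      by - (rule ArrMor_from_coequaliser_ext[OF C q[OF G']], use h in simp_all)
  qed (use \<eta> in simp_all)
  with \<eta>(4) show ?thesis by blast
qed

section \<open>Passage to reflexive graphs and arrows\<close>

text \<open>A morphism from the kernel pair of \<open>G q\<close> to that of \<open>G r\<close> is a
  vertex map \<open>v\<close> such that \<open>G r\<close> after \<open>v\<close> coequalises the
  projections. Full faithfulness at \<open>q\<close> thus asks that each such \<open>v\<close> come
  from a unique square \<open>q -> r\<close>, a condition on \<open>D\<close> and \<open>G\<close>
  free of graphs. \<open>full_faithful_at_EqD\<close> is the reverse passage for existence.\<close>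

lemma full_faithful_at_EqI:
  assumes E: "category E" and kp: "has_kernel_pairs E" and G: "is_functor D E G"
    and q: "q \<in> Mor D" and eq: "eq_of E (FMor G q) = RG p\<^sub>1 p\<^sub>2 e"
    and ex: "\<And>r v. r \<in> Mor D \<Longrightarrow> v \<in> Mor E \<Longrightarrow> Dom E v = FObj G (Dom D q) \<Longrightarrow>
      Cod E v = FObj G (Dom D r) \<Longrightarrow>
      FMor G r \<cdot>\<^bsub>E\<^esub> (v \<cdot>\<^bsub>E\<^esub> p\<^sub>1) = FMor G r \<cdot>\<^bsub>E\<^esub> (v \<cdot>\<^bsub>E\<^esub> p\<^sub>2) \<Longrightarrow>
      \<exists>h k. ArrMor q r h k \<in> Mor (Arr D) \<and> FMor G h = v"
    and un: "\<And>r h k h' k'. ArrMor q r h k \<in> Mor (Arr D) \<Longrightarrow> ArrMor q r h' k' \<in> Mor (Arr D) \<Longrightarrow>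
      FMor G h = FMor G h' \<Longrightarrow> h = h' \<and> k = k'"
  shows "full_faithful_at (RGrph E) (Arr D) (Eq E \<circ>\<^sub>F Arr_func G) q"
proof -
  note [simp] = functor_simps[OF G] q
  note AG = functor_simps[OF is_functor_Arr_func[OF G]]
  note Eq = FMor_Eq[OF E kp AG(4)]
  show ?thesis
  proof (rule full_faithful_atI)
    fix r g assume r: "r \<in> Obj (Arr D)" and g: "g \<in> Mor (RGrph E)"
      "Dom (RGrph E) g = FObj (Eq E \<circ>\<^sub>F Arr_func G) q" "Cod (RGrph E) g = FObj (Eq E \<circ>\<^sub>F Arr_func G) r"
    have r' [simp]: "r \<in> Mor D" using r by simp
    obtain u v where g': "g = RGMor (RG p\<^sub>1 p\<^sub>2 e) (eq_of E (FMor G r)) u v"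
      using g eq by (elim Mor_RGrph_cases) simp
    note v = g(1)[unfolded g', simplified]
    have G1: "FMor G q \<in> Mor E" "FMor G r \<in> Mor E" by simp_all
    note V = eq_of_in_RGrph_objs(2)[OF E kp G1(1)] eq_of_in_RGrph_objs(2)[OF E kp G1(2)]
    have "FMor G r \<cdot>\<^bsub>E\<^esub> (v \<cdot>\<^bsub>E\<^esub> p\<^sub>1) = FMor G r \<cdot>\<^bsub>E\<^esub> (v \<cdot>\<^bsub>E\<^esub> p\<^sub>2)"
      by (rule RGMor_into_eq_of_coequalises[OF E kp G1(2) g(1)[unfolded g']])
    then obtain h k where h: "ArrMor q r h k \<in> Mor (Arr D)" "FMor G h = v"
      using ex[OF r', of v] v V eq by auto
    have "FMor (Eq E) (FMor (Arr_func G) (ArrMor q r h k)) = g"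
      by (rule RGMor_into_eq_of_ext[OF E kp G1(2)])
        (use Eq[OF h(1)] g h(2) in \<open>simp_all add: g' eq del: RGMor_in_Mor\<close>)
    then show "\<exists>s. s \<in> Mor (Arr D) \<and> Dom (Arr D) s = q \<and> Cod (Arr D) s = r \<and>
        FMor (Eq E \<circ>\<^sub>F Arr_func G) s = g"
      using h(1) by (intro exI[of _ "ArrMor q r h k"]) simp
  next
    fix s t assume st: "s \<in> Mor (Arr D)" "t \<in> Mor (Arr D)" "Dom (Arr D) s = q" "Dom (Arr D) t = q"
      "Cod (Arr D) s = Cod (Arr D) t" "FMor (Eq E \<circ>\<^sub>F Arr_func G) s = FMor (Eq E \<circ>\<^sub>F Arr_func G) t"
    obtain r h k h' k' where s': "s = ArrMor q r h k" "t = ArrMor q r h' k'"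
      using st by (elim Mor_Arr_cases) simp
    have "FMor G h = FMor G h'"
      using arg_cong[OF st(6), of on_verts] Eq(2)[OF st(1)] Eq(2)[OF st(2)] by (simp add: s')
    then show "s = t" using un[of r h k h' k'] st s' by simp
  qed
qed

lemma full_faithful_at_EqD:
  assumes E: "category E" and kp: "has_kernel_pairs E" and G: "is_functor D E G"
    and q: "q \<in> Mor D" and eq: "eq_of E (FMor G q) = RG p\<^sub>1 p\<^sub>2 e"
    and ff: "full_faithful_at (RGrph E) (Arr D) (Eq E \<circ>\<^sub>F Arr_func G) q"
    and r: "r \<in> Mor D" and v: "v \<in> Mor E" "Dom E v = FObj G (Dom D q)" "Cod E v = FObj G (Dom D r)"
      "FMor G r \<cdot>\<^bsub>E\<^esub> (v \<cdot>\<^bsub>E\<^esub> p\<^sub>1) = FMor G r \<cdot>\<^bsub>E\<^esub> (v \<cdot>\<^bsub>E\<^esub> p\<^sub>2)"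
  obtains h k where "ArrMor q r h k \<in> Mor (Arr D)" "FMor G h = v"
proof -
  note [simp] = functor_simps[OF G] q
  note AG = functor_simps[OF is_functor_Arr_func[OF G]]
  note Eq = FMor_Eq[OF E kp AG(4)]
  have G1: "FMor G q \<in> Mor E" "FMor G r \<in> Mor E" using r by simp_all
  have RG: "RG p\<^sub>1 p\<^sub>2 e \<in> RGrph_objs E" "Cod E p\<^sub>1 = FObj G (Dom D q)"
    using eq_of_in_RGrph_objs[OF E kp G1(1)] unfolding eq rg_verts_RG by simp_all
  have "\<exists>u. RGMor (RG p\<^sub>1 p\<^sub>2 e) (eq_of E (FMor G r)) u v \<in> Mor (RGrph E)"
    by (rule RGMor_into_eq_of_ex[OF E kp G1(2) RG(1) v(1) _ _ v(4)]) (use v(2,3) RG(2) r in simp_all)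
  then obtain u where u: "RGMor (RG p\<^sub>1 p\<^sub>2 e) (eq_of E (FMor G r)) u v \<in> Mor (RGrph E)" ..
  obtain s where s: "s \<in> Mor (Arr D)" "Dom (Arr D) s = q" "Cod (Arr D) s = r"
    "FMor (Eq E \<circ>\<^sub>F Arr_func G) s = RGMor (RG p\<^sub>1 p\<^sub>2 e) (eq_of E (FMor G r)) u v"
    by (rule full_faithful_at_lift[OF ff u]) (use r eq in simp_all)
  obtain h k where s': "s = ArrMor q r h k" using s by (elim Mor_Arr_cases) simp
  have "FMor G h = v"
    using s(4) Eq(2)[OF s(1)] by (simp add: s')
  then show ?thesis using that[of h k] s(1) s' by simp
qed

lemma is_functor_Eq_Arr_func:
  assumes "category E" "has_kernel_pairs E" "is_functor D E G"
  shows "is_functor (Arr D) (RGrph E) (Eq E \<circ>\<^sub>F Arr_func G)"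
  using is_functor_comp[OF is_functor_Arr_func is_functor_Eq] assms by blast

text \<open>The inductive step for idempotency. The left adjoint sends \<open>H\<close> to
  \<open>F k\<close>, where \<open>k\<close> is the coequaliser of \<open>H\<close>. A vertex map
  \<open>v\<close> comes from some \<open>h\<close> by idempotency in the lower dimension, and it
  remains to factor \<open>r h\<close> through \<open>F k\<close>. This is the preservation of the
  coequaliser \<open>k\<close> by the left adjoint \<open>F\<close>, carried out on transposes in
  \<open>E\<close>.\<close>

lemma full_faithful_at_Arr_Coeq:
  assumes kp: "has_kernel_pairs E" and rc: "has_reflexive_coequalisers E"
    and u: "universal_unit E D F G \<eta>"
    and ff: "\<And>a. a \<in> Obj E \<Longrightarrow> full_faithful_at E D G (FObj F a)"
    and H: "H \<in> RGrph_objs E"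
  shows "full_faithful_at (RGrph E) (Arr D) (Eq E \<circ>\<^sub>F Arr_func G) (FObj (Arr_func F \<circ>\<^sub>F Coeq E) H)"
proof -
  note F = universal_unitD(1)[OF u] and G = universal_unitD(2)[OF u]
  note [simp] = functor_simps[OF F] functor_simps[OF G] universal_unitD(3-5)[OF u]
  note nat = universal_unitD(6)[OF u]
  have E: "category E" by simp
  note red = category_Comp_reduce[OF E]
  obtain d c e where H': "H = RG d c e" using H by (auto simp: RGrph_objs_def)
  note [simp] = H[unfolded H', simplified]
  define k where "k = coeq_of E H"
  have k: "is_coequaliser E d c k"
    using coeq_of_is_coequaliser[OF rc H] by (simp add: k_def H')
  note [simp] = coequaliser_cocone(3,6)[OF k]
  note kdc = coequaliser_cocone(7)[OF k]
  let ?V = "Cod E d" and ?q = "FMor F k"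
  have Gq: "FMor G ?q \<in> Mor E" by simp
  obtain p\<^sub>1 p\<^sub>2 e' where eq: "eq_of E (FMor G ?q) = RG p\<^sub>1 p\<^sub>2 e'" and p: "is_kernel_pair E (FMor G ?q) p\<^sub>1 p\<^sub>2"
    using eq_of_cases[OF E kp Gq] .
  note [simp] = kernel_pair_cone(2-6)[OF p]
  have nat_k: "FMor G ?q \<cdot>\<^bsub>E\<^esub> \<eta> ?V = \<eta> (Cod E k) \<cdot>\<^bsub>E\<^esub> k" using nat[of k] by simp
  have ffV: "full_faithful_at E D G (FObj F ?V)" by (rule ff) simp
  \<comment> \<open>By naturality of the unit, \<open>d\<close> and \<open>c\<close> followed by the
    unit form a cone over \<open>G F k\<close>, so they factor through \<open>p\<^sub>1\<close> and
    \<open>p\<^sub>2\<close>. A condition on these projections thereby becomes one on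
    \<open>d\<close> and \<open>c\<close>.\<close>
  have "FMor G ?q \<cdot>\<^bsub>E\<^esub> (\<eta> ?V \<cdot>\<^bsub>E\<^esub> d) = FMor G ?q \<cdot>\<^bsub>E\<^esub> (\<eta> ?V \<cdot>\<^bsub>E\<^esub> c)"
    by (simp add: red[OF nat_k] category_assoc kdc)
  then obtain t where t: "t \<in> Mor E" "Dom E t = Dom E d" "Cod E t = Dom E p\<^sub>1"
    and pt: "p\<^sub>1 \<cdot>\<^bsub>E\<^esub> t = \<eta> ?V \<cdot>\<^bsub>E\<^esub> d" "p\<^sub>2 \<cdot>\<^bsub>E\<^esub> t = \<eta> ?V \<cdot>\<^bsub>E\<^esub> c"
    using kernel_pair_lift[OF E p, of "\<eta> ?V \<cdot>\<^bsub>E\<^esub> d" "\<eta> ?V \<cdot>\<^bsub>E\<^esub> c"] by auto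
  have "full_faithful_at (RGrph E) (Arr D) (Eq E \<circ>\<^sub>F Arr_func G) ?q"
  proof (rule full_faithful_at_EqI[OF E kp G _ eq])
    fix r v assume r: "r \<in> Mor D" and v: "v \<in> Mor E" "Dom E v = FObj G (Dom D ?q)" "Cod E v = FObj G (Dom D r)"
      "FMor G r \<cdot>\<^bsub>E\<^esub> (v \<cdot>\<^bsub>E\<^esub> p\<^sub>1) = FMor G r \<cdot>\<^bsub>E\<^esub> (v \<cdot>\<^bsub>E\<^esub> p\<^sub>2)"
    obtain h where h: "h \<in> Mor D" "Dom D h = FObj F ?V" "Cod D h = Dom D r" "FMor G h = v"
      by (rule full_faithful_at_lift[OF ffV v(1), of "Dom D r"]) (use r v in simp_all)
    \<comment> \<open>The transpose of \<open>r h\<close>. It coequalises \<open>d\<close> and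
      \<open>c\<close>, hence factors through \<open>k\<close>; the factor \<open>y\<close>
      transposes back to the codomain component \<open>h'\<close> of the required square.\<close>
    let ?x = "FMor G (r \<cdot>\<^bsub>D\<^esub> h) \<cdot>\<^bsub>E\<^esub> \<eta> ?V"
    have "?x \<cdot>\<^bsub>E\<^esub> d = FMor G r \<cdot>\<^bsub>E\<^esub> (v \<cdot>\<^bsub>E\<^esub> p\<^sub>1) \<cdot>\<^bsub>E\<^esub> t"
      using r h v(1-3) t by (simp add: category_assoc pt)
    also have "\<dots> = ?x \<cdot>\<^bsub>E\<^esub> c"
      unfolding v(4) using r h v(1-3) t by (simp add: category_assoc pt)
    finally have xdc: "?x \<cdot>\<^bsub>E\<^esub> d = ?x \<cdot>\<^bsub>E\<^esub> c" .
    obtain y where y: "y \<in> Mor E" "Dom E y = Cod E k" "Cod E y = FObj G (Cod D r)" "y \<cdot>\<^bsub>E\<^esub> k = ?x"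
      by (rule coequaliser_desc[OF E k _ _ xdc]) (use r h v(1-3) in simp_all)
    obtain h' where h': "h' \<in> Mor D" "Dom D h' = FObj F (Dom E y)" "Cod D h' = Cod D r"
      "FMor G h' \<cdot>\<^bsub>E\<^esub> \<eta> (Dom E y) = y"
      using universal_unit_transpose[OF u y(1), of "Cod D r"] r y(3) by auto
    have "FMor G (h' \<cdot>\<^bsub>D\<^esub> ?q) \<cdot>\<^bsub>E\<^esub> \<eta> ?V = FMor G h' \<cdot>\<^bsub>E\<^esub> \<eta> (Cod E k) \<cdot>\<^bsub>E\<^esub> k"
      using h'(1-3) y by (simp add: category_assoc nat_k)
    also have "\<dots> = ?x" using h' y by simp
    finally have "h' \<cdot>\<^bsub>D\<^esub> ?q = r \<cdot>\<^bsub>D\<^esub> h"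
      by - (rule universal_unit_unique[OF u, of ?V], use h h'(1-3) y r in simp_all)
    then show "\<exists>h k'. ArrMor ?q r h k' \<in> Mor (Arr D) \<and> FMor G h = v"
      using h h' y r by (intro exI[of _ h] exI[of _ h']) simp
  next
    fix r h m h' m' assume hm: "ArrMor ?q r h m \<in> Mor (Arr D)" "ArrMor ?q r h' m' \<in> Mor (Arr D)"
      and e: "FMor G h = FMor G h'"
    have h: "h = h'"
      by (rule full_faithful_at_inj[OF ffV G _ _ _ _ _ e]) (use hm in simp_all)
    have mq: "m \<cdot>\<^bsub>D\<^esub> ?q = m' \<cdot>\<^bsub>D\<^esub> ?q" using hm h by simp
    have *: "FMor G n \<cdot>\<^bsub>E\<^esub> \<eta> (Cod E k) \<cdot>\<^bsub>E\<^esub> k = FMor G (n \<cdot>\<^bsub>D\<^esub> ?q) \<cdot>\<^bsub>E\<^esub> \<eta> ?V"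
      if "n \<in> Mor D" "Dom D n = FObj F (Cod E k)" for n
      using that by (simp add: category_assoc nat_k)
    have "FMor G m \<cdot>\<^bsub>E\<^esub> \<eta> (Cod E k) = FMor G m' \<cdot>\<^bsub>E\<^esub> \<eta> (Cod E k)"
      by (rule coequaliser_epi[OF E k]) (use hm *[of m] *[of m'] mq in simp_all)
    then have "m = m'"
      by - (rule universal_unit_unique[OF u, of "Cod E k"], use hm in simp_all)
    with h show "h = h' \<and> m = m'" by simp
  qed simp
  then show ?thesis by (simp add: k_def)
qed

text \<open>The preimage under \<open>G\<close> of the unit after \<open>G x\<close> lifts
  \<open>x\<close> along the counit. The value of \<open>G t\<close> is recorded because equations
  between such lifts are verified by applying \<open>G\<close>, which is faithful on maps out of
  suitable objects.\<close>

lemma coreflection: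
  assumes adj: "is_adjunction C D F G \<eta> \<epsilon>" and x: "x \<in> Mor D" "Dom D x = a" "Cod D x = b"
    and ff: "full_faithful_at C D G a"
  obtains t where "t \<in> Mor D" "Dom D t = a" "Cod D t = FObj F (FObj G b)"
    "\<epsilon> b \<cdot>\<^bsub>D\<^esub> t = x" "FMor G t = \<eta> (FObj G b) \<cdot>\<^bsub>C\<^esub> FMor G x"
proof -
  note u = adjunction_universal_unit[OF adj]
  note F = universal_unitD(1)[OF u] and G = universal_unitD(2)[OF u]
  note [simp] = functor_simps[OF F] functor_simps[OF G] universal_unitD(3-5)[OF u]
  have C: "category C" by simp
  have a: "a \<in> Obj D" and b: "b \<in> Obj D" using x category_Dom_Obj[of D x] category_Cod_Obj[of D x] by simp_all
  note [simp] = a b x adjunction_counit(1-3)[OF adj b]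
  note tri = adjunction_counit(4)[OF adj b]
  obtain t where t: "t \<in> Mor D" "Dom D t = a" "Cod D t = FObj F (FObj G b)"
    "FMor G t = \<eta> (FObj G b) \<cdot>\<^bsub>C\<^esub> FMor G x"
    by (rule full_faithful_at_lift[OF ff, of "\<eta> (FObj G b) \<cdot>\<^bsub>C\<^esub> FMor G x" "FObj F (FObj G b)"]) simp_all
  have "\<epsilon> b \<cdot>\<^bsub>D\<^esub> t = x"
    by (rule full_faithful_at_inj[OF ff G])
      (use t in \<open>simp_all add: category_Comp_reduce[OF C tri]\<close>)
  with t that show ?thesis by blast
qed

text \<open>Let \<open>q\<close> be the coequaliser of \<open>a\<close> and \<open>b\<close> in the
  subcategory. A vertex map \<open>v\<close> comes from some \<open>h\<close>, and
  \<open>r h\<close> must be factored through \<open>q\<close>. As \<open>Cod D r\<close> may lie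
  outside the subcategory, \<open>r h\<close> is replaced by its lift \<open>t\<close> along the
  counit; \<open>t\<close> factors through \<open>q\<close> as \<open>w q\<close>, and the counit
  after \<open>w\<close> completes the square.\<close>

lemma full_faithful_at_regular_epi:
  assumes kp: "has_kernel_pairs E" and adj: "is_adjunction E D F G \<eta> \<epsilon>"
    and ff: "\<And>a. a \<in> Obj E \<Longrightarrow> full_faithful_at E D G (FObj F a)"
    and q: "q \<in> Mor D" and ffq: "full_faithful_at E D G (Dom D q)" "full_faithful_at E D G (Cod D q)"
    and re: "regular_epi (full_subcat_on D {b. full_faithful_at E D G b}) q"
  shows "full_faithful_at (RGrph E) (Arr D) (Eq E \<circ>\<^sub>F Arr_func G) q"
proof -
  note u = adjunction_universal_unit[OF adj]
  note F = universal_unitD(1)[OF u] and G = universal_unitD(2)[OF u]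
  note [simp] = functor_simps[OF F] functor_simps[OF G] universal_unitD(3-5)[OF u] q
  have E: "category E" and D: "category D" by simp_all
  let ?D' = "full_subcat_on D {b. full_faithful_at E D G b}"
  have D': "category ?D'" by simp
  have Gq: "FMor G q \<in> Mor E" by simp
  obtain p\<^sub>1 p\<^sub>2 e where eq: "eq_of E (FMor G q) = RG p\<^sub>1 p\<^sub>2 e" and p: "is_kernel_pair E (FMor G q) p\<^sub>1 p\<^sub>2"
    using eq_of_cases[OF E kp Gq] .
  note [simp] = kernel_pair_cone(2-6)[OF p]
  obtain a b where k: "is_coequaliser ?D' a b q" using re by (auto simp: regular_epi_def)
  have a [simp]: "a \<in> Mor D" "b \<in> Mor D" "Dom D b = Dom D a" "Cod D b = Cod D a" "Dom D q = Cod D a"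
    and ffZ: "full_faithful_at E D G (Dom D a)" and qab: "q \<cdot>\<^bsub>D\<^esub> a = q \<cdot>\<^bsub>D\<^esub> b"
    using coequaliser_cocone[OF k] by simp_all
  have ffA: "full_faithful_at E D G (Cod D a)" using ffq(1) by simp
  have "FMor G q \<cdot>\<^bsub>E\<^esub> FMor G a = FMor G q \<cdot>\<^bsub>E\<^esub> FMor G b"
    using functor_simps(8)[OF G, of a q] functor_simps(8)[OF G, of b q] by (simp add: qab)
  \<comment> \<open>The images \<open>G a\<close> and \<open>G b\<close> factor through the kernel
    pair of \<open>G q\<close>, so the condition on \<open>v\<close> and the projections yields
    \<open>t a = t b\<close> below.\<close>
  then obtain z where z: "z \<in> Mor E" "Dom E z = FObj G (Dom D a)" "Cod E z = Dom E p\<^sub>1"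
    and pz: "p\<^sub>1 \<cdot>\<^bsub>E\<^esub> z = FMor G a" "p\<^sub>2 \<cdot>\<^bsub>E\<^esub> z = FMor G b"
    using kernel_pair_lift[OF E p, of "FMor G a" "FMor G b"] by auto
  show ?thesis
  proof (rule full_faithful_at_EqI[OF E kp G q eq])
    fix r v assume r: "r \<in> Mor D" and v: "v \<in> Mor E" "Dom E v = FObj G (Dom D q)" "Cod E v = FObj G (Dom D r)"
      and rv: "FMor G r \<cdot>\<^bsub>E\<^esub> (v \<cdot>\<^bsub>E\<^esub> p\<^sub>1) = FMor G r \<cdot>\<^bsub>E\<^esub> (v \<cdot>\<^bsub>E\<^esub> p\<^sub>2)"
    obtain h where h: "h \<in> Mor D" "Dom D h = Cod D a" "Cod D h = Dom D r" "FMor G h = v"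
      by (rule full_faithful_at_lift[OF ffA v(1), of "Dom D r"]) (use r v in simp_all)
    let ?b = "Cod D r"
    obtain t where t: "t \<in> Mor D" "Dom D t = Cod D a" "Cod D t = FObj F (FObj G ?b)"
      "\<epsilon> ?b \<cdot>\<^bsub>D\<^esub> t = r \<cdot>\<^bsub>D\<^esub> h" "FMor G t = \<eta> (FObj G ?b) \<cdot>\<^bsub>E\<^esub> FMor G (r \<cdot>\<^bsub>D\<^esub> h)"
      by (rule coreflection[OF adj, of "r \<cdot>\<^bsub>D\<^esub> h" "Cod D a" ?b]) (use r h ffA in simp_all)
    have "FMor G t \<cdot>\<^bsub>E\<^esub> FMor G a = \<eta> (FObj G ?b) \<cdot>\<^bsub>E\<^esub> (FMor G r \<cdot>\<^bsub>E\<^esub> (v \<cdot>\<^bsub>E\<^esub> p\<^sub>1) \<cdot>\<^bsub>E\<^esub> z)"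
      using r h v z by (simp add: t(5) category_assoc pz)
    also have "\<dots> = FMor G t \<cdot>\<^bsub>E\<^esub> FMor G b"
      unfolding rv using r h v z by (simp add: t(5) category_assoc pz)
    finally have "t \<cdot>\<^bsub>D\<^esub> a = t \<cdot>\<^bsub>D\<^esub> b"
      by - (rule full_faithful_at_inj[OF ffZ G], use t(1-3) in simp_all)
    then obtain w where w: "w \<in> Mor D" "Dom D w = Cod D q" "Cod D w = FObj F (FObj G ?b)" "w \<cdot>\<^bsub>D\<^esub> q = t"
      using coequaliser_desc[OF D' k, of t] t(1-3) ff ffA r by auto
    have "\<epsilon> ?b \<cdot>\<^bsub>D\<^esub> w \<cdot>\<^bsub>D\<^esub> q = r \<cdot>\<^bsub>D\<^esub> h"
      using w r t(4) adjunction_counit(1-3)[OF adj, of ?b] by (simp add: category_assoc)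
    then show "\<exists>h k. ArrMor q r h k \<in> Mor (Arr D) \<and> FMor G h = v"
      using r h w adjunction_counit(1-3)[OF adj, of ?b]
      by (intro exI[of _ h] exI[of _ "\<epsilon> ?b \<cdot>\<^bsub>D\<^esub> w"]) simp
  next
    fix r h m h' m' assume hm: "ArrMor q r h m \<in> Mor (Arr D)" "ArrMor q r h' m' \<in> Mor (Arr D)"
      and e: "FMor G h = FMor G h'"
    let ?b = "Cod D r"
    have h: "h = h'"
      by (rule full_faithful_at_inj[OF ffA G _ _ _ _ _ e]) (use hm in simp_all)
    have mq: "m \<cdot>\<^bsub>D\<^esub> q = m' \<cdot>\<^bsub>D\<^esub> q" using hm h by simp
    \<comment> \<open>The coequaliser \<open>q\<close> can be cancelled only against targets in the
      subcategory, so the two candidates \<open>m\<close> and \<open>m'\<close> are compared through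
      their lifts along the counit.\<close>
    obtain t where t: "t \<in> Mor D" "Dom D t = Cod D q" "Cod D t = FObj F (FObj G ?b)"
      "\<epsilon> ?b \<cdot>\<^bsub>D\<^esub> t = m" "FMor G t = \<eta> (FObj G ?b) \<cdot>\<^bsub>E\<^esub> FMor G m"
      by (rule coreflection[OF adj, of m "Cod D q" ?b]) (use hm ffq in simp_all)
    obtain t' where t': "t' \<in> Mor D" "Dom D t' = Cod D q" "Cod D t' = FObj F (FObj G ?b)"
      "\<epsilon> ?b \<cdot>\<^bsub>D\<^esub> t' = m'" "FMor G t' = \<eta> (FObj G ?b) \<cdot>\<^bsub>E\<^esub> FMor G m'"
      by (rule coreflection[OF adj, of m' "Cod D q" ?b]) (use hm ffq in simp_all)
    have Gmq: "FMor G m \<cdot>\<^bsub>E\<^esub> FMor G q = FMor G m' \<cdot>\<^bsub>E\<^esub> FMor G q"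
      using hm functor_simps(8)[OF G, of q m] functor_simps(8)[OF G, of q m'] mq by simp
    have "t \<cdot>\<^bsub>D\<^esub> q = t' \<cdot>\<^bsub>D\<^esub> q"
      by (rule full_faithful_at_inj[OF ffA G])
        (use hm t(1-3) t'(1-3) Gmq in \<open>simp_all add: t(5) t'(5) category_assoc\<close>)
    then have "t = t'"
      by - (rule coequaliser_epi[OF D' k], use t t' ff ffq hm in simp_all)
    with t t' h show "h = h' \<and> m = m'" by simp
  qed
qed

lemma is_iso_ArrD:
  assumes "is_iso (Arr D) s"
  shows "is_iso D (on_dom s)" "is_iso D (on_cod s)"
proof -
  obtain t where t: "s \<in> Mor (Arr D)" "t \<in> Mor (Arr D)" "Dom (Arr D) t = Cod (Arr D) s"
    "Cod (Arr D) t = Dom (Arr D) s" "t \<cdot>\<^bsub>Arr D\<^esub> s = Ide (Arr D) (Dom (Arr D) s)"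
    "s \<cdot>\<^bsub>Arr D\<^esub> t = Ide (Arr D) (Cod (Arr D) s)"
    using is_isoE[OF assms] .
  then obtain f g u v u' v' where "s = ArrMor f g u v" "t = ArrMor g f u' v'"
    by (elim Mor_Arr_cases) simp
  with t show "is_iso D (on_dom s)" "is_iso D (on_cod s)"
    by (auto intro: is_isoI[of _ _ u'] is_isoI[of _ _ v'])
qed

text \<open>The counit at \<open>q\<close> is an isomorphism to \<open>q\<close> from
  \<open>F k\<close>, where \<open>k\<close> is the coequaliser of the kernel pair of
  \<open>G q\<close>. The ends of \<open>q\<close> are therefore isomorphic to values of
  \<open>F\<close>, which have the property by idempotency. The coequaliser property of
  \<open>q\<close> comes from testing full faithfulness against identity arrows.\<close>

lemma full_faithful_at_imp_regular_epi:
  assumes kp: "has_kernel_pairs E" and rc: "has_reflexive_coequalisers E" and u: "universal_unit E D F G \<eta>"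
    and adj': "is_adjunction (RGrph E) (Arr D) (Arr_func F \<circ>\<^sub>F Coeq E) (Eq E \<circ>\<^sub>F Arr_func G) \<eta>' \<epsilon>'"
    and ff: "\<And>a. a \<in> Obj E \<Longrightarrow> full_faithful_at E D G (FObj F a)"
    and q: "q \<in> Mor D" and ffq: "full_faithful_at (RGrph E) (Arr D) (Eq E \<circ>\<^sub>F Arr_func G) q"
  shows "full_faithful_at E D G (Dom D q)" "full_faithful_at E D G (Cod D q)"
    "regular_epi (full_subcat_on D {b. full_faithful_at E D G b}) q"
proof -
  note F = universal_unitD(1)[OF u] and G = universal_unitD(2)[OF u]
  note [simp] = functor_simps[OF F] functor_simps[OF G] universal_unitD(3-5)[OF u] q
  have E: "category E" and D: "category D" by simp_all
  have Gq: "FMor G q \<in> Mor E" by simp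
  obtain p\<^sub>1 p\<^sub>2 e where eq: "eq_of E (FMor G q) = RG p\<^sub>1 p\<^sub>2 e" and p: "is_kernel_pair E (FMor G q) p\<^sub>1 p\<^sub>2"
    using eq_of_cases[OF E kp Gq] .
  note [simp] = kernel_pair_cone(2-6)[OF p]
  let ?k = "coeq_of E (eq_of E (FMor G q))"
  have k: "?k \<in> Mor E"
    using coequaliser_cocone(3)[OF coeq_of_is_coequaliser[OF rc eq_of_in_RGrph_objs(1)[OF E kp Gq]]] .
  have qA: "q \<in> Obj (Arr D)" by simp
  have iso: "is_iso (Arr D) (\<epsilon>' q)"
    by (rule counit_is_iso[OF adj' qA ffq])
  have \<epsilon>q: "\<epsilon>' q \<in> Mor (Arr D)" "Dom (Arr D) (\<epsilon>' q) = FMor F ?k" "Cod (Arr D) (\<epsilon>' q) = q"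
    using adjunction_counit(1-3)[OF adj' qA] by simp_all
  then have c: "Dom D (on_dom (\<epsilon>' q)) = FObj F (Dom E ?k)" "Cod D (on_dom (\<epsilon>' q)) = Dom D q"
    "Dom D (on_cod (\<epsilon>' q)) = FObj F (Cod E ?k)" "Cod D (on_cod (\<epsilon>' q)) = Cod D q"
    using k by (auto elim!: Mor_Arr_cases)
  \<comment> \<open>\<open>full_faithful_at_iso\<close> moves the property from the codomain of an
    isomorphism to its domain; the opposite direction is needed here, hence the passage to the
    inverse.\<close>
  have replete: "full_faithful_at E D G (Cod D i)" if i: "is_iso D i" "full_faithful_at E D G (Dom D i)" for i
  proof -
    obtain j where "i \<in> Mor D" "j \<in> Mor D" "Dom D j = Cod D i" "Cod D j = Dom D i"
      "j \<cdot>\<^bsub>D\<^esub> i = Ide D (Dom D i)" "i \<cdot>\<^bsub>D\<^esub> j = Ide D (Cod D i)"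
      using is_isoE[OF i(1)] .
    moreover from this have "is_iso D j" by (intro is_isoI[of _ _ i]) simp_all
    ultimately show ?thesis using full_faithful_at_iso[OF _ G, of j] i(2) by simp
  qed
  show ffA: "full_faithful_at E D G (Dom D q)"
    using replete[OF is_iso_ArrD(1)[OF iso]] c ff k by simp
  show ffB: "full_faithful_at E D G (Cod D q)"
    using replete[OF is_iso_ArrD(2)[OF iso]] c ff k by simp
  let ?K = "Dom E p\<^sub>1" and ?D' = "full_subcat_on D {b. full_faithful_at E D G b}"
  \<comment> \<open>\<open>a\<close> and \<open>b\<close> are the transposes of the projections of
    the kernel pair of \<open>G q\<close>. Their domain \<open>F ?K\<close> is a value of
    \<open>F\<close>, so the pair lies in the subcategory.\<close>
  obtain a where a [simp]: "a \<in> Mor D" "Dom D a = FObj F ?K" "Cod D a = Dom D q"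
    and Ga: "FMor G a \<cdot>\<^bsub>E\<^esub> \<eta> ?K = p\<^sub>1"
    using universal_unit_transpose[OF u, of p\<^sub>1 "Dom D q"] by auto
  obtain b where b [simp]: "b \<in> Mor D" "Dom D b = FObj F ?K" "Cod D b = Dom D q"
    and Gb: "FMor G b \<cdot>\<^bsub>E\<^esub> \<eta> ?K = p\<^sub>2"
    using universal_unit_transpose[OF u, of p\<^sub>2 "Dom D q"] by auto
  have ffK: "full_faithful_at E D G (FObj F ?K)" by (rule ff) simp
  have "is_coequaliser ?D' a b q"
  proof (rule is_coequaliserI)
    have "q \<cdot>\<^bsub>D\<^esub> a = q \<cdot>\<^bsub>D\<^esub> b"
      by (rule universal_unit_unique[OF u, of ?K])
        (use kernel_pair_cone(7)[OF p] in \<open>simp_all add: category_assoc Ga Gb\<close>)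
    then show "q \<cdot>\<^bsub>?D'\<^esub> a = q \<cdot>\<^bsub>?D'\<^esub> b" by simp
  next
    fix x assume x: "x \<in> Mor ?D'" "Dom ?D' x = Cod ?D' a" "x \<cdot>\<^bsub>?D'\<^esub> a = x \<cdot>\<^bsub>?D'\<^esub> b"
    have xab: "FMor G x \<cdot>\<^bsub>E\<^esub> FMor G a = FMor G x \<cdot>\<^bsub>E\<^esub> FMor G b"
      using x functor_simps(8)[OF G, of a x] functor_simps(8)[OF G, of b x] by simp
    have "FMor G x \<cdot>\<^bsub>E\<^esub> p\<^sub>1 = FMor G x \<cdot>\<^bsub>E\<^esub> FMor G a \<cdot>\<^bsub>E\<^esub> \<eta> ?K"
      using x by (simp add: category_assoc Ga)
    also have "\<dots> = FMor G x \<cdot>\<^bsub>E\<^esub> p\<^sub>2"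
      unfolding xab using x by (simp add: category_assoc Gb)
    finally have x12: "FMor G x \<cdot>\<^bsub>E\<^esub> p\<^sub>1 = FMor G x \<cdot>\<^bsub>E\<^esub> p\<^sub>2" .
    \<comment> \<open>A square from \<open>q\<close> to an identity arrow is a map together with a
      factorisation through \<open>q\<close>; fullness at \<open>q\<close> thus yields the factor of
      \<open>x\<close>.\<close>
    let ?r = "Ide D (Cod D x)"
    obtain h k where h: "ArrMor q ?r h k \<in> Mor (Arr D)" "FMor G h = FMor G x"
      by (rule full_faithful_at_EqD[OF E kp G q eq ffq, of ?r "FMor G x"]) (use x x12 in simp_all)
    have "h = x"
      by (rule full_faithful_at_inj[OF ffA G _ _ _ _ _ h(2)]) (use h(1) x in simp_all)
    then show "\<exists>w. w \<in> Mor ?D' \<and> Dom ?D' w = Cod ?D' q \<and> Cod ?D' w = Cod ?D' x \<and> w \<cdot>\<^bsub>?D'\<^esub> q = x"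
      using h(1) x ffB by (intro exI[of _ k]) simp
  next
    fix w w' assume w: "w \<in> Mor ?D'" "w' \<in> Mor ?D'" "Dom ?D' w = Cod ?D' q" "Dom ?D' w' = Cod ?D' q"
      "Cod ?D' w = Cod ?D' w'" "w \<cdot>\<^bsub>?D'\<^esub> q = w' \<cdot>\<^bsub>?D'\<^esub> q"
    \<comment> \<open>The two squares share their domain component, and \<open>Eq\<close> acts on
      squares with given ends through that component alone, so faithfulness at \<open>q\<close>
      identifies them.\<close>
    let ?r = "Ide D (Cod D w)"
    have "ArrMor q ?r (w \<cdot>\<^bsub>D\<^esub> q) w \<in> Mor (Arr D)" "ArrMor q ?r (w \<cdot>\<^bsub>D\<^esub> q) w' \<in> Mor (Arr D)"
      using w by simp_all
    then have "ArrMor q ?r (w \<cdot>\<^bsub>D\<^esub> q) w = ArrMor q ?r (w \<cdot>\<^bsub>D\<^esub> q) w'"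
      by - (rule full_faithful_at_inj[OF ffq is_functor_Eq_Arr_func[OF E kp G]], simp_all add: Eq_def)
    then show "w = w'" by simp
  qed (use ffA ffB ffK in simp_all)
  then show "regular_epi ?D' q" by (auto simp: regular_epi_def)
qed

section \<open>The \<open>n\<close>-fold equivalence\<close>

text \<open>On the right, regularity still refers to coequalisers in the subcategory. The two sides
  are equal as records because \<open>full_subcat_on\<close> alters only objects and morphisms and
  leaves the total structure maps untouched.\<close>

lemma Reg_full_subcat_on:
  "Reg (full_subcat_on C S) = full_subcat_on (Arr C)
     {f. Dom C f \<in> S \<and> Cod C f \<in> S \<and> regular_epi (full_subcat_on C S) f}"
  unfolding Reg_def
proof (rule cat.equality)
  show "Mor (full_subcat_on (Arr (full_subcat_on C S)) {f. regular_epi (full_subcat_on C S) f}) =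
    Mor (full_subcat_on (Arr C)
      {f. Dom C f \<in> S \<and> Cod C f \<in> S \<and> regular_epi (full_subcat_on C S) f})" (is "?L = ?R")
  proof (rule set_eqI)
    fix s show "s \<in> ?L \<longleftrightarrow> s \<in> ?R"
      by (cases s) (auto simp: Arr_def)
  qed
qed (auto simp: full_subcat_on_def Arr_def)

lemma full_subcat_on_cong:
  assumes "category C" "\<And>a. a \<in> Obj C \<Longrightarrow> a \<in> S \<longleftrightarrow> a \<in> T"
  shows "full_subcat_on C S = full_subcat_on C T"
  using assms by (intro cat.equality) auto

lemma n_fold_Suc:
  "Arr_n (Suc n) X = Arr (Arr_n n X)" "RGrph_n (Suc n) X = RGrph (RGrph_n n X)"
  "Reg_n (Suc n) X = Reg (Reg_n n X)"
  by (simp_all add: Arr_n_def RGrph_n_def Reg_n_def)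

lemma RGrph_n_properties:
  assumes X: "exact_Maltsev_category X"
  shows "category (RGrph_n n X) \<and> has_kernel_pairs (RGrph_n n X) \<and> has_reflexive_coequalisers (RGrph_n n X)"
proof (induction n)
  case 0
  have R: "regular_category X"
    using X by (simp add: exact_Maltsev_category_def Barr_exact_category_def)
  then have "category X" by (simp add: regular_category_def)
  then show ?case
    using regular_category_has_kernel_pairs[OF R] exact_Maltsev_has_reflexive_coequalisers[OF X]
    by (simp add: RGrph_n_def category_base has_kernel_pairs_base has_reflexive_coequalisers_base)
next
  case (Suc n)
  then show ?case
    by (simp add: n_fold_Suc has_kernel_pairs_RGrph has_reflexive_coequalisers_RGrph)
qed

text \<open>The parts are proved jointly: idempotency in dimension \<open>n\<close> gives
  idempotency in dimension \<open>n + 1\<close> and enters both directions of the description of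
  \<open>Reg_n\<close>. That description is an equality of categories, so \<open>Reg\<close> can be
  applied to it again. In dimension 0 the adjunction is the identity and every object
  qualifies.\<close>

lemma n_fold_idempotent_adjunction:
  assumes X: "exact_Maltsev_category X"
  shows "(\<exists>\<eta>. universal_unit (RGrph_n n X) (Arr_n n X) (Coeq_n n X) (Eq_n n X) \<eta>) \<and>
    (\<forall>G \<in> Obj (RGrph_n n X).
       full_faithful_at (RGrph_n n X) (Arr_n n X) (Eq_n n X) (FObj (Coeq_n n X) G)) \<and>
    Reg_n n X = full_subcat_on (Arr_n n X) {A. full_faithful_at (RGrph_n n X) (Arr_n n X) (Eq_n n X) A}"
proof (induction n)
  case 0
  have B: "category (base X)"
    using RGrph_n_properties[OF X, of 0] by (simp add: RGrph_n_def)
  have ff: "full_faithful_at (base X) (base X) id_func A" for A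
    by (rule full_faithful_atI) auto
  have "base X = full_subcat_on (base X) {A. full_faithful_at (base X) (base X) id_func A}"
    using B ff by (intro cat.equality) auto
  then show ?case
    using universal_unit_id[OF B] ff by (auto simp: RGrph_n_def Arr_n_def Reg_n_def)
next
  case (Suc n)
  let ?E = "RGrph_n n X" and ?D = "Arr_n n X" and ?F = "Coeq_n n X" and ?G = "Eq_n n X"
  let ?F' = "Arr_func ?F \<circ>\<^sub>F Coeq ?E" and ?G' = "Eq ?E \<circ>\<^sub>F Arr_func ?G"
  have E: "category ?E" and kp: "has_kernel_pairs ?E" and rc: "has_reflexive_coequalisers ?E"
    using RGrph_n_properties[OF X] by simp_all
  obtain \<eta> where u: "universal_unit ?E ?D ?F ?G \<eta>"
    and ff: "\<And>a. a \<in> Obj ?E \<Longrightarrow> full_faithful_at ?E ?D ?G (FObj ?F a)"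
    and Reg: "Reg_n n X = full_subcat_on ?D {b. full_faithful_at ?E ?D ?G b}"
    using Suc by auto
  have D: "category ?D" using functor_simps(2)[OF universal_unitD(1)[OF u]] .
  obtain \<epsilon> where adj: "is_adjunction ?E ?D ?F ?G \<eta> \<epsilon>"
    using universal_unit_adjunction[OF u] ..
  \<comment> \<open>The adjunction of \<open>Coeq\<close> and \<open>Eq\<close> over
    \<open>n\<close>-fold graphs is composed with the arrow version of the previous one, matching
    the recursions of \<open>Coeq_n\<close> and \<open>Eq_n\<close>.\<close>
  obtain \<eta>' where u': "universal_unit (RGrph ?E) (Arr ?D) ?F' ?G' \<eta>'"
    using universal_unit_comp[OF _ universal_unit_Arr[OF u]] universal_unit_Coeq_Eq[OF E kp rc] by blast
  obtain \<epsilon>' where adj': "is_adjunction (RGrph ?E) (Arr ?D) ?F' ?G' \<eta>' \<epsilon>'"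
    using universal_unit_adjunction[OF u'] ..
  have "full_faithful_at (RGrph ?E) (Arr ?D) ?G' (FObj ?F' H)" if "H \<in> Obj (RGrph ?E)" for H
    using full_faithful_at_Arr_Coeq[OF kp rc u ff] that by simp
  moreover have "Reg (Reg_n n X) = full_subcat_on (Arr ?D) {q. full_faithful_at (RGrph ?E) (Arr ?D) ?G' q}"
    unfolding Reg Reg_full_subcat_on
  proof (rule full_subcat_on_cong)
    fix q assume "q \<in> Obj (Arr ?D)"
    then have q: "q \<in> Mor ?D" by simp
    show "q \<in> {q. Dom ?D q \<in> {b. full_faithful_at ?E ?D ?G b} \<and> Cod ?D q \<in> {b. full_faithful_at ?E ?D ?G b} \<and>
          regular_epi (full_subcat_on ?D {b. full_faithful_at ?E ?D ?G b}) q} \<longleftrightarrow>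
        q \<in> {q. full_faithful_at (RGrph ?E) (Arr ?D) ?G' q}"
      using full_faithful_at_regular_epi[OF kp adj ff q]
        full_faithful_at_imp_regular_epi[OF kp rc u adj' ff q] by blast
  qed (use D in simp)
  ultimately show ?case
    using u' by (auto simp: n_fold_Suc)
qed

theorem mainTheorem1:
  fixes X :: "('o, 'm) cat" and n :: nat
  assumes "exact_Maltsev_category X" and "n \<ge> 1"
  shows "(\<exists>\<eta> \<epsilon>. is_adjunction (RGrph_n n X) (Arr_n n X) (Coeq_n n X) (Eq_n n X) \<eta> \<epsilon>) \<and>
    (\<forall>\<eta> \<epsilon>. is_adjunction (RGrph_n n X) (Arr_n n X) (Coeq_n n X) (Eq_n n X) \<eta> \<epsilon> \<longrightarrow>
       restricts_to_equivalence (RGrph_n n X) (Arr_n n X) (Coeq_n n X) (Eq_n n X) \<eta> \<epsilon>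
         (EERel_n n X) (Reg_n n X))"
proof (intro conjI allI impI)
  note idem = n_fold_idempotent_adjunction[OF assms(1), of n]
  show "\<exists>\<eta> \<epsilon>. is_adjunction (RGrph_n n X) (Arr_n n X) (Coeq_n n X) (Eq_n n X) \<eta> \<epsilon>"
    using idem universal_unit_adjunction by blast
  \<comment> \<open>The unit and counit are arbitrary here: idempotency and the description of
    \<open>Reg_n\<close> refer to the two functors alone.\<close>
  fix \<eta> \<epsilon> assume "is_adjunction (RGrph_n n X) (Arr_n n X) (Coeq_n n X) (Eq_n n X) \<eta> \<epsilon>"
  then show "restricts_to_equivalence (RGrph_n n X) (Arr_n n X) (Coeq_n n X) (Eq_n n X) \<eta> \<epsilon>
      (EERel_n n X) (Reg_n n X)"
    using idempotent_adjunction_restricts[of "RGrph_n n X" "Arr_n n X"] idem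
    unfolding EERel_n_def by auto
qed

end
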